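(* Let $\alpha\in\mathbb{Z}^m$. Then, for every $i\in I$, $$\ell(\alpha)=\#\big(\Gamma(\alpha)/\equiv_i\big).$$ In particular, $\#(\Gamma(\alpha)/\equiv_i)$ does not depend on $i$.
   Context: Let $\mathbb{F}$ be a finite field and $\mathcal{X}$ a projective, non-singular, geometrically irreducible algebraic curve over $\mathbb{F}$ with function field $\mathbb{F}(\mathcal{X})$. Let $m\geq 2$ and let $\mathbf{Q}=(Q_1,\ldots,Q_m)$ be an $m$-tuple of pairwise distinct $\mathbb{F}$-rational points of $\mathcal{X}$. Standing assumption: $\#\mathbb{F}\geq m$. Put $I=\{1,\ldots,m\}$. Let $R_{\mathbf{Q}}$ be the ring of functions of $\mathcal{X}$ that are regular outside $\{Q_1,\ldots,Q_m\}$. For $f\in R_{\mathbf{Q}}\setminus\{0\}$ put $\rho_{\mathbf{Q}}(f)=(-v_{Q_1}(f),\ldots,-v_{Q_m}(f))\in\mathbb{Z}^m$, where $v_{Q_i}$ is the valuation at $Q_i$. The generalized Weierstrass semigroup is $\widehat{H}(\mathbf{Q})=\{\rho_{\mathbf{Q}}(f): f\in R_{\mathbf{Q}}\setminus\{0\}\}\subseteq\mathbb{Z}^m$. For $\alpha\in\mathbb{Z}^m$, $\ell(\alpha)$ is the $\mathbb{F}$-dimension of the Riemann-Roch space $\mathcal{L}(\alpha)$ of the divisor $\sum_{i=1}^m\alpha_iQ_i$. For $\alpha\in\mathbb{Z}^m$ and a non-empty $J\subsetneq I$, set $\nabla_J(\alpha)=\{\beta\in\widehat{H}(\mathbf{Q}):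 \beta_j=\alpha_j\ \forall j\in J,\ \beta_i<\alpha_i\ \forall i\in I\setminus J\}$. An element $\alpha\in\widehat{H}(\mathbf{Q})$ is absolute maximal if $\nabla_J(\alpha)=\emptyset$ for every non-empty $J\subsetneq I$; $\Gamma(\mathbf{Q})$ is the set of absolute maximal elements. For $\alpha\in\mathbb{Z}^m$, $\Gamma(\alpha)=\{\beta\in\Gamma(\mathbf{Q}):\beta\leq\alpha\}$, where $\leq$ is the coordinatewise partial order on $\mathbb{Z}^m$. For $i\in I$, $\equiv_i$ is the equivalence relation on $\Gamma(\alpha)$ given by $\beta\equiv_i\beta'$ if and only if $\beta_i=\beta'_i$, and $\Gamma(\alpha)/\equiv_i$ is its set of equivalence classes. *)

theory Defs
  imports "HOL-Algebra.Algebra" "HOL-Algebra.Algebraic_Closure_Type" "HOL-Library.Poly_Mapping"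
    "HOL-Library.Cardinality"
begin

section \<open>Projective curves over a field\<close>

text \<open>
  The base field is a type \<open>'a\<close> and its algebraic closure is the type \<open>'a alg_closure\<close>. The finite
  type \<open>'n\<close> indexes homogeneous coordinates, so the ambient projective space has dimension
  \<open>CARD('n) - 1\<close>. Polynomials are finitely supported maps from monomials to coefficients.
\<close>

type_synonym ('n, 'k) mpol = "('n \<Rightarrow>\<^sub>0 nat) \<Rightarrow>\<^sub>0 'k"

definition mpol_eval :: "('n::finite, 'k::comm_ring_1) mpol \<Rightarrow> ('n \<Rightarrow> 'k) \<Rightarrow> 'k" where
  "mpol_eval p x =
     (\<Sum>u\<in>Poly_Mapping.keys p. Poly_Mapping.lookup p u * (\<Prod>i\<in>UNIV. x i ^ Poly_Mapping.lookup u i))"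

text \<open>The zero polynomial is homogeneous of every degree.\<close>

definition homogeneous_deg :: "nat \<Rightarrow> ('n::finite, 'k::zero) mpol \<Rightarrow> bool" where
  "homogeneous_deg d p \<longleftrightarrow>
     (\<forall>u\<in>Poly_Mapping.keys p. (\<Sum>i\<in>UNIV. Poly_Mapping.lookup u i) = d)"

definition homogeneous :: "('n::finite, 'k::zero) mpol \<Rightarrow> bool" where
  "homogeneous p \<longleftrightarrow> (\<exists>d. homogeneous_deg d p)"

text \<open>A point of projective space is the set of all its homogeneous coordinate vectors.\<close>

type_synonym ('n, 'k) ppoint = "('n \<Rightarrow> 'k) set"

definition ppoint_of :: "('n \<Rightarrow> 'k::field) \<Rightarrow> ('n, 'k) ppoint" where
  "ppoint_of x = {(\<lambda>i. c * x i) |c. c \<noteq> 0}"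

definition proj_space :: "('n, 'k::field) ppoint set" where
  "proj_space = {ppoint_of x |x. x \<noteq> (\<lambda>_. 0)}"

definition vanishes_at :: "('n::finite, 'k::field) mpol \<Rightarrow> ('n, 'k) ppoint \<Rightarrow> bool" where
  "vanishes_at p P \<longleftrightarrow> (\<forall>x\<in>P. mpol_eval p x = 0)"

definition zero_locus :: "('n::finite, 'k::field) mpol set \<Rightarrow> ('n, 'k) ppoint set" where
  "zero_locus S = {P \<in> proj_space. \<forall>p\<in>S. vanishes_at p P}"

definition zariski_closed :: "('n::finite, 'k::field) ppoint set \<Rightarrow> bool" where
  "zariski_closed Y \<longleftrightarrow> (\<exists>S. (\<forall>p\<in>S. homogeneous p) \<and> Y = zero_locus S)"

definition zariski_irreducible :: "('n::finite, 'k::field) ppoint set \<Rightarrow> bool" where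
  "zariski_irreducible C \<longleftrightarrow> C \<noteq> {} \<and>
     (\<forall>Y Z. zariski_closed Y \<and> zariski_closed Z \<and> C \<subseteq> Y \<union> Z \<longrightarrow> C \<subseteq> Y \<or> C \<subseteq> Z)"

definition base_change :: "('n, 'a::field) mpol \<Rightarrow> ('n, 'a alg_closure) mpol" where
  "base_change = Poly_Mapping.map to_ac"

text \<open>
  A curve is represented by its set of geometric points. Its equations have coefficients in the
  base field.
\<close>

definition projective_over_base :: "('n::finite, 'a::field alg_closure) ppoint set \<Rightarrow> bool" where
  "projective_over_base C \<longleftrightarrow>
     (\<exists>S :: ('n, 'a) mpol set. (\<forall>p\<in>S. homogeneous p) \<and> C = zero_locus (base_change ` S))"

definition rational_points :: "('n::finite, 'a::field alg_closure) ppoint set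
    \<Rightarrow> ('n, 'a alg_closure) ppoint set" where
  "rational_points C = {P \<in> C. \<exists>x :: 'n \<Rightarrow> 'a. x \<noteq> (\<lambda>_. 0) \<and> P = ppoint_of (\<lambda>i. to_ac (x i))}"


section \<open>The function field\<close>

definition vanishes_on :: "('n::finite, 'a::field) mpol \<Rightarrow> ('n, 'a alg_closure) ppoint set \<Rightarrow> bool" where
  "vanishes_on p C \<longleftrightarrow> (\<forall>P\<in>C. vanishes_at (base_change p) P)"

text \<open>
  A rational function over the base field is a fraction \<open>g / h\<close> of homogeneous polynomials of
  the same degree over the base field, with \<open>h\<close> not vanishing identically on \<open>C\<close>. Two fractions
  \<open>g / h\<close> and \<open>g' / h'\<close> are identified if \<open>g * h' - g' * h\<close> vanishes on \<open>C\<close>.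
\<close>

definition fractions :: "('n::finite, 'a::field alg_closure) ppoint set
    \<Rightarrow> (('n, 'a) mpol \<times> ('n, 'a) mpol) set" where
  "fractions C = {(g, h). (\<exists>d. homogeneous_deg d g \<and> homogeneous_deg d h) \<and> \<not> vanishes_on h C}"

definition frac_rel :: "('n::finite, 'a::field alg_closure) ppoint set
    \<Rightarrow> ((('n, 'a) mpol \<times> ('n, 'a) mpol) \<times> (('n, 'a) mpol \<times> ('n, 'a) mpol)) set" where
  "frac_rel C = {((g, h), (g', h')). (g, h) \<in> fractions C \<and> (g', h') \<in> fractions C \<and>
     vanishes_on (g * h' - g' * h) C}"

type_synonym ('n, 'a) ratfun = "(('n, 'a) mpol \<times> ('n, 'a) mpol) set"

definition ratfun :: "('n::finite, 'a::field alg_closure) ppoint set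
    \<Rightarrow> ('n, 'a) mpol \<Rightarrow> ('n, 'a) mpol \<Rightarrow> ('n, 'a) ratfun" where
  "ratfun C g h = frac_rel C `` {(g, h)}"

definition function_field :: "('n::finite, 'a::field alg_closure) ppoint set
    \<Rightarrow> ('n, 'a) ratfun ring" where
  "function_field C = \<lparr>
     carrier = fractions C // frac_rel C,
     monoid.mult = (\<lambda>A B. \<Union>(g, h)\<in>A. \<Union>(g', h')\<in>B. ratfun C (g * g') (h * h')),
     one = ratfun C 1 1,
     ring.zero = ratfun C 0 1,
     add = (\<lambda>A B. \<Union>(g, h)\<in>A. \<Union>(g', h')\<in>B. ratfun C (g * h' + g' * h) (h * h'))\<rparr>"

definition constant_functions :: "('n::finite, 'a::field alg_closure) ppoint set
    \<Rightarrow> ('n, 'a) ratfun set" where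
  "constant_functions C = range (\<lambda>c. ratfun C (Poly_Mapping.single 0 c) 1)"

text \<open>
  The dimension of \<open>C\<close> is the transcendence degree of its function field over the constants; it
  equals one iff some single element is a transcendence basis.
\<close>

definition one_dimensional :: "('n::finite, 'a::field alg_closure) ppoint set \<Rightarrow> bool" where
  "one_dimensional C \<longleftrightarrow>
     (\<exists>x\<in>carrier (function_field C).
        ring.transcendental (function_field C) (constant_functions C) x \<and>
        (\<forall>y\<in>carrier (function_field C).
           ring.algebraic (function_field C)
             (generate_field (function_field C) (insert x (constant_functions C))) y))"


section \<open>Local rings, valuations and divisors\<close>

text \<open>
  The local ring at a geometric point \<open>P\<close>, as a subring of the function field over the base field,
  is the local ring of the closed point below \<open>P\<close>; it is the same for all Galois conjugates of \<open>P\<close>.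
\<close>

definition local_ring_at :: "('n::finite, 'a::field alg_closure) ppoint set
    \<Rightarrow> ('n, 'a alg_closure) ppoint \<Rightarrow> ('n, 'a) ratfun set" where
  "local_ring_at C P = {ratfun C g h |g h. (g, h) \<in> fractions C \<and> \<not> vanishes_at (base_change h) P}"

definition max_ideal_at :: "('n::finite, 'a::field alg_closure) ppoint set
    \<Rightarrow> ('n, 'a alg_closure) ppoint \<Rightarrow> ('n, 'a) ratfun set" where
  "max_ideal_at C P = {ratfun C g h |g h. (g, h) \<in> fractions C \<and>
     \<not> vanishes_at (base_change h) P \<and> vanishes_at (base_change g) P}"

definition uniformizer_at :: "('n::finite, 'a::field alg_closure) ppoint set
    \<Rightarrow> ('n, 'a alg_closure) ppoint \<Rightarrow> ('n, 'a) ratfun \<Rightarrow> bool" where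
  "uniformizer_at C P t \<longleftrightarrow> t \<in> max_ideal_at C P \<and>
     max_ideal_at C P = (\<lambda>a. t \<otimes>\<^bsub>function_field C\<^esub> a) ` local_ring_at C P"

text \<open>
  Non-singular means that all local rings are regular. The local rings of closed points of a curve
  have Krull dimension one, so regularity says that the maximal ideal has one generator. Over a
  perfect base field this agrees with smoothness.
\<close>

definition nonsingular_curve :: "('n::finite, 'a::field alg_closure) ppoint set \<Rightarrow> bool" where
  "nonsingular_curve C \<longleftrightarrow> one_dimensional C \<and> (\<forall>P\<in>C. \<exists>t. uniformizer_at C P t)"

text \<open>
  Irreducibility refers to the geometric points, hence is geometric irreducibility.
\<close>

definition smooth_projective_curve :: "('n::finite, 'a::field alg_closure) ppoint set \<Rightarrow> bool" where
  "smooth_projective_curve C \<longleftrightarrow>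
     projective_over_base C \<and> zariski_irreducible C \<and> nonsingular_curve C"

text \<open>The valuation is only meaningful for non-zero rational functions.\<close>

definition valuation_at :: "('n::finite, 'a::field alg_closure) ppoint set
    \<Rightarrow> ('n, 'a alg_closure) ppoint \<Rightarrow> ('n, 'a) ratfun \<Rightarrow> int" where
  "valuation_at C P f = (THE n. \<exists>t u. uniformizer_at C P t \<and>
     u \<in> local_ring_at C P - max_ideal_at C P \<and>
     f = u \<otimes>\<^bsub>function_field C\<^esub> (t [^]\<^bsub>function_field C\<^esub> (n::int)))"

text \<open>
  A divisor is given by its coefficients at geometric points. Those over the base field are constant
  on Galois orbits, as is automatic for divisors supported at rational points.
\<close>

definition riemann_roch_space :: "('n::finite, 'a::field alg_closure) ppoint set
    \<Rightarrow> (('n, 'a alg_closure) ppoint \<Rightarrow> int) \<Rightarrow> ('n, 'a) ratfun set" where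
  "riemann_roch_space C D = {f \<in> carrier (function_field C).
     f = \<zero>\<^bsub>function_field C\<^esub> \<or> (\<forall>P\<in>C. valuation_at C P f + D P \<ge> 0)}"


section \<open>Generalized Weierstrass semigroups\<close>

text \<open>The index set \<open>I\<close> is the finite type \<open>'m\<close>, so that integer tuples are functions \<open>'m \<Rightarrow> int\<close>.\<close>

definition divisor_of :: "('m::finite \<Rightarrow> ('n, 'a::field alg_closure) ppoint) \<Rightarrow> ('m \<Rightarrow> int)
    \<Rightarrow> ('n, 'a alg_closure) ppoint \<Rightarrow> int" where
  "divisor_of Q \<alpha> P = (\<Sum>i\<in>UNIV. if P = Q i then \<alpha> i else 0)"

definition RR :: "('n::finite, 'a::field alg_closure) ppoint set
    \<Rightarrow> ('m::finite \<Rightarrow> ('n, 'a alg_closure) ppoint) \<Rightarrow> ('m \<Rightarrow> int) \<Rightarrow> ('n, 'a) ratfun set" where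
  "RR C Q \<alpha> = riemann_roch_space C (divisor_of Q \<alpha>)"

definition ell :: "('n::finite, 'a::field alg_closure) ppoint set
    \<Rightarrow> ('m::finite \<Rightarrow> ('n, 'a alg_closure) ppoint) \<Rightarrow> ('m \<Rightarrow> int) \<Rightarrow> nat" where
  "ell C Q \<alpha> = ring.dim (function_field C) (constant_functions C) (RR C Q \<alpha>)"

definition regular_outside :: "('n::finite, 'a::field alg_closure) ppoint set
    \<Rightarrow> ('m \<Rightarrow> ('n, 'a alg_closure) ppoint) \<Rightarrow> ('n, 'a) ratfun set" where
  "regular_outside C Q = {f \<in> carrier (function_field C). \<forall>P\<in>C - range Q. f \<in> local_ring_at C P}"

definition rho :: "('n::finite, 'a::field alg_closure) ppoint set
    \<Rightarrow> ('m \<Rightarrow> ('n, 'a alg_closure) ppoint) \<Rightarrow> ('n, 'a) ratfun \<Rightarrow> 'm \<Rightarrow> int" where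
  "rho C Q f = (\<lambda>i. - valuation_at C (Q i) f)"

definition weierstrass_semigroup :: "('n::finite, 'a::field alg_closure) ppoint set
    \<Rightarrow> ('m \<Rightarrow> ('n, 'a alg_closure) ppoint) \<Rightarrow> ('m \<Rightarrow> int) set" where
  "weierstrass_semigroup C Q = rho C Q ` (regular_outside C Q - {\<zero>\<^bsub>function_field C\<^esub>})"

definition nabla :: "('n::finite, 'a::field alg_closure) ppoint set
    \<Rightarrow> ('m \<Rightarrow> ('n, 'a alg_closure) ppoint) \<Rightarrow> 'm set \<Rightarrow> ('m \<Rightarrow> int) \<Rightarrow> ('m \<Rightarrow> int) set" where
  "nabla C Q J \<alpha> = {\<beta> \<in> weierstrass_semigroup C Q. (\<forall>j\<in>J. \<beta> j = \<alpha> j) \<and> (\<forall>i\<in>- J. \<beta> i < \<alpha> i)}"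

definition absolute_maximals :: "('n::finite, 'a::field alg_closure) ppoint set
    \<Rightarrow> ('m \<Rightarrow> ('n, 'a alg_closure) ppoint) \<Rightarrow> ('m \<Rightarrow> int) set" where
  "absolute_maximals C Q =
     {\<alpha> \<in> weierstrass_semigroup C Q. \<forall>J. J \<noteq> {} \<and> J \<subset> UNIV \<longrightarrow> nabla C Q J \<alpha> = {}}"

definition maximals_below :: "('n::finite, 'a::field alg_closure) ppoint set
    \<Rightarrow> ('m \<Rightarrow> ('n, 'a alg_closure) ppoint) \<Rightarrow> ('m \<Rightarrow> int) \<Rightarrow> ('m \<Rightarrow> int) set" where
  "maximals_below C Q \<alpha> = {\<beta> \<in> absolute_maximals C Q. \<beta> \<le> \<alpha>}"

definition coord_equiv :: "('m \<Rightarrow> int) set \<Rightarrow> 'm \<Rightarrow> (('m \<Rightarrow> int) \<times> ('m \<Rightarrow> int)) set" where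
  "coord_equiv B i = {(\<beta>, \<beta>') \<in> B \<times> B. \<beta> i = \<beta>' i}"

end

theory Submission
  imports Defs "HOL-Library.Countable_Set"
begin

text \<open>
  The number \<open>\<ell>(\<alpha>)\<close> is computed by filtering the Riemann-Roch space \<open>L(\<alpha>)\<close> by the pole order at
  one of the points \<open>Q\<^sub>i\<close>. Since \<open>Q\<^sub>i\<close> is rational, two functions of the same pole order at \<open>Q\<^sub>i\<close>
  become, after subtracting a constant multiple of one from the other, a function of smaller pole
  order. Hence \<open>\<ell>(\<alpha>)\<close> is the number of pole orders at \<open>Q\<^sub>i\<close> of non-zero elements of \<open>L(\<alpha>)\<close>
  (\<open>dimension_RR\<close>). It remains to see that these pole orders are exactly the \<open>i\<close>-th coordinates
  of the elements of \<open>\<Gamma>(\<alpha>)\<close> (\<open>values_of_maximals\<close>). Elements of \<open>\<Gamma>(\<alpha>)\<close> are pole vectors of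
  functions in \<open>L(\<alpha>)\<close>. Conversely, among the functions in \<open>L(\<alpha>)\<close> with a given pole order at \<open>Q\<^sub>i\<close>
  choose one, \<open>f\<close>, whose pole vector has the smallest sum. If its pole vector were not absolute
  maximal, there would be a function \<open>g\<close> whose pole orders are at most those of \<open>f\<close>, with equality
  on \<open>J\<close> and strict inequality off \<open>J\<close>. If \<open>i \<in> J\<close>, then \<open>g\<close> itself contradicts the choice of
  \<open>f\<close>. If \<open>i \<notin> J\<close>, a combination \<open>f - c g\<close> that lowers the pole order at some \<open>j \<in> J\<close> does:
  its pole order at \<open>Q\<^sub>i\<close> is still that of \<open>f\<close>.

  All of this needs \<open>L(\<alpha>)\<close> to be finite-dimensional, which over the finite base field \<open>k\<close> means
  finite. Lowering one coordinate of \<open>\<alpha>\<close> by one loses at most one dimension, so it is enough that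
  a function without poles that vanishes at some point is zero
  (\<open>regular_everywhere_vanishing_somewhere\<close>). Let \<open>f \<noteq> 0\<close> be such a function. Then \<open>1/f\<close> is
  transcendental and can be specialized to \<open>0\<close>. This specialization extends to the ratios of the
  coordinates of a generic point, up to replacing some ratios by their inverses
  (\<open>extend_to_element_or_inverse\<close>), and so it has a centre on the projective curve. As \<open>f\<close> is
  regular at the centre, the equation \<open>f \<cdot> (1/f) = 1\<close> specializes to \<open>0 = 1\<close>.

  The local rings have principal maximal ideals by hypothesis; to be discrete valuation rings they
  must in addition contain no non-zero element that is divisible by all powers of the uniformizer
  \<open>t\<close>. If \<open>y\<close> is such an element, then \<open>t\<close> and \<open>y\<close> satisfy a polynomial relation over \<open>k\<close> because the
  transcendence degree is one (\<open>algebraically_dependent\<close>, a counting argument over the finite field).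
  Divided by a power of \<open>y\<close>, the relation says that \<open>y\<close> divides a non-zero polynomial in \<open>t\<close>, which
  is \<open>t\<^sup>e\<close> times a unit; so \<open>t\<^sup>e\<^sup>+\<^sup>1\<close> divides \<open>t\<^sup>e\<close>, a contradiction.

  The calculations take place in one ambient field given as a type, an ultrapower \<open>\<Omega>\<close> of the
  algebraic closure of \<open>k\<close>. A generic point \<open>\<xi>\<close> of the curve with coordinates in \<open>\<Omega>\<close>
  (\<open>ex_generic_point\<close>) identifies the function field with the subfield of the quotients
  \<open>g(\<xi>)/h(\<xi>)\<close> of \<open>\<Omega>\<close>. The local ring at a point \<open>x\<close> becomes the domain of the specialization
  \<open>g(\<xi>)/h(\<xi>) \<mapsto> g(x)/h(x)\<close>.
\<close>

section \<open>Evaluating polynomials along a ring homomorphism\<close>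

text \<open>
  Below, \<open>pev z\<close> and \<open>mev x\<close> evaluate polynomials with coefficients in \<open>'r\<close> at points with
  coordinates in \<open>'s\<close>; the coefficients are moved along \<open>\<phi>\<close>. The same evaluation serves for \<open>k\<close> itself,
  for its algebraic closure and for the ultrapower.
\<close>

locale type_ring_hom =
  fixes \<phi> :: "'r::comm_ring_1 \<Rightarrow> 's::comm_ring_1"
  assumes hom_one [simp]: "\<phi> 1 = 1"
    and hom_add [simp]: "\<phi> (x + y) = \<phi> x + \<phi> y"
    and hom_mult [simp]: "\<phi> (x * y) = \<phi> x * \<phi> y"
begin

lemma hom_zero [simp]: "\<phi> 0 = 0"
  using hom_add[of 0 0] by simp

lemma hom_uminus [simp]: "\<phi> (- x) = - \<phi> x"
  using hom_add[of x "- x"] by (simp add: eq_neg_iff_add_eq_0 add.commute)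

lemma hom_diff [simp]: "\<phi> (x - y) = \<phi> x - \<phi> y"
  using hom_add[of x "- y"] by simp

lemma hom_power [simp]: "\<phi> (x ^ n) = \<phi> x ^ n"
  by (induction n) auto

lemma hom_sum: "\<phi> (sum f A) = (\<Sum>x\<in>A. \<phi> (f x))"
  by (induction A rule: infinite_finite_induct) auto

lemma hom_prod: "\<phi> (prod f A) = (\<Prod>x\<in>A. \<phi> (f x))"
  by (induction A rule: infinite_finite_induct) auto

definition pev :: "'s \<Rightarrow> 'r poly \<Rightarrow> 's" where
  "pev z p = poly (map_poly \<phi> p) z"

lemma pev_pCons [simp]: "pev z (pCons a p) = \<phi> a + z * pev z p"
  by (simp add: pev_def map_poly_pCons)

lemma pev_0 [simp]: "pev z 0 = 0"
  by (simp add: pev_def)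

lemma pev_add: "pev z (p + q) = pev z p + pev z q"
proof (induction p q rule: poly_induct2)
  case (pCons a p b q)
  then show ?case by (simp add: algebra_simps)
qed simp

lemma pev_smult: "pev z (Polynomial.smult a p) = \<phi> a * pev z p"
  by (induction p) (simp_all add: algebra_simps)

lemma pev_mult: "pev z (p * q) = pev z p * pev z q"
  by (induction p) (simp_all add: algebra_simps pev_add pev_smult)

lemma pev_hom: "type_ring_hom (pev z)"
  by unfold_locales (simp_all add: pev_add pev_mult one_pCons del: pCons_one)

lemma pev_sum: "pev z (sum f A) = (\<Sum>x\<in>A. pev z (f x))"
  by (rule type_ring_hom.hom_sum[OF pev_hom])

lemma pev_monom: "pev z (Polynomial.monom a n) = \<phi> a * z ^ n"
  by (induction n) (simp_all add: monom_0 monom_Suc algebra_simps)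

lemma pev_altdef: "pev z p = (\<Sum>i\<le>Polynomial.degree p. \<phi> (poly.coeff p i) * z ^ i)"
proof -
  have "pev z p = (\<Sum>i\<le>Polynomial.degree (map_poly \<phi> p). \<phi> (poly.coeff p i) * z ^ i)"
    by (simp add: pev_def poly_altdef coeff_map_poly)
  also have "\<dots> = (\<Sum>i\<le>Polynomial.degree p. \<phi> (poly.coeff p i) * z ^ i)"
  proof (intro sum.mono_neutral_left ballI)
    fix i assume "i \<in> {..Polynomial.degree p} - {..Polynomial.degree (map_poly \<phi> p)}"
    then have "poly.coeff (map_poly \<phi> p) i = 0" by (intro coeff_eq_0) simp
    then show "\<phi> (poly.coeff p i) * z ^ i = 0" by (simp add: coeff_map_poly)
  qed (simp_all add: map_poly_degree_leq)
  finally show ?thesis .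
qed

definition mev :: "('n::finite \<Rightarrow> 's) \<Rightarrow> ('n, 'r) mpol \<Rightarrow> 's" where
  "mev x p = (\<Sum>u\<in>Poly_Mapping.keys p.
     \<phi> (Poly_Mapping.lookup p u) * (\<Prod>i\<in>UNIV. x i ^ Poly_Mapping.lookup u i))"

lemma mev_superset:
  assumes "finite A" "Poly_Mapping.keys p \<subseteq> A"
  shows "mev x p = (\<Sum>u\<in>A. \<phi> (Poly_Mapping.lookup p u) * (\<Prod>i\<in>UNIV. x i ^ Poly_Mapping.lookup u i))"
  unfolding mev_def
  by (rule sum.mono_neutral_left[OF assms]) (auto simp: in_keys_iff)

lemma mev_0 [simp]: "mev x 0 = 0"
  by (simp add: mev_def)

lemma mev_add: "mev x (p + q) = mev x p + mev x q"
proof -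
  let ?A = "Poly_Mapping.keys p \<union> Poly_Mapping.keys q"
  have "mev x (p + q) = (\<Sum>u\<in>?A. \<phi> (Poly_Mapping.lookup (p + q) u) * (\<Prod>i\<in>UNIV. x i ^ Poly_Mapping.lookup u i))"
    using Poly_Mapping.keys_add[of p q] by (intro mev_superset) auto
  also have "\<dots> = mev x p + mev x q"
    by (simp add: lookup_add ring_distribs sum.distrib mev_superset[of ?A p] mev_superset[of ?A q])
  finally show ?thesis .
qed

lemma mev_single: "mev x (Poly_Mapping.single u a) = \<phi> a * (\<Prod>i\<in>UNIV. x i ^ Poly_Mapping.lookup u i)"
  by (cases "a = 0") (simp_all add: mev_def)

lemma mev_single_mult:
  "mev x (Poly_Mapping.single u a * p) = mev x (Poly_Mapping.single u a) * mev x p"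
proof (induction p rule: update_induct)
  case (update p v b)
  have "Poly_Mapping.update v b p = p + Poly_Mapping.single v b"
    by (rule poly_mapping_eqI)
       (use update in \<open>auto simp: lookup_add lookup_update lookup_single in_keys_iff\<close>)
  then show ?case
    using update by (simp add: distrib_left mev_add mult_single mev_single lookup_add power_add prod.distrib algebra_simps)
qed simp

lemma mev_mult: "mev x (p * q) = mev x p * mev x q"
proof (induction p rule: update_induct)
  case (update p v b)
  have "Poly_Mapping.update v b p = p + Poly_Mapping.single v b"
    by (rule poly_mapping_eqI)
       (use update in \<open>auto simp: lookup_add lookup_update lookup_single in_keys_iff\<close>)
  then show ?case
    using update by (simp add: distrib_right mev_add mev_single_mult)
qed simp

lemma mev_const [simp]: "mev x (Poly_Mapping.single 0 a) = \<phi> a"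
  by (simp add: mev_single)

lemma mev_hom: "type_ring_hom (mev x)"
proof unfold_locales
  show "mev x 1 = 1" using mev_const[of x 1] by (simp del: mev_const)
qed (simp_all add: mev_add mev_mult)

text \<open>
  Evaluation of forms in homogeneous coordinates: a quotient of two forms of the same degree only
  depends on the projective point.
\<close>

lemma mev_scale:
  assumes "homogeneous_deg d p"
  shows "mev (\<lambda>i. c * x i) p = c ^ d * mev x p"
proof -
  have "(\<Prod>i\<in>UNIV. (c * x i) ^ Poly_Mapping.lookup u i) = c ^ d * (\<Prod>i\<in>UNIV. x i ^ Poly_Mapping.lookup u i)"
    if "u \<in> Poly_Mapping.keys p" for u
    using assms that by (simp add: homogeneous_deg_def power_mult_distrib prod.distrib flip: power_sum)
  then show ?thesis
    unfolding mev_def sum_distrib_left by (intro sum.cong) (auto simp: algebra_simps)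
qed

end

lemma mev_comp:
  assumes "type_ring_hom \<phi>" "type_ring_hom \<psi>"
  shows "\<psi> (type_ring_hom.mev \<phi> x p) = type_ring_hom.mev (\<lambda>a. \<psi> (\<phi> a)) (\<lambda>i. \<psi> (x i)) p"
proof -
  interpret f: type_ring_hom \<phi> by fact
  interpret g: type_ring_hom \<psi> by fact
  interpret c: type_ring_hom "\<lambda>a. \<psi> (\<phi> a)" by unfold_locales simp_all
  show ?thesis by (simp add: f.mev_def c.mev_def g.hom_sum g.hom_prod)
qed

lemma homogeneous_deg_single:
  "(\<Sum>i\<in>UNIV. Poly_Mapping.lookup u i) = d \<Longrightarrow> homogeneous_deg d (Poly_Mapping.single u a)"
  by (auto simp: homogeneous_deg_def)

lemma homogeneous_deg_const [simp]: "homogeneous_deg 0 (Poly_Mapping.single 0 a)"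
  by (rule homogeneous_deg_single) simp

lemma homogeneous_deg_1 [simp]: "homogeneous_deg 0 (1 :: ('n::finite, 'k::comm_ring_1) mpol)"
  by (simp add: homogeneous_deg_def)

lemma homogeneous_deg_add:
  "homogeneous_deg d p \<Longrightarrow> homogeneous_deg d q \<Longrightarrow> homogeneous_deg d (p + q)"
  using Poly_Mapping.keys_add[of p q] by (auto simp: homogeneous_deg_def)

lemma homogeneous_deg_uminus:
  "homogeneous_deg d p \<Longrightarrow> homogeneous_deg d (- p)" for p :: "('n::finite, 'k::comm_ring_1) mpol"
  by (auto simp: homogeneous_deg_def in_keys_iff)

lemma homogeneous_deg_diff:
  "homogeneous_deg d p \<Longrightarrow> homogeneous_deg d q \<Longrightarrow> homogeneous_deg d (p - q)"
  for p :: "('n::finite, 'k::comm_ring_1) mpol"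
  using homogeneous_deg_add[OF _ homogeneous_deg_uminus, of d p q] by simp

lemma homogeneous_deg_mult:
  assumes "homogeneous_deg d p" "homogeneous_deg e q"
  shows "homogeneous_deg (d + e) (p * q)"
  unfolding homogeneous_deg_def
proof
  fix u assume "u \<in> Poly_Mapping.keys (p * q)"
  then obtain v w where "u = v + w" "v \<in> Poly_Mapping.keys p" "w \<in> Poly_Mapping.keys q"
    using keys_mult[of p q] by auto
  then show "(\<Sum>i\<in>UNIV. Poly_Mapping.lookup u i) = d + e"
    using assms by (simp add: homogeneous_deg_def lookup_add sum.distrib)
qed

lemma homogeneous_mult: "homogeneous p \<Longrightarrow> homogeneous q \<Longrightarrow> homogeneous (p * q)"
  unfolding homogeneous_def using homogeneous_deg_mult by blast

definition mvar :: "'n \<Rightarrow> ('n::finite, 'k::comm_ring_1) mpol" where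
  "mvar i = Poly_Mapping.single (Poly_Mapping.single i 1) 1"

lemma homogeneous_deg_mvar: "homogeneous_deg 1 (mvar i)"
  unfolding mvar_def by (rule homogeneous_deg_single) (simp add: lookup_single when_def)

lemma homogeneous_deg_mvar_power:
  "homogeneous_deg d (mvar i ^ d :: ('n::finite, 'k::comm_ring_1) mpol)"
proof (induction d)
  case (Suc d)
  then show ?case using homogeneous_deg_mult[OF homogeneous_deg_mvar[of i] Suc] by simp
qed simp

context type_ring_hom begin

lemma mev_mvar [simp]: "mev x (mvar i) = x i"
proof -
  have "(\<Prod>j\<in>UNIV. x j ^ Poly_Mapping.lookup (Poly_Mapping.single i 1) j) = (\<Prod>j\<in>UNIV. if j = i then x j else 1)"
    by (intro prod.cong) (auto simp: lookup_single when_def)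
  then show ?thesis by (simp add: mvar_def mev_single)
qed

end

lemma to_ac_hom: "type_ring_hom to_ac"
  by unfold_locales simp_all

interpretation ac: type_ring_hom to_ac by (rule to_ac_hom)

lemma keys_base_change: "Poly_Mapping.keys (base_change p) = Poly_Mapping.keys p"
  by (auto simp: base_change_def in_keys_iff map.rep_eq when_def)

lemma mpol_eval_base_change: "mpol_eval (base_change p) x = ac.mev x p"
  unfolding mpol_eval_def ac.mev_def keys_base_change
  by (intro sum.cong) (auto simp: base_change_def map.rep_eq in_keys_iff)

lemma homogeneous_deg_base_change: "homogeneous_deg d p \<Longrightarrow> homogeneous_deg d (base_change p)"
  by (simp add: homogeneous_deg_def keys_base_change)

lemma self_in_ppoint_of [simp]: "x \<in> ppoint_of x"
  unfolding ppoint_of_def by (rule CollectI, rule exI[of _ 1]) simp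

lemma vanishes_at_base_change:
  assumes "homogeneous p"
  shows "vanishes_at (base_change p) (ppoint_of x) \<longleftrightarrow> ac.mev x p = 0"
proof -
  obtain d where d: "homogeneous_deg d p" using assms by (auto simp: homogeneous_def)
  have "ac.mev y p = 0" if "y \<in> ppoint_of x" "ac.mev x p = 0" for y
    using that by (auto simp: ppoint_of_def ac.mev_scale[OF d])
  then show ?thesis by (auto simp: vanishes_at_def mpol_eval_base_change)
qed

section \<open>An ultrapower of a field\<close>

text \<open>
  A maximal family \<open>M\<close> of sets all of whose finite intersections are infinite consists of the
  large sets of such an ultrafilter: by maximality it contains every set that meets all its finite
  intersections in an infinite set.
\<close>

lemma ex_free_ultrafilter:
  "\<exists>F :: nat filter. F \<le> sequentially \<and> F \<noteq> bot \<and>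
     (\<forall>P. eventually P F \<or> eventually (\<lambda>n. \<not> P n) F)"
proof -
  define fip where "fip \<A> \<longleftrightarrow> (\<forall>\<B>. finite \<B> \<longrightarrow> \<B> \<subseteq> \<A> \<longrightarrow> infinite (\<Inter>\<B>))" for \<A> :: "nat set set"
  have "\<exists>M\<in>{\<A>. fip \<A>}. \<forall>N\<in>{\<A>. fip \<A>}. M \<subseteq> N \<longrightarrow> N = M"
  proof (rule subset_Zorn_nonempty)
    have "fip {}" by (auto simp: fip_def infinite_UNIV_nat)
    then show "{\<A>. fip \<A>} \<noteq> {}" by blast
  next
    fix \<C> assume ne: "\<C> \<noteq> {}" and ch: "subset.chain {\<A>. fip \<A>} \<C>"
    have "infinite (\<Inter>\<B>)" if \<B>: "finite \<B>" "\<B> \<subseteq> \<Union>\<C>" for \<B>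
    proof -
      obtain \<A> where "\<A> \<in> \<C>" "\<B> \<subseteq> \<A>"
        using finite_subset_Union_chain[OF \<B> ne ch] by blast
      moreover from this have "fip \<A>" using ch by (auto simp: subset.chain_def)
      ultimately show ?thesis using \<B> by (auto simp: fip_def)
    qed
    then show "\<Union>\<C> \<in> {\<A>. fip \<A>}" by (auto simp: fip_def)
  qed
  then obtain M where M: "fip M" and max: "\<And>N. fip N \<Longrightarrow> M \<subseteq> N \<Longrightarrow> N = M" by auto
  have memI: "S \<in> M" if S: "\<And>\<B>. finite \<B> \<Longrightarrow> \<B> \<subseteq> M \<Longrightarrow> infinite (S \<inter> \<Inter>\<B>)" for S
  proof -
    have "infinite (\<Inter>\<B>)" if "finite \<B>" "\<B> \<subseteq> insert S M" for \<B>
    proof -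
      have "infinite (S \<inter> \<Inter>(\<B> - {S}))" using S[of "\<B> - {S}"] that by blast
      moreover have "S \<inter> \<Inter>(\<B> - {S}) \<subseteq> \<Inter>\<B>" by auto
      ultimately show ?thesis using finite_subset by blast
    qed
    then have "fip (insert S M)" by (auto simp: fip_def)
    then show ?thesis using max[of "insert S M"] by blast
  qed
  have inf: "infinite (\<Inter>\<B>)" if "finite \<B>" "\<B> \<subseteq> M" for \<B> using M that by (auto simp: fip_def)
  have cofin: "S \<in> M" if "finite (- S)" for S
  proof (rule memI)
    fix \<B> assume "finite \<B>" "\<B> \<subseteq> M"
    then have "infinite (\<Inter>\<B>)" by (rule inf)
    moreover have "\<Inter>\<B> \<subseteq> (S \<inter> \<Inter>\<B>) \<union> - S" by auto
    ultimately show "infinite (S \<inter> \<Inter>\<B>)" using that by (meson finite_Un finite_subset)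
  qed
  have inter: "S \<inter> T \<in> M" if ST: "S \<in> M" "T \<in> M" for S T
  proof (rule memI)
    fix \<B> assume \<B>: "finite \<B>" "\<B> \<subseteq> M"
    show "infinite (S \<inter> T \<inter> \<Inter>\<B>)"
      using inf[of "insert S (insert T \<B>)"] ST \<B> by (simp add: Int_assoc)
  qed
  have up: "T \<in> M" if ST: "S \<in> M" "S \<subseteq> T" for S T
  proof (rule memI)
    fix \<B> assume \<B>: "finite \<B>" "\<B> \<subseteq> M"
    then have "infinite (S \<inter> \<Inter>\<B>)" using inf[of "insert S \<B>"] ST by simp
    moreover have "S \<inter> \<Inter>\<B> \<subseteq> T \<inter> \<Inter>\<B>" using ST by auto
    ultimately show "infinite (T \<inter> \<Inter>\<B>)" using finite_subset by blast
  qed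
  have compl: "S \<in> M \<or> - S \<in> M" for S
  proof (rule ccontr)
    assume neg: "\<not> ?thesis"
    obtain \<B>1 where B1: "finite \<B>1" "\<B>1 \<subseteq> M" "finite (S \<inter> \<Inter>\<B>1)" using memI[of S] neg by blast
    obtain \<B>2 where B2: "finite \<B>2" "\<B>2 \<subseteq> M" "finite (- S \<inter> \<Inter>\<B>2)" using memI[of "-S"] neg by blast
    have "infinite (\<Inter>(\<B>1 \<union> \<B>2))" using inf[of "\<B>1 \<union> \<B>2"] B1 B2 by blast
    moreover have "\<Inter>(\<B>1 \<union> \<B>2) \<subseteq> (S \<inter> \<Inter>\<B>1) \<union> (- S \<inter> \<Inter>\<B>2)" by auto
    ultimately show False using B1 B2 by (meson finite_Un finite_subset)
  qed
  define F where "F = Abs_filter (\<lambda>P. Collect P \<in> M)"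
  have ev: "eventually P F \<longleftrightarrow> Collect P \<in> M" for P
    unfolding F_def
  proof (rule eventually_Abs_filter, rule is_filter.intro)
    show "Collect (\<lambda>_. True) \<in> M" by (rule cofin) simp
    show "Collect (\<lambda>x. P x \<and> Q x) \<in> M" if "Collect P \<in> M" "Collect Q \<in> M" for P Q
      using inter[OF that] by (simp add: Collect_conj_eq)
    show "Collect Q \<in> M" if "\<forall>x. P x \<longrightarrow> Q x" "Collect P \<in> M" for P Q
      using that(1) by (intro up[OF that(2)]) auto
  qed
  have "F \<le> sequentially"
  proof (rule filter_leI)
    fix P :: "nat \<Rightarrow> bool" assume "eventually P sequentially"
    then obtain N where "\<And>n. n \<ge> N \<Longrightarrow> P n" by (auto simp: eventually_sequentially)
    then have "- Collect P \<subseteq> {..<N}" by (auto simp: not_less[symmetric])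
    then have "finite (- Collect P)" using finite_subset by blast
    then show "eventually P F" by (simp add: ev cofin)
  qed
  moreover have "F \<noteq> bot"
  proof
    assume "F = bot"
    then have "{} \<in> M" using ev[of "\<lambda>_. False"] by simp
    then show False using inf[of "{{}}"] by simp
  qed
  moreover have "eventually P F \<or> eventually (\<lambda>n. \<not> P n) F" for P
    using compl[of "Collect P"] by (simp add: ev Collect_neg_eq)
  ultimately show ?thesis by blast
qed

definition free_ultrafilter :: "nat filter" where
  "free_ultrafilter = (SOME F. F \<le> sequentially \<and> F \<noteq> bot \<and>
     (\<forall>P. eventually P F \<or> eventually (\<lambda>n. \<not> P n) F))"

lemma free_ultrafilter:
  shows free_ultrafilter_le: "free_ultrafilter \<le> sequentially"
    and free_ultrafilter_proper: "free_ultrafilter \<noteq> bot"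
    and free_ultrafilter_ultra:
      "eventually P free_ultrafilter \<or> eventually (\<lambda>n. \<not> P n) free_ultrafilter"
  using someI_ex[OF ex_free_ultrafilter] unfolding free_ultrafilter_def by blast+

lemma not_eventually_free_ultrafilter:
  "\<not> eventually P free_ultrafilter \<Longrightarrow> eventually (\<lambda>n. \<not> P n) free_ultrafilter"
  using free_ultrafilter_ultra by blast

text \<open>
  The ultrapower is a field because for every sequence the indices where it vanishes, or else those
  where it does not, form a large set.
\<close>

quotient_type 'k ultra = "nat \<Rightarrow> 'k" / "\<lambda>f g. eventually (\<lambda>n. f n = g n) free_ultrafilter"
  by (rule equivpI) (auto simp: reflp_def symp_def transp_def elim: eventually_mono eventually_elim2)

instantiation ultra :: (field) field
begin

lift_definition zero_ultra :: "'a ultra" is "\<lambda>_. 0" .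
lift_definition one_ultra :: "'a ultra" is "\<lambda>_. 1" .
lift_definition plus_ultra :: "'a ultra \<Rightarrow> 'a ultra \<Rightarrow> 'a ultra" is "\<lambda>f g n. f n + g n"
  by (auto elim: eventually_elim2)
lift_definition minus_ultra :: "'a ultra \<Rightarrow> 'a ultra \<Rightarrow> 'a ultra" is "\<lambda>f g n. f n - g n"
  by (auto elim: eventually_elim2)
lift_definition times_ultra :: "'a ultra \<Rightarrow> 'a ultra \<Rightarrow> 'a ultra" is "\<lambda>f g n. f n * g n"
  by (auto elim: eventually_elim2)
lift_definition divide_ultra :: "'a ultra \<Rightarrow> 'a ultra \<Rightarrow> 'a ultra" is "\<lambda>f g n. f n / g n"
  by (auto elim: eventually_elim2)
lift_definition uminus_ultra :: "'a ultra \<Rightarrow> 'a ultra" is "\<lambda>f n. - f n"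
  by (auto elim: eventually_mono)
lift_definition inverse_ultra :: "'a ultra \<Rightarrow> 'a ultra" is "\<lambda>f n. inverse (f n)"
  by (auto elim: eventually_mono)

instance
proof
  show "(0::'a ultra) \<noteq> 1"
    by transfer (simp add: free_ultrafilter_proper)
  show "a \<noteq> 0 \<Longrightarrow> inverse a * a = 1" for a :: "'a ultra"
    by transfer (auto dest!: not_eventually_free_ultrafilter elim: eventually_mono)
qed (transfer; simp add: algebra_simps divide_inverse)+

end

lift_definition ultra_const :: "'k \<Rightarrow> 'k ultra" is "\<lambda>c _. c" .

lemma abs_ultra_eq_0_iff:
  "abs_ultra f = (0 :: 'k::field ultra) \<longleftrightarrow> eventually (\<lambda>n. f n = 0) free_ultrafilter"
  by (simp add: zero_ultra_def ultra.abs_eq_iff)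

section \<open>A generic point\<close>

lemma ultra_const_hom: "type_ring_hom (ultra_const :: 'k::field \<Rightarrow> 'k ultra)"
  by unfold_locales (transfer, simp)+

interpretation uc: type_ring_hom "ultra_const :: 'k::field \<Rightarrow> 'k ultra" by (rule ultra_const_hom)

lemma ultra_const_eq_0_iff [simp]: "ultra_const c = (0 :: 'k::field ultra) \<longleftrightarrow> c = 0"
  by transfer (simp add: free_ultrafilter_proper)

lemma ultra_const_inverse: "ultra_const (inverse c) = inverse (ultra_const c :: 'k::field ultra)"
  by transfer simp

abbreviation base :: "'k::field \<Rightarrow> 'k alg_closure ultra" where
  "base \<equiv> \<lambda>a. ultra_const (to_ac a)"

lemma base_hom: "type_ring_hom base"
  by unfold_locales simp_all

interpretation gen: type_ring_hom base by (rule base_hom)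

lemma abs_ultra_sum: "abs_ultra (\<lambda>n. \<Sum>u\<in>A. f u n) = (\<Sum>u\<in>A. abs_ultra (f u) :: 'k::field ultra)"
  by (induction A rule: infinite_finite_induct)
     (simp_all add: zero_ultra_def plus_ultra.abs_eq[symmetric])

lemma abs_ultra_prod: "abs_ultra (\<lambda>n. \<Prod>u\<in>A. f u n) = (\<Prod>u\<in>A. abs_ultra (f u) :: 'k::field ultra)"
  by (induction A rule: infinite_finite_induct)
     (simp_all add: one_ultra_def times_ultra.abs_eq[symmetric])

lemma abs_ultra_power: "abs_ultra (\<lambda>n. f n ^ k) = (abs_ultra f ^ k :: 'k::field ultra)"
  by (induction k) (simp_all add: one_ultra_def times_ultra.abs_eq[symmetric])

lemma gen_mev_abs_ultra:
  "gen.mev (\<lambda>i. abs_ultra (\<lambda>n. x n i)) p = abs_ultra (\<lambda>n. ac.mev (x n) p)"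
proof -
  have c: "ultra_const c = abs_ultra (\<lambda>n. c)" for c :: "'k::field"
    by (simp add: ultra_const_def)
  show ?thesis
    unfolding gen.mev_def ac.mev_def
    by (simp add: abs_ultra_sum abs_ultra_prod abs_ultra_power c
        times_ultra.abs_eq[symmetric])
qed

instance poly_mapping :: (countable, "{countable, zero}") countable
proof
  have "inj (\<lambda>p :: 'a \<Rightarrow>\<^sub>0 'b. {(u, Poly_Mapping.lookup p u) |u. u \<in> Poly_Mapping.keys p})"
  proof (rule injI, rule poly_mapping_eqI)
    fix p q :: "'a \<Rightarrow>\<^sub>0 'b" and u
    assume "{(u, Poly_Mapping.lookup p u) |u. u \<in> Poly_Mapping.keys p} =
      {(u, Poly_Mapping.lookup q u) |u. u \<in> Poly_Mapping.keys q}"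
    then have *: "u \<in> Poly_Mapping.keys p \<and> v = Poly_Mapping.lookup p u \<longleftrightarrow>
        u \<in> Poly_Mapping.keys q \<and> v = Poly_Mapping.lookup q u" for v
      by (auto simp: set_eq_iff)
    show "Poly_Mapping.lookup p u = Poly_Mapping.lookup q u"
      using *[of "Poly_Mapping.lookup p u"] *[of "Poly_Mapping.lookup q u"] by (auto simp: in_keys_iff)
  qed
  moreover have "countable {A :: ('a \<times> 'b) set. finite A}"
    by (rule countable_Collect_finite)
  moreover have "range (\<lambda>p :: 'a \<Rightarrow>\<^sub>0 'b. {(u, Poly_Mapping.lookup p u) |u. u \<in> Poly_Mapping.keys p})
      \<subseteq> {A. finite A}"
    by auto
  ultimately have "countable (UNIV :: ('a \<Rightarrow>\<^sub>0 'b) set)"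
    by (meson countable_image_inj_on countable_subset)
  then show "\<exists>f :: ('a \<Rightarrow>\<^sub>0 'b) \<Rightarrow> nat. inj f"
    unfolding countable_def .
qed

lemma vanishes_on_iff_zero_locus:
  assumes "C \<subseteq> proj_space"
  shows "vanishes_on p C \<longleftrightarrow> C \<subseteq> zero_locus {base_change p}"
  using assms by (auto simp: vanishes_on_def zero_locus_def)

text \<open>
  Irreducibility of the curve in the form in which it is used: the forms that vanish on it are a
  prime ideal.
\<close>

lemma vanishes_on_mult:
  assumes C: "zariski_irreducible C" "C \<subseteq> proj_space"
    and pq: "homogeneous p" "homogeneous q" "vanishes_on (p * q) C"
  shows "vanishes_on p C \<or> vanishes_on q C"
proof -
  have hom: "homogeneous (base_change r)" if "homogeneous r" for r :: "('a, 'b) mpol"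
    using that homogeneous_deg_base_change unfolding homogeneous_def by blast
  have "zariski_closed (zero_locus {base_change r})" if "homogeneous r" for r :: "('a, 'b) mpol"
    unfolding zariski_closed_def using hom[OF that] by blast
  moreover have "C \<subseteq> zero_locus {base_change p} \<union> zero_locus {base_change q}"
  proof
    fix P assume P: "P \<in> C"
    then obtain x where x: "P = ppoint_of x" using C by (auto simp: proj_space_def)
    have "ac.mev x (p * q) = 0"
      using pq P vanishes_at_base_change[OF homogeneous_mult[OF pq(1,2)], of x]
      by (simp add: vanishes_on_def x)
    then have "vanishes_at (base_change p) P \<or> vanishes_at (base_change q) P"
      using pq by (simp add: x vanishes_at_base_change ac.mev_mult)
    then show "P \<in> zero_locus {base_change p} \<union> zero_locus {base_change q}"
      using P C by (auto simp: zero_locus_def)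
  qed
  ultimately show ?thesis
    using C pq unfolding zariski_irreducible_def vanishes_on_iff_zero_locus[OF C(2)] by blast
qed

text \<open>
  There are only countably many forms over a finite field. Enumerate those that do not vanish on the
  curve as \<open>e\<^sub>0, e\<^sub>1, \<dots>\<close>. As the vanishing ideal is prime, some point \<open>y\<^sub>n\<close> of the curve is a zero of
  none of \<open>e\<^sub>0, \<dots>, e\<^sub>n\<close>. In the ultrapower the sequence of these points satisfies the equations of
  the curve, and each \<open>e\<^sub>k\<close> is non-zero at it, being non-zero at all but finitely many of the \<open>y\<^sub>n\<close>.
\<close>

theorem ex_generic_point:
  fixes C :: "('n::finite, 'a::{field,finite} alg_closure) ppoint set"
  assumes C: "zariski_irreducible C" "C \<subseteq> proj_space"
  shows "\<exists>\<xi> :: 'n \<Rightarrow> 'a alg_closure ultra.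
    \<forall>p. homogeneous p \<longrightarrow> (vanishes_on p C \<longleftrightarrow> gen.mev \<xi> p = 0)"
proof -
  define S where "S = {p :: ('n, 'a) mpol. homogeneous p \<and> \<not> vanishes_on p C}"
  obtain P where P: "P \<in> C" using C by (auto simp: zariski_irreducible_def)
  then obtain x where x: "P = ppoint_of x" using C by (auto simp: proj_space_def)
  have one: "homogeneous (1 :: ('n, 'a) mpol)" 
    unfolding homogeneous_def by (rule exI) (rule homogeneous_deg_1)
  have "1 \<in> S"
    using P one vanishes_at_base_change[OF one, of x] ac.mev_const[of x 1]
    by (auto simp: S_def x vanishes_on_def simp del: ac.mev_const)
  define e where "e = from_nat_into S"
  have eS: "e k \<in> S" for k using \<open>1 \<in> S\<close> unfolding e_def by (intro from_nat_into) auto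
  have prodS: "(\<Prod>k\<le>n. e k) \<in> S" for n
  proof (induction n)
    case (Suc n)
    then show ?case
      using eS[of "Suc n"] vanishes_on_mult[OF C, of "\<Prod>k\<le>n. e k" "e (Suc n)"]
      by (auto simp: S_def homogeneous_mult)
  qed (use eS in simp)
  have "\<exists>x. ppoint_of x \<in> C \<and> (\<forall>k\<le>n. ac.mev x (e k) \<noteq> 0)" for n
  proof -
    obtain P where P: "P \<in> C" "\<not> vanishes_at (base_change (\<Prod>k\<le>n. e k)) P"
      using prodS[of n] by (auto simp: S_def vanishes_on_def)
    then obtain x where x: "P = ppoint_of x" using C by (auto simp: proj_space_def)
    have "ac.mev x (\<Prod>k\<le>n. e k) \<noteq> 0"
      using P prodS[of n] by (simp add: x S_def vanishes_at_base_change)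
    then have "\<forall>k\<le>n. ac.mev x (e k) \<noteq> 0"
      by (auto simp: type_ring_hom.hom_prod[OF ac.mev_hom])
    then show ?thesis using P x by blast
  qed
  then obtain y where y: "\<And>n. ppoint_of (y n) \<in> C" "\<And>n k. k \<le> n \<Longrightarrow> ac.mev (y n) (e k) \<noteq> 0"
    by metis
  let ?\<xi> = "\<lambda>i. abs_ultra (\<lambda>n. y n i)"
  have "vanishes_on p C \<longleftrightarrow> gen.mev ?\<xi> p = 0" if p: "homogeneous p" for p
  proof
    assume "vanishes_on p C"
    then have "ac.mev (y n) p = 0" for n
      using y(1)[of n] vanishes_at_base_change[OF p, of "y n"] by (auto simp: vanishes_on_def)
    then show "gen.mev ?\<xi> p = 0" by (simp add: gen_mev_abs_ultra zero_ultra_def)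
  next
    assume z: "gen.mev ?\<xi> p = 0"
    show "vanishes_on p C"
    proof (rule ccontr)
      assume "\<not> vanishes_on p C"
      then have "p \<in> S" using p by (simp add: S_def)
      then obtain k where k: "e k = p"
        unfolding e_def using from_nat_into_surj[of S p] by (auto intro: countableI_type)
      then have "eventually (\<lambda>n. ac.mev (y n) p \<noteq> 0) sequentially"
        using y(2) by (auto simp: eventually_sequentially)
      then have "eventually (\<lambda>n. ac.mev (y n) p \<noteq> 0) free_ultrafilter"
        using free_ultrafilter_le by (rule filter_leD[rotated])
      moreover have "eventually (\<lambda>n. ac.mev (y n) p = 0) free_ultrafilter"
        using z by (simp add: gen_mev_abs_ultra abs_ultra_eq_0_iff)
      ultimately have "eventually (\<lambda>n. False) free_ultrafilter"
        by eventually_elim simp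
      then show False using free_ultrafilter_proper by (simp add: trivial_limit_def)
    qed
  qed
  then show ?thesis by blast
qed

section \<open>The function field inside the ultrapower\<close>

text \<open>
  Equational axioms are inherited from the field into which \<open>R\<close> embeds; negatives and inverses exist
  because the image is closed under them.
\<close>

lemma field_via_embedding:
  fixes R (structure) and emb :: "'b \<Rightarrow> 'e::Fields.field"
  assumes inj: "inj_on emb (carrier R)"
    and closed: "\<zero> \<in> carrier R" "\<one> \<in> carrier R"
      "\<And>a b. a \<in> carrier R \<Longrightarrow> b \<in> carrier R \<Longrightarrow> a \<oplus> b \<in> carrier R"
      "\<And>a b. a \<in> carrier R \<Longrightarrow> b \<in> carrier R \<Longrightarrow> a \<otimes> b \<in> carrier R"
    and hom: "emb \<zero> = 0" "emb \<one> = 1"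
      "\<And>a b. a \<in> carrier R \<Longrightarrow> b \<in> carrier R \<Longrightarrow> emb (a \<oplus> b) = emb a + emb b"
      "\<And>a b. a \<in> carrier R \<Longrightarrow> b \<in> carrier R \<Longrightarrow> emb (a \<otimes> b) = emb a * emb b"
    and uminus: "\<And>a. a \<in> carrier R \<Longrightarrow> \<exists>b\<in>carrier R. emb b = - emb a"
    and inverse: "\<And>a. a \<in> carrier R \<Longrightarrow> emb a \<noteq> 0 \<Longrightarrow> \<exists>b\<in>carrier R. emb b = inverse (emb a)"
  shows "field R"
proof -
  note eqI = inj_onD[OF inj]
  have "abelian_group R"
  proof (rule abelian_groupI)
    fix a assume a: "a \<in> carrier R"
    then obtain b where "b \<in> carrier R" "emb b = - emb a" using uminus by blast
    then show "\<exists>y\<in>carrier R. y \<oplus> a = \<zero>"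
      using a closed hom by (intro bexI[of _ b] eqI) auto
  qed (auto intro!: eqI simp: closed hom algebra_simps)
  moreover have "comm_monoid R"
    by (rule comm_monoidI) (auto intro!: eqI simp: closed hom algebra_simps)
  ultimately have "cring R"
    by (rule cringI) (auto intro!: eqI simp: closed hom algebra_simps)
  moreover have "Units R = carrier R - {\<zero>}"
  proof -
    have zero: "emb a = 0 \<longleftrightarrow> a = \<zero>" if "a \<in> carrier R" for a
      using eqI[of a \<zero>] that closed hom by auto
    show ?thesis
    proof (rule Set.set_eqI, rule iffI)
      fix a assume "a \<in> Units R"
      then obtain b where b: "a \<in> carrier R" "b \<in> carrier R" "b \<otimes> a = \<one>" unfolding Units_def by blast
      then have "emb b * emb a = 1" using hom by metis
      then show "a \<in> carrier R - {\<zero>}" using b hom by auto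
    next
      fix a assume a: "a \<in> carrier R - {\<zero>}"
      then obtain b where b: "b \<in> carrier R" "emb b = inverse (emb a)" using inverse zero by auto
      have "b \<otimes> a = \<one>" "a \<otimes> b = \<one>"
        using a b zero by (auto intro!: eqI simp: closed hom)
      then show "a \<in> Units R" using a b unfolding Units_def by blast
    qed
  qed
  ultimately show ?thesis by (rule cring.cring_fieldI)
qed

text \<open>
  The third condition says that \<open>\<xi>\<close> is a generic point of \<open>C\<close> in the sense of Weil. Evaluation at
  \<open>\<xi>\<close> identifies rational functions with elements of the ambient field: \<open>emb\<close> is the resulting
  embedding of the function field and \<open>K\<close> is its image.
\<close>

locale generic_point =
  fixes C :: "('n::finite, 'a::{field,finite} alg_closure) ppoint set"
    and \<xi> :: "'n \<Rightarrow> 'a alg_closure ultra"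
  assumes over_base: "projective_over_base C"
    and nonempty: "C \<noteq> {}"
    and generic: "homogeneous p \<Longrightarrow> vanishes_on p C \<longleftrightarrow> gen.mev \<xi> p = 0"
begin

abbreviation "ev \<equiv> gen.mev \<xi>"

abbreviation "FF \<equiv> function_field C"

abbreviation "consts \<equiv> constant_functions C"

definition K :: "'a alg_closure ultra set" where
  "K = {ev g / ev h |g h d. homogeneous_deg d g \<and> homogeneous_deg d h \<and> ev h \<noteq> 0}"

definition emb :: "('n, 'a) ratfun \<Rightarrow> 'a alg_closure ultra" where
  "emb A = (THE z. \<exists>(g, h)\<in>A. z = ev g / ev h)"

lemma pointE:
  assumes "P \<in> C"
  obtains x where "P = ppoint_of x" "x \<noteq> (\<lambda>_. 0)"
proof -
  have "P \<in> proj_space"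
    using assms over_base by (auto simp: projective_over_base_def zero_locus_def)
  then show ?thesis using that unfolding proj_space_def by blast
qed

lemma fractions_iff:
  "(g, h) \<in> fractions C \<longleftrightarrow> (\<exists>d. homogeneous_deg d g \<and> homogeneous_deg d h) \<and> ev h \<noteq> 0"
proof -
  have "vanishes_on h C \<longleftrightarrow> ev h = 0" if "homogeneous_deg d h" for d
    using that by (intro generic) (auto simp: homogeneous_def)
  then show ?thesis unfolding fractions_def by blast
qed

lemma frac_rel_iff:
  "((g, h), (g', h')) \<in> frac_rel C \<longleftrightarrow>
     (g, h) \<in> fractions C \<and> (g', h') \<in> fractions C \<and> ev g / ev h = ev g' / ev h'"
proof (cases "(g, h) \<in> fractions C \<and> (g', h') \<in> fractions C")
  case True
  then obtain d d' where "homogeneous_deg d g" "homogeneous_deg d h"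
    "homogeneous_deg d' g'" "homogeneous_deg d' h'" and nz: "ev h \<noteq> 0" "ev h' \<noteq> 0"
    by (auto simp: fractions_iff)
  then have "homogeneous_deg (d + d') (g * h' - g' * h)"
    using homogeneous_deg_mult[of d g d' h'] homogeneous_deg_mult[of d' g' d h]
    by (intro homogeneous_deg_diff) (simp_all add: add.commute)
  then have "vanishes_on (g * h' - g' * h) C \<longleftrightarrow> ev g * ev h' - ev g' * ev h = 0"
    using generic[of "g * h' - g' * h"]
    by (auto simp: homogeneous_def type_ring_hom.hom_diff[OF gen.mev_hom] gen.mev_mult)
  then show ?thesis using True nz by (simp add: frac_rel_def divide_simps)
qed (auto simp: frac_rel_def)

lemma ratfun_eq:
  assumes "(g, h) \<in> fractions C"
  shows "ratfun C g h = {(g', h'). (g', h') \<in> fractions C \<and> ev g' / ev h' = ev g / ev h}"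
  using assms by (auto simp: ratfun_def frac_rel_iff)

lemma emb_ratfun:
  assumes "(g, h) \<in> fractions C"
  shows "emb (ratfun C g h) = ev g / ev h"
  unfolding emb_def
proof (rule the_equality)
  show "\<exists>(g', h')\<in>ratfun C g h. ev g / ev h = ev g' / ev h'"
    using assms by (auto simp: ratfun_eq)
qed (use assms in \<open>auto simp: ratfun_eq\<close>)

lemma carrier_iff: "A \<in> carrier FF \<longleftrightarrow> (\<exists>g h. (g, h) \<in> fractions C \<and> A = ratfun C g h)"
proof -
  have "carrier FF = fractions C // frac_rel C" by (simp add: function_field_def)
  also have "\<dots> = (\<lambda>p. frac_rel C `` {p}) ` fractions C" by (auto simp: quotient_def)
  finally show ?thesis by (simp add: ratfun_def image_iff split_paired_Ex Bex_def)
qed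

lemma carrierE:
  assumes "A \<in> carrier FF"
  obtains g h d where "homogeneous_deg d g" "homogeneous_deg d h" "ev h \<noteq> 0"
    "(g, h) \<in> fractions C" "A = ratfun C g h"
proof -
  obtain g h where gh: "(g, h) \<in> fractions C" "A = ratfun C g h"
    using assms unfolding carrier_iff by blast
  then obtain d where "homogeneous_deg d g" "homogeneous_deg d h" "ev h \<noteq> 0"
    unfolding fractions_iff by blast
  then show ?thesis using gh by (intro that)
qed

lemma ratfun_eqI:
  assumes "(g, h) \<in> fractions C" "(g', h') \<in> fractions C" "ev g / ev h = ev g' / ev h'"
  shows "ratfun C g h = ratfun C g' h'"
  using assms by (simp add: ratfun_eq)

lemma emb_inj: "inj_on emb (carrier FF)"
proof (rule inj_onI)
  fix A B assume A: "A \<in> carrier FF" and B: "B \<in> carrier FF" and eq: "emb A = emb B"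
  obtain g h where gh: "(g, h) \<in> fractions C" "A = ratfun C g h" using carrierE[OF A] by metis
  obtain g' h' where gh': "(g', h') \<in> fractions C" "B = ratfun C g' h'" using carrierE[OF B] by metis
  show "A = B"
    unfolding gh(2) gh'(2)
    using gh(1) gh'(1) eq[unfolded gh(2) gh'(2) emb_ratfun[OF gh(1)] emb_ratfun[OF gh'(1)]]
    by (rule ratfun_eqI)
qed

lemma fractions_mult:
  assumes "(g, h) \<in> fractions C" "(g', h') \<in> fractions C"
  shows "(g * g', h * h') \<in> fractions C"
proof -
  obtain d d' where d: "homogeneous_deg d g" "homogeneous_deg d h" "ev h \<noteq> 0"
    "homogeneous_deg d' g'" "homogeneous_deg d' h'" "ev h' \<noteq> 0"
    using assms unfolding fractions_iff by blast
  show ?thesis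
    using homogeneous_deg_mult[OF d(1,4)] homogeneous_deg_mult[OF d(2,5)] d(3,6)
    unfolding fractions_iff gen.mev_mult by auto
qed

lemma fractions_add:
  assumes "(g, h) \<in> fractions C" "(g', h') \<in> fractions C"
  shows "(g * h' + g' * h, h * h') \<in> fractions C"
proof -
  obtain d d' where d: "homogeneous_deg d g" "homogeneous_deg d h" "ev h \<noteq> 0"
    "homogeneous_deg d' g'" "homogeneous_deg d' h'" "ev h' \<noteq> 0"
    using assms unfolding fractions_iff by blast
  have "homogeneous_deg (d + d') (g * h' + g' * h)"
    using homogeneous_deg_mult[OF d(1,5)] homogeneous_deg_mult[OF d(4,2)]
    by (intro homogeneous_deg_add) (simp_all add: add.commute)
  then show ?thesis
    using homogeneous_deg_mult[OF d(2,5)] d(3,6) unfolding fractions_iff gen.mev_mult by auto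
qed

lemma UN_pairs_const:
  assumes "\<And>g h g' h'. (g, h) \<in> A \<Longrightarrow> (g', h') \<in> B \<Longrightarrow> f g h g' h' = c" "A \<noteq> {}" "B \<noteq> {}"
  shows "(\<Union>(g, h)\<in>A. \<Union>(g', h')\<in>B. f g h g' h') = c"
proof -
  have "(\<Union>(g, h)\<in>A. \<Union>(g', h')\<in>B. f g h g' h') = (\<Union>p\<in>A. \<Union>q\<in>B. c)"
    using assms(1) by (intro SUP_cong refl) (auto intro!: SUP_cong)
  then show ?thesis using assms(2,3) by simp
qed

lemma mult_ratfun:
  assumes "(g, h) \<in> fractions C" "(g', h') \<in> fractions C"
  shows "ratfun C g h \<otimes>\<^bsub>FF\<^esub> ratfun C g' h' = ratfun C (g * g') (h * h')"
proof -
  have "ratfun C g h \<otimes>\<^bsub>FF\<^esub> ratfun C g' h' =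
      (\<Union>(g1, h1)\<in>ratfun C g h. \<Union>(g2, h2)\<in>ratfun C g' h'. ratfun C (g1 * g2) (h1 * h2))"
    by (simp add: function_field_def)
  also have "\<dots> = ratfun C (g * g') (h * h')"
  proof (rule UN_pairs_const)
    fix g1 h1 g2 h2
    assume "(g1, h1) \<in> ratfun C g h" "(g2, h2) \<in> ratfun C g' h'"
    then have *: "(g1, h1) \<in> fractions C" "ev g1 / ev h1 = ev g / ev h"
      "(g2, h2) \<in> fractions C" "ev g2 / ev h2 = ev g' / ev h'"
      using assms by (auto simp: ratfun_eq)
    have "ev (g1 * g2) / ev (h1 * h2) = (ev g1 / ev h1) * (ev g2 / ev h2)"
      by (simp add: gen.mev_mult)
    also have "\<dots> = ev (g * g') / ev (h * h')" by (simp add: * gen.mev_mult)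
    finally show "ratfun C (g1 * g2) (h1 * h2) = ratfun C (g * g') (h * h')"
      using * assms by (intro ratfun_eqI fractions_mult)
  qed (use assms in \<open>auto simp: ratfun_eq\<close>)
  finally show ?thesis .
qed

lemma add_ratfun:
  assumes "(g, h) \<in> fractions C" "(g', h') \<in> fractions C"
  shows "ratfun C g h \<oplus>\<^bsub>FF\<^esub> ratfun C g' h' = ratfun C (g * h' + g' * h) (h * h')"
proof -
  have frac: "ev (g1 * h2 + g2 * h1) / ev (h1 * h2) = ev g1 / ev h1 + ev g2 / ev h2"
    if "(g1, h1) \<in> fractions C" "(g2, h2) \<in> fractions C" for g1 h1 g2 h2
    using that by (simp add: gen.mev_mult gen.mev_add fractions_iff add_frac_eq)
  have "ratfun C g h \<oplus>\<^bsub>FF\<^esub> ratfun C g' h' =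
      (\<Union>(g1, h1)\<in>ratfun C g h. \<Union>(g2, h2)\<in>ratfun C g' h'. ratfun C (g1 * h2 + g2 * h1) (h1 * h2))"
    by (simp add: function_field_def)
  also have "\<dots> = ratfun C (g * h' + g' * h) (h * h')"
  proof (rule UN_pairs_const)
    fix g1 h1 g2 h2
    assume "(g1, h1) \<in> ratfun C g h" "(g2, h2) \<in> ratfun C g' h'"
    then have *: "(g1, h1) \<in> fractions C" "ev g1 / ev h1 = ev g / ev h"
      "(g2, h2) \<in> fractions C" "ev g2 / ev h2 = ev g' / ev h'"
      using assms by (auto simp: ratfun_eq)
    then show "ratfun C (g1 * h2 + g2 * h1) (h1 * h2) = ratfun C (g * h' + g' * h) (h * h')"
      using assms by (intro ratfun_eqI fractions_add) (simp_all add: frac)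
  qed (use assms in \<open>auto simp: ratfun_eq\<close>)
  finally show ?thesis .
qed

lemma fractions_const: "(Poly_Mapping.single 0 c, 1) \<in> fractions C"
  by (auto simp: fractions_iff type_ring_hom.hom_one[OF gen.mev_hom] intro: exI[of _ 0])

lemma emb_const: "emb (ratfun C (Poly_Mapping.single 0 c) 1) = base c"
  by (simp add: emb_ratfun[OF fractions_const] type_ring_hom.hom_one[OF gen.mev_hom])

lemma zero_one_FF:
  "\<zero>\<^bsub>FF\<^esub> = ratfun C (Poly_Mapping.single 0 0) 1" "\<one>\<^bsub>FF\<^esub> = ratfun C (Poly_Mapping.single 0 1) 1"
  by (simp_all add: function_field_def)

lemma FF_closed:
  "\<zero>\<^bsub>FF\<^esub> \<in> carrier FF" "\<one>\<^bsub>FF\<^esub> \<in> carrier FF"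
  "A \<in> carrier FF \<Longrightarrow> B \<in> carrier FF \<Longrightarrow> A \<oplus>\<^bsub>FF\<^esub> B \<in> carrier FF"
  "A \<in> carrier FF \<Longrightarrow> B \<in> carrier FF \<Longrightarrow> A \<otimes>\<^bsub>FF\<^esub> B \<in> carrier FF"
proof -
  show "\<zero>\<^bsub>FF\<^esub> \<in> carrier FF" "\<one>\<^bsub>FF\<^esub> \<in> carrier FF"
    unfolding zero_one_FF carrier_iff using fractions_const by metis+
  assume "A \<in> carrier FF" "B \<in> carrier FF"
  then obtain g h g' h' where gh: "(g, h) \<in> fractions C" "A = ratfun C g h"
      "(g', h') \<in> fractions C" "B = ratfun C g' h'"
    unfolding carrier_iff by metis
  show "A \<oplus>\<^bsub>FF\<^esub> B \<in> carrier FF" "A \<otimes>\<^bsub>FF\<^esub> B \<in> carrier FF"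
    unfolding gh(2,4) mult_ratfun[OF gh(1,3)] add_ratfun[OF gh(1,3)] carrier_iff
    using fractions_mult[OF gh(1,3)] fractions_add[OF gh(1,3)] by metis+
qed

lemma emb_zero_one [simp]: "emb \<zero>\<^bsub>FF\<^esub> = 0" "emb \<one>\<^bsub>FF\<^esub> = 1"
  unfolding zero_one_FF emb_const by simp_all

lemma emb_add_mult [simp]:
  assumes "A \<in> carrier FF" "B \<in> carrier FF"
  shows emb_add: "emb (A \<oplus>\<^bsub>FF\<^esub> B) = emb A + emb B" and emb_mult: "emb (A \<otimes>\<^bsub>FF\<^esub> B) = emb A * emb B"
proof -
  from assms obtain g h g' h' where gh: "(g, h) \<in> fractions C" "A = ratfun C g h"
      "(g', h') \<in> fractions C" "B = ratfun C g' h'"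
    unfolding carrier_iff by metis
  then have "ev h \<noteq> 0" "ev h' \<noteq> 0" unfolding fractions_iff by blast+
  then show "emb (A \<oplus>\<^bsub>FF\<^esub> B) = emb A + emb B" "emb (A \<otimes>\<^bsub>FF\<^esub> B) = emb A * emb B"
    unfolding gh(2,4) mult_ratfun[OF gh(1,3)] add_ratfun[OF gh(1,3)]
      emb_ratfun[OF fractions_mult[OF gh(1,3)]] emb_ratfun[OF fractions_add[OF gh(1,3)]]
      emb_ratfun[OF gh(1)] emb_ratfun[OF gh(3)]
    by (simp_all add: gen.mev_mult gen.mev_add add_frac_eq)
qed

lemma emb_image: "emb ` carrier FF = K"
proof -
  have "emb ` carrier FF = {ev g / ev h |g h. (g, h) \<in> fractions C}"
  proof (intro Set.equalityI subsetI)
    fix z assume "z \<in> emb ` carrier FF"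
    then obtain A where A: "A \<in> carrier FF" "z = emb A" by (elim imageE)
    then obtain g h where "(g, h) \<in> fractions C" "z = emb (ratfun C g h)"
      using carrierE[OF A(1)] by metis
    then show "z \<in> {ev g / ev h |g h. (g, h) \<in> fractions C}" using emb_ratfun by blast
  next
    fix z assume "z \<in> {ev g / ev h |g h. (g, h) \<in> fractions C}"
    then obtain g h where "(g, h) \<in> fractions C" "z = emb (ratfun C g h)"
      using emb_ratfun by (smt (verit) mem_Collect_eq)
    moreover from this have "ratfun C g h \<in> carrier FF" unfolding carrier_iff by metis
    ultimately show "z \<in> emb ` carrier FF" by (intro image_eqI)
  qed
  then show ?thesis unfolding K_def fractions_iff by blast
qed

lemma K_uminus: "a \<in> K \<Longrightarrow> - a \<in> K"
proof -
  assume "a \<in> K"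
  then obtain g h d where "homogeneous_deg d g" "homogeneous_deg d h" "ev h \<noteq> 0" "a = ev g / ev h"
    by (auto simp: K_def)
  then have "- a = ev (- g) / ev h \<and> homogeneous_deg d (- g) \<and> homogeneous_deg d h \<and> ev h \<noteq> 0"
    by (simp add: type_ring_hom.hom_uminus[OF gen.mev_hom] homogeneous_deg_uminus)
  then show "- a \<in> K" unfolding K_def by blast
qed

lemma K_inverse: "a \<in> K \<Longrightarrow> inverse a \<in> K"
proof -
  assume a: "a \<in> K"
  then obtain g h d where gh: "homogeneous_deg d g" "homogeneous_deg d h" "ev h \<noteq> 0" "a = ev g / ev h"
    by (auto simp: K_def)
  show "inverse a \<in> K"
  proof (cases "a = 0")
    case False
    then have "inverse a = ev h / ev g \<and> homogeneous_deg d h \<and> homogeneous_deg d g \<and> ev g \<noteq> 0"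
      using gh by simp
    then show ?thesis unfolding K_def by blast
  qed (use a in simp)
qed

sublocale FF: field "function_field C"
proof (rule field_via_embedding[of emb])
  fix a assume "a \<in> carrier FF"
  then have "emb a \<in> K" using emb_image by blast
  then have "- emb a \<in> emb ` carrier FF" "inverse (emb a) \<in> emb ` carrier FF"
    by (simp_all add: emb_image K_uminus K_inverse)
  then show "\<exists>b\<in>carrier FF. emb b = - emb a" "\<exists>b\<in>carrier FF. emb b = inverse (emb a)"
    by (metis imageE)+
qed (use emb_inj FF_closed in simp_all)

lemma K_closed:
  "0 \<in> K" "1 \<in> K" "base c \<in> K"
  "a \<in> K \<Longrightarrow> b \<in> K \<Longrightarrow> a + b \<in> K" "a \<in> K \<Longrightarrow> b \<in> K \<Longrightarrow> a * b \<in> K"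
  "a \<in> K \<Longrightarrow> b \<in> K \<Longrightarrow> a - b \<in> K" "a \<in> K \<Longrightarrow> b \<in> K \<Longrightarrow> a / b \<in> K"
proof -
  have "ratfun C (Poly_Mapping.single 0 c) 1 \<in> carrier FF"
    using fractions_const unfolding carrier_iff by metis
  from imageI[OF this, of emb] show "base c \<in> K"
    by (simp only: emb_const emb_image)
  show "0 \<in> K" "1 \<in> K"
    using imageI[OF FF_closed(1), of emb] imageI[OF FF_closed(2), of emb]
    by (simp_all only: emb_zero_one emb_image)
  show add: "a + b \<in> K" if ab: "a \<in> K" "b \<in> K" for a b
  proof -
    obtain A B where "A \<in> carrier FF" "B \<in> carrier FF" "a = emb A" "b = emb B"
      using ab unfolding emb_image[symmetric] by (elim imageE) blast
    then show ?thesis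
      unfolding emb_image[symmetric] by (intro image_eqI[of _ _ "A \<oplus>\<^bsub>FF\<^esub> B"]) simp_all
  qed
  show mult: "a * b \<in> K" if ab: "a \<in> K" "b \<in> K" for a b
  proof -
    obtain A B where "A \<in> carrier FF" "B \<in> carrier FF" "a = emb A" "b = emb B"
      using ab unfolding emb_image[symmetric] by (elim imageE) blast
    then show ?thesis
      unfolding emb_image[symmetric] by (intro image_eqI[of _ _ "A \<otimes>\<^bsub>FF\<^esub> B"]) simp_all
  qed
  show "a - b \<in> K" if "a \<in> K" "b \<in> K"
    using add[of a "- b"] that by (simp add: K_uminus)
  show "a / b \<in> K" if "a \<in> K" "b \<in> K"
    using mult[of a "inverse b"] that by (simp add: K_inverse divide_inverse)
qed

lemma emb_eq_0_iff: "A \<in> carrier FF \<Longrightarrow> emb A = 0 \<longleftrightarrow> A = \<zero>\<^bsub>FF\<^esub>"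
  using inj_onD[OF emb_inj, of A "\<zero>\<^bsub>FF\<^esub>"] by auto

lemma emb_uminus [simp]: "A \<in> carrier FF \<Longrightarrow> emb (\<ominus>\<^bsub>FF\<^esub> A) = - emb A"
  using emb_add[of A "\<ominus>\<^bsub>FF\<^esub> A"] by (simp add: FF.r_neg eq_neg_iff_add_eq_0 add.commute del: emb_add)

lemma emb_minus [simp]:
  "A \<in> carrier FF \<Longrightarrow> B \<in> carrier FF \<Longrightarrow> emb (A \<ominus>\<^bsub>FF\<^esub> B) = emb A - emb B"
  by (simp add: a_minus_def)

lemma emb_inv [simp]:
  assumes "A \<in> carrier FF" "A \<noteq> \<zero>\<^bsub>FF\<^esub>"
  shows "emb (inv\<^bsub>FF\<^esub> A) = inverse (emb A)"
proof -
  have "A \<in> Units FF" using assms FF.field_Units by auto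
  then have "emb A * emb (inv\<^bsub>FF\<^esub> A) = 1"
    using emb_mult[of A "inv\<^bsub>FF\<^esub> A"] assms FF.Units_r_inv FF.Units_inv_closed by auto
  then show ?thesis by (metis inverse_unique)
qed

lemma emb_pow [simp]: "A \<in> carrier FF \<Longrightarrow> emb (A [^]\<^bsub>FF\<^esub> (n::nat)) = emb A ^ n"
  by (induction n) (simp_all add: mult.commute)

lemma emb_int_pow [simp]:
  assumes "A \<in> carrier FF" "A \<noteq> \<zero>\<^bsub>FF\<^esub>"
  shows "emb (A [^]\<^bsub>FF\<^esub> (n::int)) = emb A powi n" "A [^]\<^bsub>FF\<^esub> (n::int) \<in> carrier FF"
proof -
  have U: "A [^]\<^bsub>FF\<^esub> (k::nat) \<in> Units FF" for k
    using assms FF.field_Units FF.Units_pow_closed by auto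
  have nz: "A [^]\<^bsub>FF\<^esub> (k::nat) \<noteq> \<zero>\<^bsub>FF\<^esub>" for k using U[of k] FF.field_Units by auto
  have car: "A [^]\<^bsub>FF\<^esub> (k::nat) \<in> carrier FF" for k using U[of k] by (rule FF.Units_closed)
  show "emb (A [^]\<^bsub>FF\<^esub> (n::int)) = emb A powi n"
  proof (cases "n < 0")
    case True
    then have "\<not> 0 \<le> n" by simp
    with True show ?thesis
      unfolding int_pow_def2 power_int_def
      by (simp only: if_True if_False emb_inv[OF car nz] emb_pow[OF assms(1)] power_inverse)
  next
    case False
    then have "0 \<le> n" by simp
    with False show ?thesis
      unfolding int_pow_def2 power_int_def by (simp only: if_False if_True emb_pow[OF assms(1)])
  qed
  show "A [^]\<^bsub>FF\<^esub> (n::int) \<in> carrier FF"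
    unfolding int_pow_def2 using U FF.Units_inv_closed car by (simp only: split: if_splits) blast
qed

end

section \<open>Algebraic dependence over a finite field\<close>

lemma card_degree_le:
  "finite {p :: 'a::{field,finite} poly. degree p \<le> M}"
  "card {p :: 'a::{field,finite} poly. degree p \<le> M} \<le> CARD('a) ^ Suc M"
proof -
  have sub: "{p :: 'a poly. degree p \<le> M} \<subseteq> Poly ` {cs. set cs \<subseteq> UNIV \<and> length cs = Suc M}"
  proof
    fix p :: "'a poly" assume "p \<in> {p. degree p \<le> M}"
    then have "coeffs p @ replicate (Suc M - length (coeffs p)) 0 \<in> {cs. set cs \<subseteq> UNIV \<and> length cs = Suc M}"
      by (cases "p = 0") (auto simp: length_coeffs)
    moreover have "p = Poly (coeffs p @ replicate (Suc M - length (coeffs p)) 0)" by simp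
    ultimately show "p \<in> Poly ` {cs. set cs \<subseteq> UNIV \<and> length cs = Suc M}"
      by (rule image_eqI[rotated])
  qed
  have fin: "finite {cs :: 'a list. set cs \<subseteq> UNIV \<and> length cs = Suc M}"
    by (rule finite_lists_length_eq) simp
  show "finite {p :: 'a poly. degree p \<le> M}"
    by (rule finite_subset[OF sub finite_imageI[OF fin]])
  have "card {p :: 'a poly. degree p \<le> M} \<le> card {cs :: 'a list. set cs \<subseteq> UNIV \<and> length cs = Suc M}"
    by (rule order_trans[OF card_mono[OF finite_imageI[OF fin] sub] card_image_le[OF fin]])
  also have "\<dots> = CARD('a) ^ Suc M" by (rule card_lists_length_eq) simp
  finally show "card {p :: 'a poly. degree p \<le> M} \<le> CARD('a) ^ Suc M" .
qed

text \<open>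
  Let \<open>t\<close> and \<open>y\<close> be algebraic over \<open>k(x)\<close> of degrees at most \<open>d\<close> and \<open>d'\<close>. The space \<open>box M\<close> is
  spanned by the \<open>x\<^sup>a t\<^sup>l y\<^sup>m\<close> with \<open>a \<le> M\<close>, \<open>l < d\<close>, \<open>m < d'\<close>; its dimension grows linearly
  with \<open>M\<close>. Up to a common denominator, all \<open>t\<^sup>i y\<^sup>j\<close> with \<open>i, j \<le> N\<close> lie in such a space with \<open>M\<close>
  proportional to \<open>N\<close>. As their number grows quadratically, they cannot stay independent over \<open>k\<close>.
\<close>

locale finite_field_hom = type_ring_hom \<kappa> for \<kappa> :: "'a::{field,finite} \<Rightarrow> 'e::field"
begin

definition algebraic_over_adjoin :: "'e \<Rightarrow> 'e \<Rightarrow> bool" where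
  "algebraic_over_adjoin x t \<longleftrightarrow>
     (\<exists>d c. pev x (c d) \<noteq> 0 \<and> (\<Sum>l\<le>d. pev x (c l) * t ^ l) = 0)"

definition box_comb :: "'e \<Rightarrow> 'e \<Rightarrow> nat \<Rightarrow> 'e \<Rightarrow> nat \<Rightarrow> (nat \<Rightarrow> nat \<Rightarrow> 'a poly) \<Rightarrow> 'e" where
  "box_comb x t d y d' p = (\<Sum>l<d. \<Sum>m<d'. pev x (p l m) * t ^ l * y ^ m)"

definition box :: "'e \<Rightarrow> 'e \<Rightarrow> nat \<Rightarrow> 'e \<Rightarrow> nat \<Rightarrow> nat \<Rightarrow> 'e set" where
  "box x t d y d' M = {box_comb x t d y d' p |p. \<forall>l m. degree (p l m) \<le> M}"

lemma box_swap: "box x t d y d' M = box x y d' t d M"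
proof -
  have "box x t d y d' M \<subseteq> box x y d' t d M" for t d y d'
  proof
    fix v assume "v \<in> box x t d y d' M"
    then obtain p where p: "v = box_comb x t d y d' p" "\<forall>l m. degree (p l m) \<le> M"
      by (auto simp: box_def)
    have "v = box_comb x y d' t d (\<lambda>l m. p m l)"
      unfolding p box_comb_def by (subst sum.swap) (simp add: ac_simps)
    then show "v \<in> box x y d' t d M" unfolding box_def using p(2) by auto
  qed
  then show ?thesis by blast
qed

lemma box_one: "d > 0 \<Longrightarrow> d' > 0 \<Longrightarrow> 1 \<in> box x t d y d' 0"
proof -
  assume d: "d > 0" "d' > 0"
  have eq: "pev x (if l = 0 \<and> m = 0 then 1 else 0) * t ^ l * y ^ m = (if l = 0 then if m = 0 then 1 else 0 else 0)"
    for l m by (simp add: type_ring_hom.hom_one[OF pev_hom])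
  have "(\<Sum>m<d'. if l = 0 then if m = 0 then 1 else 0 else 0) = (if l = 0 then 1 else (0::'e))" for l :: nat
    using d by (simp add: sum.delta)
  then have "box_comb x t d y d' (\<lambda>l m. if l = 0 \<and> m = 0 then 1 else 0) = 1"
    unfolding box_comb_def eq using d by (simp add: sum.delta)
  then have "1 = box_comb x t d y d' (\<lambda>l m. if l = 0 \<and> m = 0 then 1 else 0)" ..
  then show ?thesis unfolding box_def by (auto intro!: exI[of _ "\<lambda>l m. if l = 0 \<and> m = 0 then 1 else 0"])
qed

lemma box_add:
  assumes "u \<in> box x t d y d' M" "v \<in> box x t d y d' M"
  shows "u + v \<in> box x t d y d' M"
proof -
  obtain p q where *: "u = box_comb x t d y d' p" "\<forall>l m. degree (p l m) \<le> M"
    "v = box_comb x t d y d' q" "\<forall>l m. degree (q l m) \<le> M"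
    using assms by (auto simp: box_def)
  have "u + v = box_comb x t d y d' (\<lambda>l m. p l m + q l m)"
    by (simp add: * box_comb_def pev_add sum.distrib ring_distribs)
  moreover have "\<forall>l m. degree (p l m + q l m) \<le> M" using * by (simp add: degree_add_le)
  ultimately show ?thesis unfolding box_def by blast
qed

lemma box_mult:
  assumes "degree q \<le> e" "v \<in> box x t d y d' M"
  shows "pev x q * v \<in> box x t d y d' (M + e)"
proof -
  obtain p where *: "v = box_comb x t d y d' p" "\<forall>l m. degree (p l m) \<le> M"
    using assms by (auto simp: box_def)
  have "pev x q * v = box_comb x t d y d' (\<lambda>l m. q * p l m)"
    by (simp add: * box_comb_def pev_mult sum_distrib_left ac_simps)
  moreover have "\<forall>l m. degree (q * p l m) \<le> M + e"
  proof (intro allI)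
    fix l m
    have "degree q + degree (p l m) \<le> M + e" using add_mono[of "degree q" e "degree (p l m)" M] * assms(1) by (simp add: add.commute)
    then show "degree (q * p l m) \<le> M + e" by (rule order_trans[OF degree_mult_le])
  qed
  ultimately show ?thesis unfolding box_def by blast
qed

lemma box_0: "0 \<in> box x t d y d' M"
proof -
  have "0 = box_comb x t d y d' (\<lambda>l m. 0)" by (simp add: box_comb_def)
  then show ?thesis unfolding box_def by fastforce
qed

lemma box_const_mult: "v \<in> box x t d y d' M \<Longrightarrow> \<kappa> a * v \<in> box x t d y d' M"
  using box_mult[of "[:a:]" 0] by simp

lemma box_sum: "(\<And>i. i \<in> A \<Longrightarrow> f i \<in> box x t d y d' M) \<Longrightarrow> sum f A \<in> box x t d y d' M"
  by (induction A rule: infinite_finite_induct) (auto intro: box_0 box_add)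

text \<open>
  The relation \<open>c\<^sub>d(x) t\<^sup>d = - \<Sum>\<^sub>l\<^sub><\<^sub>d c\<^sub>l(x) t\<^sup>l\<close> brings the power \<open>t\<^sup>d\<close> that arises from \<open>t\<^sup>d\<^sup>-\<^sup>1\<close> back into the
  range \<open>l < d\<close>, after multiplication by the leading coefficient \<open>c\<^sub>d(x)\<close> and at the cost of raising
  degrees in \<open>x\<close> by the degrees of the \<open>c\<^sub>l\<close>.
\<close>

lemma box_mult_root:
  assumes deg: "\<forall>l\<le>d. degree (c l) \<le> e" and root: "(\<Sum>l\<le>d. pev x (c l) * t ^ l) = 0"
    and d: "d > 0" and v: "v \<in> box x t d y d' M"
  shows "pev x (c d) * t * v \<in> box x t d y d' (M + e)"
proof -
  obtain p where *: "v = box_comb x t d y d' p" "\<forall>l m. degree (p l m) \<le> M"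
    using v by (auto simp: box_def)
  obtain k where k: "d = Suc k" using d by (cases d) auto
  define p' where "p' l m = (if l < d then c d * (if l = 0 then 0 else p (l - 1) m) - c l * p k m else 0)" for l m
  have td: "pev x (c d) * t ^ d = - (\<Sum>l<d. pev x (c l) * t ^ l)"
    using root by (simp add: lessThan_Suc_atMost[symmetric] add.commute eq_neg_iff_add_eq_0)
  have inner: "(\<Sum>l<d. pev x (p' l m) * t ^ l) = pev x (c d) * t * (\<Sum>l<d. pev x (p l m) * t ^ l)" for m
  proof -
    have "(\<Sum>l<d. pev x (p' l m) * t ^ l) =
        (\<Sum>l<d. pev x (c d) * (pev x (if l = 0 then 0 else p (l - 1) m) * t ^ l))
          - (\<Sum>l<d. pev x (c l) * t ^ l) * pev x (p k m)"
      unfolding sum_subtractf[symmetric] sum_distrib_right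
      by (intro sum.cong refl)
         (auto simp: p'_def pev_mult type_ring_hom.hom_diff[OF pev_hom] algebra_simps)
    also have "(\<Sum>l<d. pev x (c d) * (pev x (if l = 0 then 0 else p (l - 1) m) * t ^ l)) =
        pev x (c d) * t * (\<Sum>l<k. pev x (p l m) * t ^ l)"
      unfolding k sum.lessThan_Suc_shift by (simp add: sum_distrib_left ac_simps)
    also have "- ((\<Sum>l<d. pev x (c l) * t ^ l) * pev x (p k m)) = pev x (c d) * t ^ d * pev x (p k m)"
      using td by simp
    then have "pev x (c d) * t * (\<Sum>l<k. pev x (p l m) * t ^ l) - (\<Sum>l<d. pev x (c l) * t ^ l) * pev x (p k m)
      = pev x (c d) * t * (\<Sum>l<k. pev x (p l m) * t ^ l) + pev x (c d) * t ^ d * pev x (p k m)"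
      by simp
    also have "\<dots> = pev x (c d) * t * (\<Sum>l<d. pev x (p l m) * t ^ l)"
      unfolding k by (simp add: algebra_simps)
    finally show ?thesis .
  qed
  have swap: "box_comb x t d y d' r = (\<Sum>m<d'. (\<Sum>l<d. pev x (r l m) * t ^ l) * y ^ m)" for r
    unfolding box_comb_def by (subst sum.swap) (simp add: sum_distrib_right)
  have "pev x (c d) * t * v = box_comb x t d y d' p'"
    unfolding * swap inner by (subst sum_distrib_left) (simp only: ac_simps)
  moreover have "\<forall>l m. degree (p' l m) \<le> M + e"
  proof (intro allI)
    fix l m
    have mul: "degree (c l * r) \<le> M + e" if "l \<le> d" "degree r \<le> M" for l r
    proof -
      have "degree (c l) + degree r \<le> M + e" using add_mono[of "degree (c l)" e "degree r" M] deg that by (simp add: add.commute)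
      then show ?thesis by (rule order_trans[OF degree_mult_le])
    qed
    show "degree (p' l m) \<le> M + e"
    proof (cases "l < d")
      case True
      have "degree (c d * (if l = 0 then 0 else p (l - 1) m)) \<le> M + e"
        using *(2) by (intro mul) auto
      moreover have "degree (c l * p k m) \<le> M + e" using *(2) True by (intro mul) auto
      ultimately show ?thesis using True by (simp add: p'_def degree_diff_le)
    qed (simp add: p'_def)
  qed
  ultimately show ?thesis unfolding box_def by blast
qed

lemma card_box:
  "finite (box x t d y d' M)" "card (box x t d y d' M) \<le> CARD('a) ^ (Suc M * (d * d'))"
proof -
  let ?D = "{p :: 'a poly. degree p \<le> M}"
  let ?F = "{..<d} \<times> {..<d'} \<rightarrow>\<^sub>E ?D"
  have sub: "box x t d y d' M \<subseteq> (\<lambda>f. box_comb x t d y d' (\<lambda>l m. f (l, m))) ` ?F"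
  proof
    fix v assume "v \<in> box x t d y d' M"
    then obtain p where *: "v = box_comb x t d y d' p" "\<forall>l m. degree (p l m) \<le> M"
      by (auto simp: box_def)
    have "restrict (\<lambda>(l, m). p l m) ({..<d} \<times> {..<d'}) \<in> ?F" using * by auto
    moreover have "v = box_comb x t d y d' (\<lambda>l m. restrict (\<lambda>(l, m). p l m) ({..<d} \<times> {..<d'}) (l, m))"
      by (simp add: * box_comb_def)
    ultimately show "v \<in> (\<lambda>f. box_comb x t d y d' (\<lambda>l m. f (l, m))) ` ?F" by blast
  qed
  have fin: "finite ?F" using card_degree_le(1) by (intro finite_PiE) auto
  show "finite (box x t d y d' M)" by (rule finite_subset[OF sub finite_imageI[OF fin]])
  have "card (box x t d y d' M) \<le> card ?F"
    by (rule order_trans[OF card_mono[OF finite_imageI[OF fin] sub] card_image_le[OF fin]])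
  also have "\<dots> = card ?D ^ (d * d')" by (simp add: card_PiE)
  also have "\<dots> \<le> (CARD('a) ^ Suc M) ^ (d * d')"
    by (intro power_mono card_degree_le(2)) simp
  finally show "card (box x t d y d' M) \<le> CARD('a) ^ (Suc M * (d * d'))" by (simp only: power_mult)
qed

text \<open>
  Counting over the finite field \<open>k\<close> with \<open>q\<close> elements: there are \<open>q\<close> to the power \<open>(N + 1)\<^sup>2\<close> polynomials
  with both degrees at most \<open>N\<close>, but fewer available values, so two of them take the same value at
  \<open>(t, y)\<close>.
\<close>

theorem algebraically_dependent:
  assumes "algebraic_over_adjoin x t" "algebraic_over_adjoin x y"
  shows "\<exists>n b. (\<exists>j\<le>n. b j \<noteq> 0) \<and> (\<Sum>j\<le>n. pev t (b j) * y ^ j) = 0"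
proof -
  obtain d c where c: "pev x (c d) \<noteq> 0" "(\<Sum>l\<le>d. pev x (c l) * t ^ l) = 0"
    using assms by (auto simp: algebraic_over_adjoin_def)
  obtain d' c' where c': "pev x (c' d') \<noteq> 0" "(\<Sum>l\<le>d'. pev x (c' l) * y ^ l) = 0"
    using assms by (auto simp: algebraic_over_adjoin_def)
  have d: "d > 0" "d' > 0" using c c' by (auto intro!: Nat.gr0I)
  define e where "e = Max ((\<lambda>l. degree (c l)) ` {..d} \<union> (\<lambda>l. degree (c' l)) ` {..d'})"
  have e: "\<forall>l\<le>d. degree (c l) \<le> e" "\<forall>l\<le>d'. degree (c' l) \<le> e"
    by (auto simp: e_def)
  \<comment> \<open>With this choice \<open>(2 N e + 1) d d' \<le> N\<^sup>2 < (N + 1)\<^sup>2\<close>.\<close>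
  define N where "N = (2 * e + 1) * (d * d')"
  define \<gamma> \<delta> where "\<gamma> = pev x (c d)" and "\<delta> = pev x (c' d')"
  have nz: "\<gamma> ^ N * \<delta> ^ N \<noteq> 0" using c c' by (simp add: \<gamma>_def \<delta>_def)
  let ?B = "\<lambda>M. box x t d y d' M"
  have pow: "u ^ k * v \<in> ?B (M + k * e)"
    if "\<And>M v. v \<in> ?B M \<Longrightarrow> u * v \<in> ?B (M + e)" "v \<in> ?B M" for u v k M
  proof (induction k)
    case (Suc k)
    from that(1)[OF Suc] show ?case by (simp add: ac_simps)
  qed (use that in simp)
  have mono: "\<gamma> ^ N * \<delta> ^ N * t ^ i * y ^ j \<in> ?B (2 * N * e)" if ij: "i \<le> N" "j \<le> N" for i j
  proof -
    have s1: "\<gamma> * v \<in> ?B (M + e)" "\<delta> * v \<in> ?B (M + e)" if "v \<in> ?B M" for v M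
      unfolding \<gamma>_def \<delta>_def using box_mult[OF _ that] e by auto
    have s2: "\<gamma> * t * v \<in> ?B (M + e)" if "v \<in> ?B M" for v M
      unfolding \<gamma>_def using box_mult_root[OF e(1) c(2) d(1) that] .
    have s3: "\<delta> * y * v \<in> ?B (M + e)" if "v \<in> ?B M" for v M
      using box_mult_root[OF e(2) c'(2) d(2)] that
      unfolding \<delta>_def box_swap[of x t d] by blast
    have "(\<gamma> * t) ^ i * (\<gamma> ^ (N - i) * ((\<delta> * y) ^ j * (\<delta> ^ (N - j) * 1)))
        \<in> ?B (0 + (N - j) * e + j * e + (N - i) * e + i * e)"
      by (intro pow s1 s2 s3 box_one d)
    moreover have "(N - j) * e + j * e = N * e" "(N - i) * e + i * e = N * e"
      using ij by (simp_all add: add_mult_distrib[symmetric])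
    then have "0 + (N - j) * e + j * e + (N - i) * e + i * e = 2 * N * e" by simp
    moreover have "\<gamma> ^ N = \<gamma> ^ i * \<gamma> ^ (N - i)" "\<delta> ^ N = \<delta> ^ j * \<delta> ^ (N - j)"
      using ij by (simp_all add: power_add[symmetric])
    ultimately show ?thesis by (simp add: power_mult_distrib ac_simps)
  qed
  let ?A = "{..N} \<times> {..N} \<rightarrow>\<^sub>E (UNIV :: 'a set)"
  define \<Phi> where "\<Phi> a = (\<Sum>j\<le>N. \<Sum>i\<le>N. \<kappa> (a (i, j)) * (\<gamma> ^ N * \<delta> ^ N * t ^ i * y ^ j))" for a
  have "\<Phi> ` ?A \<subseteq> ?B (2 * N * e)"
    unfolding \<Phi>_def by (auto intro!: box_sum box_const_mult mono)
  then have "card (\<Phi> ` ?A) \<le> CARD('a) ^ (Suc (2 * N * e) * (d * d'))"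
    by (rule order_trans[OF card_mono[OF card_box(1)] card_box(2)])
  also have "\<dots> < CARD('a) ^ ((N + 1) * (N + 1))"
  proof (rule power_strict_increasing)
    have "(0::'a) \<noteq> 1" by simp
    then have "card {0, 1::'a} \<le> CARD('a)" by (intro card_mono) auto
    then show "1 < CARD('a)" by simp
    have "N > 0" using d by (simp add: N_def)
    then have "N \<ge> 1" by simp
    have "Suc (2 * N * e) * (d * d') \<le> (N * (2 * e + 1)) * (d * d')"
      using \<open>N \<ge> 1\<close> by (intro mult_right_mono) (auto simp: algebra_simps)
    also have "\<dots> = N * N" by (simp only: mult.assoc N_def[symmetric])
    also have "\<dots> < (N + 1) * (N + 1)" by simp
    finally show "Suc (2 * N * e) * (d * d') < (N + 1) * (N + 1)" .
  qed
  also have "\<dots> = card ?A" by (simp add: card_PiE card_cartesian_product)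
  finally have "\<not> inj_on \<Phi> ?A" by (intro pigeonhole)
  then obtain f g where fg: "f \<in> ?A" "g \<in> ?A" "f \<noteq> g" "\<Phi> f = \<Phi> g"
    by (auto simp: inj_on_def)
  have "\<exists>k\<in>{..N} \<times> {..N}. f k \<noteq> g k"
    using PiE_ext[OF fg(1,2)] fg(3) by blast
  then obtain i0 j0 where ij: "i0 \<le> N" "j0 \<le> N" "f (i0, j0) \<noteq> g (i0, j0)"
    by auto
  define b where "b j = (\<Sum>i\<le>N. Polynomial.monom (f (i, j) - g (i, j)) i)" for j
  have "coeff (b j0) i0 = f (i0, j0) - g (i0, j0)"
    using ij by (simp add: b_def coeff_sum sum.delta)
  then have "b j0 \<noteq> 0" using ij by auto
  moreover have "(\<Sum>j\<le>N. pev t (b j) * y ^ j) = 0"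
  proof -
    have "\<gamma> ^ N * \<delta> ^ N * (\<Sum>j\<le>N. pev t (b j) * y ^ j) = \<Phi> f - \<Phi> g"
      by (simp add: \<Phi>_def b_def pev_sum pev_monom sum_distrib_left sum_distrib_right
          sum_subtractf[symmetric] algebra_simps)
    then have "\<gamma> ^ N * \<delta> ^ N * (\<Sum>j\<le>N. pev t (b j) * y ^ j) = 0" using fg by simp
    then show ?thesis using nz mult_eq_0_iff by blast
  qed
  ultimately show ?thesis using ij by blast
qed

end

section \<open>Specializations\<close>

text \<open>
  Subrings of the algebraic closure that contain the base field are fields. This makes localizations
  unnecessary in the extension of specializations.
\<close>

lemma alg_closure_inverse_polynomial:
  fixes b :: "'a::field alg_closure"
  assumes "b \<noteq> 0"
  shows "\<exists>q. b * ac.pev b q = 1"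
proof -
  obtain p :: "'a poly" where "p \<noteq> 0" "ac.pev b p = 0"
    using alg_closure_algebraic[of b] by (auto simp: ac.pev_def)
  then show ?thesis
  proof (induction p)
    case (pCons c q)
    show ?case
    proof (cases "c = 0")
      case True
      then show ?thesis using pCons assms by auto
    next
      case False
      have "b * ac.pev b q = - to_ac c" using pCons.prems by (simp add: eq_neg_iff_add_eq_0 add.commute)
      then have "b * ac.pev b (Polynomial.smult (- inverse c) q) = 1"
        unfolding ac.pev_smult mult.left_commute[of b] using False by simp
      then show ?thesis by blast
    qed
  qed simp
qed

text \<open>
  A factorization at \<open>0\<close>: \<open>e\<close> is the order of vanishing there.
\<close>

lemma poly_factor_var:
  "p \<noteq> 0 \<Longrightarrow> \<exists>e q. p = Polynomial.monom 1 e * q \<and> coeff q 0 \<noteq> 0" for p :: "'a::field poly"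
proof (induction p)
  case (pCons a p)
  show ?case
  proof (cases "a = 0")
    case True
    then obtain e q where *: "p = Polynomial.monom 1 e * q" "coeff q 0 \<noteq> 0" using pCons by auto
    have "pCons a p = Polynomial.monom 1 (Suc e) * q" by (simp add: True * monom_Suc)
    then show ?thesis using * by blast
  next
    case False
    then show ?thesis by (intro exI[of _ 0] exI[of _ "pCons a p"]) (simp add: monom_0)
  qed
qed simp

text \<open>
  A specialization is a \<open>k\<close>-algebra homomorphism from a subring of a field \<open>'e\<close> to the algebraic
  closure of \<open>k\<close>. It is represented by its graph \<open>G\<close>: then the subring need not be named separately
  and extending a homomorphism is inclusion of graphs.
\<close>

locale specialization = type_ring_hom \<kappa> for \<kappa> :: "'a::field \<Rightarrow> 'e::field" +
  fixes G :: "('e \<times> 'a alg_closure) set"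
  assumes const: "(\<kappa> c, to_ac c) \<in> G"
    and add: "(a, b) \<in> G \<Longrightarrow> (a', b') \<in> G \<Longrightarrow> (a + a', b + b') \<in> G"
    and mult: "(a, b) \<in> G \<Longrightarrow> (a', b') \<in> G \<Longrightarrow> (a * a', b * b') \<in> G"
    and functional: "(0, b) \<in> G \<Longrightarrow> b = 0"
begin

lemma zero: "(0, 0) \<in> G" and one: "(1, 1) \<in> G"
  using const[of 0] const[of 1] by simp_all

lemma uminus: "(a, b) \<in> G \<Longrightarrow> (- a, - b) \<in> G"
  using mult[OF const[of "-1"], of a b] by simp

lemma diff: "(a, b) \<in> G \<Longrightarrow> (a', b') \<in> G \<Longrightarrow> (a - a', b - b') \<in> G"
  using add[OF _ uminus, of a b a' b'] by simp

lemma sum: "(\<And>i. i \<in> A \<Longrightarrow> (f i, g i) \<in> G) \<Longrightarrow> (sum f A, sum g A) \<in> G"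
  by (induction A rule: infinite_finite_induct) (auto intro: zero add)

lemma prod: "(\<And>i. i \<in> A \<Longrightarrow> (f i, g i) \<in> G) \<Longrightarrow> (prod f A, prod g A) \<in> G"
  by (induction A rule: infinite_finite_induct) (auto intro: one mult)

lemma power: "(a, b) \<in> G \<Longrightarrow> (a ^ n, b ^ n) \<in> G"
  by (induction n) (auto intro: one mult)

lemma pev: "(a, b) \<in> G \<Longrightarrow> (pev a p, ac.pev b p) \<in> G"
  by (induction p) (auto intro!: zero add mult const)

lemma mev: "(\<And>i. (x i, y i) \<in> G) \<Longrightarrow> (mev x p, ac.mev y p) \<in> G"
  unfolding mev_def ac.mev_def by (intro sum mult const prod power)

lemma value_inverse:
  assumes "(a, b) \<in> G" "b \<noteq> 0"
  shows "\<exists>a'. (a', inverse b) \<in> G"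
proof -
  obtain q where "b * ac.pev b q = 1" using alg_closure_inverse_polynomial assms by blast
  then have "ac.pev b q = inverse b" by (metis inverse_unique)
  then show ?thesis using pev[OF assms(1), of q] by metis
qed

text \<open>
  Cancel the common power of \<open>y\<close> in the relation; the rest says that \<open>y\<close> divides \<open>b\<^sub>j(t)\<close> for some
  \<open>b\<^sub>j \<noteq> 0\<close>. Write \<open>b\<^sub>j = X\<^sup>e q\<close> with \<open>q(0) \<noteq> 0\<close>. If \<open>y\<close> were divisible by \<open>t\<^sup>e\<^sup>+\<^sup>1\<close>, then \<open>q(t)\<close> would be
  divisible by \<open>t\<close> and specialize to \<open>0\<close>, but it specializes to \<open>q(0)\<close>.
\<close>

lemma no_infinitely_divisible:
  assumes t: "(t, 0) \<in> G" "t \<noteq> 0" and y: "y \<noteq> 0" "(y, \<beta>) \<in> G"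
    and dep: "\<exists>j\<le>n. b j \<noteq> 0" "(\<Sum>j\<le>n. pev t (b j) * y ^ j) = 0"
  shows "\<exists>k. \<forall>w \<in> Domain G. y \<noteq> t ^ k * w"
proof (rule ccontr)
  assume "\<not> ?thesis"
  then have div: "\<exists>w\<in>Domain G. y = t ^ k * w" for k by blast
  define j0 where "j0 = (LEAST j. b j \<noteq> 0)"
  have j0: "b j0 \<noteq> 0" "j0 \<le> n" "\<And>j. j < j0 \<Longrightarrow> b j = 0"
  proof -
    obtain j where j: "j \<le> n" "b j \<noteq> 0" using dep(1) by blast
    show "b j0 \<noteq> 0" unfolding j0_def by (rule LeastI[of "\<lambda>j. b j \<noteq> 0", OF j(2)])
    show "j0 \<le> n" using Least_le[of "\<lambda>j. b j \<noteq> 0", OF j(2)] j(1) unfolding j0_def by simp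
    show "b j = 0" if "j < j0" for j using not_less_Least[of j "\<lambda>j. b j \<noteq> 0"] that unfolding j0_def by simp
  qed
  define r where "r = (\<Sum>j\<in>{Suc j0..n}. pev t (b j) * y ^ (j - Suc j0))"
  define \<rho> where "\<rho> = (\<Sum>j\<in>{Suc j0..n}. ac.pev 0 (b j) * \<beta> ^ (j - Suc j0))"
  have r: "(r, \<rho>) \<in> G"
    unfolding r_def \<rho>_def using t y by (intro sum mult pev power)
  have "0 = (\<Sum>j\<in>{..n}. pev t (b j) * y ^ j)" using dep by simp
  also have "\<dots> = (\<Sum>j\<in>{j0..n}. pev t (b j) * y ^ j)"
    using j0(3) by (intro sum.mono_neutral_right) (auto simp: not_le)
  also have "\<dots> = pev t (b j0) * y ^ j0 + (\<Sum>j\<in>{Suc j0..n}. pev t (b j) * y ^ j)"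
    using j0(2) by (rule sum.atLeast_Suc_atMost)
  also have "(\<Sum>j\<in>{Suc j0..n}. pev t (b j) * y ^ j) = y ^ j0 * (y * r)"
    unfolding r_def sum_distrib_left
  proof (intro sum.cong refl)
    fix j assume "j \<in> {Suc j0..n}"
    then have "y ^ j = y ^ j0 * (y * y ^ (j - Suc j0))"
      by (simp flip: power_Suc power_add)
    then show "pev t (b j) * y ^ j = y ^ j0 * (y * (pev t (b j) * y ^ (j - Suc j0)))"
      by (simp add: ac_simps)
  qed
  finally have "y ^ j0 * (pev t (b j0) + y * r) = 0" by (simp add: algebra_simps)
  then have eq: "pev t (b j0) = - (y * r)" using y by (simp add: eq_neg_iff_add_eq_0)
  obtain e q where q: "b j0 = Polynomial.monom 1 e * q" "coeff q 0 \<noteq> 0"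
    using poly_factor_var j0 by blast
  have pq: "pev t (b j0) = t ^ e * pev t q"
    by (simp add: q pev_mult pev_monom)
  have *: "t ^ e * pev t q + y * r = 0" unfolding pq[symmetric] eq by simp
  obtain w \<omega> where w: "(w, \<omega>) \<in> G" "y = t ^ Suc e * w" using div[of "Suc e"] by auto
  have "t ^ e * (pev t q + t * w * r) = t ^ e * pev t q + y * r" unfolding w(2) by (simp add: algebra_simps)
  then have "t ^ e * (pev t q + t * w * r) = 0" using * by simp
  then have "pev t q + t * w * r = 0" using t by simp
  moreover have "(pev t q + t * w * r, ac.pev 0 q + 0 * \<omega> * \<rho>) \<in> G"
    using t w r by (intro add mult pev)
  moreover have "ac.pev 0 q = to_ac (coeff q 0)" by (cases q) simp
  ultimately show False using functional q(2) by force
qed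

text \<open>
  \<open>q\<close> arises from \<open>p\<close> by specializing coefficients. The specialization extends to \<open>z\<close> if and only if
  the polynomials \<open>q\<close> that belong in this way to some \<open>p\<close> with \<open>p(z) = 0\<close> have a common zero.
\<close>

definition coeffwise :: "'e poly \<Rightarrow> 'a alg_closure poly \<Rightarrow> bool" where
  "coeffwise p q \<longleftrightarrow> (\<forall>i. (coeff p i, coeff q i) \<in> G)"

lemma coeffwise_add: "coeffwise p q \<Longrightarrow> coeffwise p' q' \<Longrightarrow> coeffwise (p + p') (q + q')"
  by (simp add: coeffwise_def add)

lemma coeffwise_diff: "coeffwise p q \<Longrightarrow> coeffwise p' q' \<Longrightarrow> coeffwise (p - p') (q - q')"
  by (simp add: coeffwise_def diff)

lemma coeffwise_mult: "coeffwise p q \<Longrightarrow> coeffwise p' q' \<Longrightarrow> coeffwise (p * p') (q * q')"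
  by (auto simp: coeffwise_def coeff_mult intro!: sum mult)

lemma coeffwise_monom: "(a, b) \<in> G \<Longrightarrow> coeffwise (Polynomial.monom a n) (Polynomial.monom b n)"
  by (simp add: coeffwise_def zero)

text \<open>
  A relation that obstructs an extension to \<open>z\<close>: it specializes to a non-zero constant.
\<close>

definition unit_relation :: "'e \<Rightarrow> 'e poly \<Rightarrow> bool" where
  "unit_relation z p \<longleftrightarrow> poly p z = 0 \<and> (\<exists>c. c \<noteq> 0 \<and> coeffwise p [:c:])"

lemma unit_relation_degree_pos: "unit_relation z p \<Longrightarrow> degree p > 0"
proof (rule ccontr)
  assume p: "unit_relation z p" and "\<not> degree p > 0"
  then obtain a where "p = [:a:]" using degree_eq_zeroE by blast
  then show False
    using p functional by (auto simp: unit_relation_def coeffwise_def dest!: spec[of _ 0])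
qed

text \<open>
  If \<open>p\<^sub>0 + p\<^sub>1 z + \<dots> + p\<^sub>n z\<^sup>n = 0\<close> and \<open>r\<^sub>0 + r\<^sub>1 z\<^sup>-\<^sup>1 + \<dots> + r\<^sub>l z\<^sup>-\<^sup>l = 0\<close> are such obstructions and \<open>l \<le> n\<close>, then
  \<open>z\<^sup>n\<close> times the second relation can be used to remove the term of degree \<open>n\<close> from \<open>r\<^sub>0\<close> times the
  first. The constant term still specializes to something non-zero, since \<open>p\<^sub>n\<close> specializes to \<open>0\<close>.
\<close>

lemma not_both_unit_relation_aux:
  assumes z: "z \<noteq> 0" and p: "unit_relation z p" and r: "unit_relation (inverse z) r"
    and le: "degree r \<le> degree p"
  shows "\<exists>p'. unit_relation z p' \<and> degree p' < degree p"
proof -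
  define n where "n = degree p"
  have n: "n > 0" using unit_relation_degree_pos[OF p] by (simp add: n_def)
  obtain \<alpha> where \<alpha>: "\<alpha> \<noteq> 0" "coeffwise p [:\<alpha>:]" using p by (auto simp: unit_relation_def)
  obtain \<beta> where \<beta>: "\<beta> \<noteq> 0" "coeffwise r [:\<beta>:]" using r by (auto simp: unit_relation_def)
  \<comment> \<open>This is \<open>z\<^sup>n r(1/z)\<close> as a polynomial in \<open>z\<close>.\<close>
  define s where "s = (\<Sum>j\<le>n. Polynomial.monom (coeff r j) (n - j))"
  have coeff_s: "coeff s i = (if i \<le> n then coeff r (n - i) else 0)" for i
  proof -
    have "coeff s i = (\<Sum>j\<le>n. if n - j = i then coeff r j else 0)"
      by (simp add: s_def coeff_sum)
    also have "\<dots> = (\<Sum>j\<le>n. if j = n - i then (if i \<le> n then coeff r j else 0) else 0)"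
      by (intro sum.cong) auto
    finally show ?thesis by (simp add: sum.delta)
  qed
  have poly_s: "poly s z = 0"
  proof -
    have "poly r (inverse z) = (\<Sum>j\<le>n. coeff r j * inverse z ^ j)"
      using le unfolding poly_altdef n_def[symmetric]
      by (intro sum.mono_neutral_left) (auto simp: coeff_eq_0)
    then have "(\<Sum>j\<le>n. coeff r j * inverse z ^ j) = 0"
      using r by (simp add: unit_relation_def)
    then have "z ^ n * (\<Sum>j\<le>n. coeff r j * inverse z ^ j) = 0" by simp
    moreover have "z ^ n * inverse z ^ j = z ^ (n - j)" if "j \<le> n" for j
      using z that by (simp add: power_diff power_inverse divide_inverse)
    ultimately show ?thesis
      unfolding s_def poly_sum sum_distrib_left by (simp add: poly_monom ac_simps)
  qed
  define p' where "p' = Polynomial.smult (coeff r 0) p - Polynomial.smult (coeff p n) s"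
  have "poly p' z = 0" using p poly_s by (simp add: p'_def unit_relation_def)
  moreover have "coeffwise p' [:\<beta> * \<alpha>:]"
    unfolding coeffwise_def
  proof
    fix i
    have "(coeff r 0 * coeff p i, \<beta> * coeff [:\<alpha>:] i) \<in> G"
    proof (rule mult)
      show "(coeff r 0, \<beta>) \<in> G" using \<beta>(2) unfolding coeffwise_def by (metis coeff_pCons_0)
      show "(coeff p i, coeff [:\<alpha>:] i) \<in> G" using \<alpha>(2) unfolding coeffwise_def by blast
    qed
    moreover have "coeff [:\<alpha>:] n = 0" using n by (cases n) auto
    then have "(coeff p n, 0) \<in> G" using spec[OF \<alpha>(2)[unfolded coeffwise_def], of n] by simp
    then have "(coeff p n * coeff s i, 0 * (if i \<le> n then coeff [:\<beta>:] (n - i) else 0)) \<in> G"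
      using \<beta>(2) unfolding coeff_s coeffwise_def by (intro mult) (auto simp: zero)
    ultimately have "(coeff r 0 * coeff p i - coeff p n * coeff s i, \<beta> * coeff [:\<alpha>:] i - 0) \<in> G"
      by (intro diff) simp_all
    then show "(coeff p' i, coeff [:\<beta> * \<alpha>:] i) \<in> G"
      by (cases i) (simp_all add: p'_def)
  qed
  moreover have "degree p' < n"
  proof -
    have "degree s \<le> n" by (rule degree_le) (simp add: coeff_s)
    then have "degree p' \<le> n" unfolding p'_def
      by (intro degree_diff_le) (auto intro: order_trans[OF degree_smult_le] simp: n_def)
    moreover have "coeff p' n = 0" by (simp add: p'_def coeff_s)
    ultimately show ?thesis using n
      by (metis coeff_eq_0 degree_0 le_neq_implies_less leading_coeff_0_iff)
  qed
  moreover have "\<beta> * \<alpha> \<noteq> 0" using \<alpha>(1) \<beta>(1) by simp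
  ultimately show ?thesis unfolding unit_relation_def n_def by blast
qed

lemma not_both_unit_relation:
  assumes "z \<noteq> 0" "unit_relation z p" "unit_relation (inverse z) r"
  shows False
  using assms
proof (induction "degree p + degree r" arbitrary: z p r rule: less_induct)
  case less
  show False
  proof (cases "degree r \<le> degree p")
    case True
    then show False using not_both_unit_relation_aux[OF less.prems True] less by (meson add_less_mono1)
  next
    case False
    then obtain r' where "unit_relation (inverse z) r'" "degree r' < degree r"
      using not_both_unit_relation_aux[of "inverse z" r p] less.prems by auto
    then show False using less by (meson add_less_cancel_left)
  qed
qed

text \<open>
  The polynomials \<open>J\<close> that have to vanish at the value of \<open>z\<close> are closed under subtraction and under
  multiplication by monomials with specialized coefficients. As specialized values form a field,
  division with remainder works and an element of least degree divides all of them. It is not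
  constant, so its roots are common zeros.
\<close>

lemma extend_to_element:
  assumes no_unit: "\<And>p. \<not> unit_relation z p"
  shows "\<exists>G' w. G \<subseteq> G' \<and> (z, w) \<in> G' \<and> specialization \<kappa> G'"
proof -
  define J where "J = {q. \<exists>p. coeffwise p q \<and> poly p z = 0}"
  have deg_pos: "degree q > 0" if "q \<in> J" "q \<noteq> 0" for q
  proof (rule ccontr)
    assume "\<not> degree q > 0"
    then obtain c where "q = [:c:]" using degree_eq_zeroE by blast
    then show False using that no_unit by (auto simp: J_def unit_relation_def)
  qed
  obtain w where w: "\<And>q. q \<in> J \<Longrightarrow> poly q w = 0"
  proof (cases "J \<subseteq> {0}")
    case True
    then show ?thesis by (intro that[of 0]) auto
  next
    case False
    define q0 where "q0 = arg_min degree (\<lambda>q. q \<in> J \<and> q \<noteq> 0)"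
    have q0: "q0 \<in> J" "q0 \<noteq> 0" and min: "\<And>q. q \<in> J \<Longrightarrow> q \<noteq> 0 \<Longrightarrow> degree q0 \<le> degree q"
      using False arg_min_nat_lemma[of "\<lambda>q. q \<in> J \<and> q \<noteq> 0" _ degree] unfolding q0_def by blast+
    obtain w where w: "poly q0 w = 0"
      using alg_closed_imp_poly_has_root[OF deg_pos[OF q0]] by blast
    obtain p0 where p0: "coeffwise p0 q0" "poly p0 z = 0" using q0 by (auto simp: J_def)
    have "\<exists>a. (a, inverse (lead_coeff q0)) \<in> G"
      using p0 q0 by (intro value_inverse) (auto simp: coeffwise_def)
    then obtain a0 where a0: "(a0, inverse (lead_coeff q0)) \<in> G" ..
    have "poly q w = 0" if "q \<in> J" for q
      using that
    proof (induction "degree q" arbitrary: q rule: less_induct)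
      case less
      show ?case
      proof (cases "q = 0")
        case False
        have le: "degree q0 \<le> degree q" using min less.prems False by blast
        obtain p where p: "coeffwise p q" "poly p z = 0" using less.prems by (auto simp: J_def)
        define u where "u = lead_coeff q * inverse (lead_coeff q0)"
        define k where "k = degree q - degree q0"
        define q' where "q' = q - Polynomial.monom u k * q0"
        have u: "(coeff p (degree q) * a0, u) \<in> G"
          using p a0 unfolding u_def coeffwise_def by (intro mult) auto
        have "coeffwise (p - Polynomial.monom (coeff p (degree q) * a0) k * p0) q'"
          unfolding q'_def using p p0 u by (intro coeffwise_diff coeffwise_mult coeffwise_monom)
        then have "q' \<in> J" using p p0 by (auto simp: J_def intro!: exI)
        moreover have "degree q' < degree q"
        proof -
          have "degree (Polynomial.monom u k * q0) \<le> k + degree q0"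
            by (intro order_trans[OF degree_mult_le] add_mono degree_monom_le order_refl)
          then have "degree q' \<le> degree q"
            unfolding q'_def using le by (intro degree_diff_le) (simp_all add: k_def)
          moreover have "coeff q' (degree q) = 0"
            using q0 le by (simp add: q'_def coeff_monom_mult k_def u_def)
          ultimately show ?thesis using deg_pos[OF less.prems False]
            by (metis coeff_eq_0 degree_0 le_neq_implies_less leading_coeff_0_iff)
        qed
        ultimately have "poly q' w = 0" using less.hyps by blast
        then show ?thesis using w by (simp add: q'_def)
      qed simp
    qed
    then show ?thesis using that by blast
  qed
  define G' where "G' = {(poly p z, poly q w) |p q. coeffwise p q}"
  have cw_const: "coeffwise [:a:] [:b:]" if "(a, b) \<in> G" for a b
    using coeffwise_monom[OF that, of 0] by (simp add: monom_0)
  have "G \<subseteq> G'"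
  proof
    fix g assume "g \<in> G"
    then show "g \<in> G'"
      unfolding G'_def using cw_const[of "fst g" "snd g"]
      by (auto intro!: exI[of _ "[:fst g:]"] exI[of _ "[:snd g:]"])
  qed
  moreover have "(z, w) \<in> G'"
    unfolding G'_def using coeffwise_monom[OF one, of 1]
    by (auto intro!: exI[of _ "Polynomial.monom 1 1"] simp: poly_monom)
  moreover have "specialization \<kappa> G'"
  proof unfold_locales
    show "(\<kappa> c, to_ac c) \<in> G'" for c using \<open>G \<subseteq> G'\<close> const by blast
    fix a b a' b' assume "(a, b) \<in> G'" "(a', b') \<in> G'"
    then obtain p q p' q' where pq: "a = poly p z" "b = poly q w" "coeffwise p q"
      "a' = poly p' z" "b' = poly q' w" "coeffwise p' q'"
      unfolding G'_def by blast
    have "(poly (p + p') z, poly (q + q') w) \<in> G'" "(poly (p * p') z, poly (q * q') w) \<in> G'"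
      unfolding G'_def using coeffwise_add[OF pq(3,6)] coeffwise_mult[OF pq(3,6)] by blast+
    then show "(a + a', b + b') \<in> G'" "(a * a', b * b') \<in> G'" by (simp_all add: pq)
  next
    fix b assume "(0, b) \<in> G'"
    then obtain p q where "poly p z = 0" "b = poly q w" "coeffwise p q" by (auto simp: G'_def)
    then show "b = 0" using w by (auto simp: J_def)
  qed
  ultimately show ?thesis by blast
qed

text \<open>
  Chevalley's extension theorem for one element: \<open>z\<close> and \<open>1/z\<close> cannot both be obstructed.
\<close>

theorem extend_to_element_or_inverse:
  assumes "z \<noteq> 0"
  shows "\<exists>G'. G \<subseteq> G' \<and> specialization \<kappa> G' \<and> ((\<exists>w. (z, w) \<in> G') \<or> (\<exists>w. (inverse z, w) \<in> G'))"
  using not_both_unit_relation[OF assms] extend_to_element by metis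

end

lemma specialization_extend_finite:
  assumes "finite Z" "0 \<notin> Z" "specialization \<kappa> G"
  shows "\<exists>G'. G \<subseteq> G' \<and> specialization \<kappa> G' \<and>
    (\<forall>z\<in>Z. (\<exists>w. (z, w) \<in> G') \<or> (\<exists>w. (inverse z, w) \<in> G'))"
  using assms
proof (induction Z rule: finite_induct)
  case (insert z Z)
  then obtain G1 where G1: "G \<subseteq> G1" "specialization \<kappa> G1"
    "\<forall>z\<in>Z. (\<exists>w. (z, w) \<in> G1) \<or> (\<exists>w. (inverse z, w) \<in> G1)" by auto
  have "z \<noteq> 0" using insert by auto
  then obtain G2 where "G1 \<subseteq> G2" "specialization \<kappa> G2" "(\<exists>w. (z, w) \<in> G2) \<or> (\<exists>w. (inverse z, w) \<in> G2)"
    using specialization.extend_to_element_or_inverse[OF G1(2)] by metis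
  with G1 show ?case by (intro exI[of _ G2]) blast
qed auto

section \<open>Discrete valuation rings\<close>

text \<open>
  \<open>K\<close> consists of fractions of elements of the ring \<open>V\<close>, whose non-units \<open>M\<close> are the multiples of \<open>\<tau>\<close>.
  The last condition replaces the Noetherian property: together with \<open>M = \<tau>V\<close> it makes \<open>V\<close> a discrete valuation
  ring.
\<close>

locale dvr =
  fixes K V M :: "'e::field set" and \<tau> :: 'e
  assumes V_one: "1 \<in> V"
    and V_diff: "a \<in> V \<Longrightarrow> b \<in> V \<Longrightarrow> a - b \<in> V"
    and V_mult: "a \<in> V \<Longrightarrow> b \<in> V \<Longrightarrow> a * b \<in> V"
    and M_eq: "M = (*) \<tau> ` V"
    and M_subset: "M \<subseteq> V"
    and V_unit: "a \<in> V \<Longrightarrow> a \<notin> M \<Longrightarrow> inverse a \<in> V"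
    and one_notin_M: "1 \<notin> M"
    and \<tau>_nonzero: "\<tau> \<noteq> 0"
    and K_quotient: "f \<in> K \<Longrightarrow> \<exists>a\<in>V. \<exists>b\<in>V. b \<noteq> 0 \<and> f = a / b"
    and separated: "y \<in> V \<Longrightarrow> y \<noteq> 0 \<Longrightarrow> \<exists>n. y \<notin> (*) (\<tau> ^ n) ` V"
begin

lemma V_zero: "0 \<in> V"
  using V_diff[OF V_one V_one] by simp

lemma V_uminus: "a \<in> V \<Longrightarrow> - a \<in> V"
  using V_diff[OF V_zero] by simp

lemma V_add: "a \<in> V \<Longrightarrow> b \<in> V \<Longrightarrow> a + b \<in> V"
  using V_diff[OF _ V_uminus, of a b] by simp

lemma V_power: "a \<in> V \<Longrightarrow> a ^ n \<in> V"
  by (induction n) (auto intro: V_one V_mult)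

lemma \<tau>_in_M: "\<tau> \<in> M"
  unfolding M_eq using V_one by force

lemma \<tau>_in_V: "\<tau> \<in> V"
  using \<tau>_in_M M_subset by blast

lemma M_mult: "a \<in> M \<Longrightarrow> b \<in> V \<Longrightarrow> a * b \<in> M"
  unfolding M_eq using V_mult by (force simp: mult.assoc)

lemma M_add: "a \<in> M \<Longrightarrow> b \<in> M \<Longrightarrow> a + b \<in> M"
  unfolding M_eq using V_add by (force simp flip: distrib_left)

lemma zero_in_M: "0 \<in> M"
  unfolding M_eq using V_zero by force

definition U :: "'e set" where "U = V - M"

lemma U_V: "u \<in> U \<Longrightarrow> u \<in> V"
  by (simp add: U_def)

lemma U_nonzero: "u \<in> U \<Longrightarrow> u \<noteq> 0"
  using zero_in_M by (auto simp: U_def)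

lemma U_one: "1 \<in> U"
  using V_one one_notin_M by (simp add: U_def)

lemma U_I: "a \<in> V \<Longrightarrow> b \<in> V \<Longrightarrow> a * b = 1 \<Longrightarrow> a \<in> U"
  using M_mult[of a b] one_notin_M by (auto simp: U_def)

lemma U_inverse: "u \<in> U \<Longrightarrow> inverse u \<in> U"
  using U_nonzero V_unit by (intro U_I[of _ u]) (auto simp: U_def)

lemma U_mult: 
  assumes "u \<in> U" "w \<in> U"
  shows "u * w \<in> U"
proof (rule U_I)
  show "u * w \<in> V" "inverse u * inverse w \<in> V"
    using V_mult[OF U_V[OF assms(1)] U_V[OF assms(2)]]
      V_mult[OF U_V[OF U_inverse[OF assms(1)]] U_V[OF U_inverse[OF assms(2)]]] by simp_all
  show "u * w * (inverse u * inverse w) = 1"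
    using U_nonzero[OF assms(1)] U_nonzero[OF assms(2)] by (simp add: field_simps)
qed

lemma U_power: "u \<in> U \<Longrightarrow> u ^ n \<in> U"
  by (induction n) (auto intro: U_one U_mult)

lemma U_powi: "u \<in> U \<Longrightarrow> u powi n \<in> U"
  by (simp add: power_int_def U_power U_inverse)

lemma ex_nat_order:
  assumes "a \<in> V" "a \<noteq> 0"
  shows "\<exists>u\<in>U. \<exists>n::nat. a = u * \<tau> ^ n"
proof -
  define n where "n = (LEAST n. a \<notin> (*) (\<tau> ^ n) ` V)"
  have n: "a \<notin> (*) (\<tau> ^ n) ` V" and less: "\<And>k. k < n \<Longrightarrow> a \<in> (*) (\<tau> ^ k) ` V"
    unfolding n_def using LeastI_ex[OF separated[OF assms]] not_less_Least by blast+
  have "n \<noteq> 0"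
  proof
    assume "n = 0"
    then show False using n assms(1) by (simp add: image_iff)
  qed
  then obtain k where k: "n = Suc k" by (cases n) auto
  then obtain u where u: "u \<in> V" "a = \<tau> ^ k * u" using less[of k] by auto
  have "u \<notin> M"
  proof
    assume "u \<in> M"
    then obtain v where "v \<in> V" "u = \<tau> * v" by (auto simp: M_eq)
    then have "a = \<tau> ^ n * v" using u k by (simp add: ac_simps)
    then show False using n \<open>v \<in> V\<close> by blast
  qed
  then show ?thesis using u by (auto simp: U_def mult.commute)
qed

lemma ex_order:
  assumes "f \<in> K" "f \<noteq> 0"
  shows "\<exists>u\<in>U. \<exists>n::int. f = u * \<tau> powi n"
proof -
  obtain a b where ab: "a \<in> V" "b \<in> V" "b \<noteq> 0" "f = a / b" using K_quotient[OF assms(1)] by blast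
  moreover from this have "a \<noteq> 0" using assms by auto
  ultimately obtain u n w m where uw: "u \<in> U" "a = u * \<tau> ^ n" "w \<in> U" "b = w * \<tau> ^ m"
    using ex_nat_order[of a] ex_nat_order[of b] by blast
  have "f = (u * inverse w) * \<tau> powi (int n - int m)"
    using ab(4) uw \<tau>_nonzero by (simp add: power_int_diff field_simps)
  moreover have "u * inverse w \<in> U" using uw by (intro U_mult U_inverse)
  ultimately show ?thesis by blast
qed

lemma order_nonneg_iff:
  assumes "u \<in> U"
  shows "u * \<tau> powi n \<in> V \<longleftrightarrow> n \<ge> 0" and "u * \<tau> powi n \<in> M \<longleftrightarrow> n > 0"
proof -
  have pos: "v * \<tau> powi k \<in> M" if "k > 0" "v \<in> V" for k v
  proof -
    have "k = int (Suc (nat k - 1))" using that by simp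
    then obtain j where "k = int (Suc j)" by blast
    then have *: "v * \<tau> powi k = \<tau> * (v * \<tau> ^ j)"
      by (simp add: power_int_def nat_add_distrib ac_simps)
    have "v * \<tau> ^ j \<in> V" using that V_power V_mult \<tau>_in_V by blast
    then show ?thesis unfolding * M_eq by (intro imageI)
  qed
  have nonneg: "u * \<tau> powi n \<in> V" if "n \<ge> 0"
    using pos[of n u] assms that M_subset by (cases "n = 0") (auto simp: U_V)
  have neg: "u * \<tau> powi n \<notin> V" if "n < 0"
  proof
    assume V: "u * \<tau> powi n \<in> V"
    have "inverse u * (u * \<tau> powi n) * \<tau> powi (- n) \<in> M"
      using that by (intro pos V_mult[OF U_V[OF U_inverse[OF assms]] V]) auto
    moreover have "inverse u * (u * \<tau> powi n) * \<tau> powi (- n) = 1"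
      using U_nonzero[OF assms] \<tau>_nonzero by (simp add: power_int_minus field_simps)
    ultimately show False using one_notin_M by simp
  qed
  show "u * \<tau> powi n \<in> V \<longleftrightarrow> n \<ge> 0" using nonneg neg by force
  show "u * \<tau> powi n \<in> M \<longleftrightarrow> n > 0"
  proof (cases "n = 0")
    case True
    then show ?thesis using assms by (simp add: U_def)
  next
    case False
    then show ?thesis using pos[OF _ U_V[OF assms]] neg M_subset by force
  qed
qed

lemma order_unique:
  assumes "u \<in> U" "w \<in> U" "u * \<tau> powi n = w * \<tau> powi m"
  shows "n = m"
proof -
  have "u * \<tau> powi (n - m) = w" "w * \<tau> powi (m - n) = u"
    using assms(3) \<tau>_nonzero by (simp_all add: power_int_diff field_simps)
  then have "n - m \<ge> 0" "m - n \<ge> 0"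
    using order_nonneg_iff(1)[OF assms(1), of "n - m"] order_nonneg_iff(1)[OF assms(2), of "m - n"]
      U_V[OF assms(1)] U_V[OF assms(2)] by simp_all
  then show ?thesis by simp
qed

definition ord :: "'e \<Rightarrow> int" where
  "ord f = (THE n. \<exists>u\<in>U. f = u * \<tau> powi n)"

lemma ord_eqI: "u \<in> U \<Longrightarrow> ord (u * \<tau> powi n) = n"
  unfolding ord_def using order_unique by (intro the_equality) blast+

lemma ordE:
  assumes "f \<in> K" "f \<noteq> 0"
  obtains u where "u \<in> U" "f = u * \<tau> powi ord f"
proof -
  obtain u n where "u \<in> U" "f = u * \<tau> powi n" using ex_order[OF assms] by blast
  then show ?thesis using that ord_eqI by simp
qed

lemma V_iff_ord: "f \<in> K \<Longrightarrow> f \<noteq> 0 \<Longrightarrow> f \<in> V \<longleftrightarrow> ord f \<ge> 0"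
  by (erule (1) ordE, erule ssubst) (simp add: order_nonneg_iff ord_eqI)

lemma M_iff_ord: "f \<in> K \<Longrightarrow> f \<noteq> 0 \<Longrightarrow> f \<in> M \<longleftrightarrow> ord f > 0"
  by (erule (1) ordE, erule ssubst) (simp add: order_nonneg_iff ord_eqI)

lemma le_ord_iff:
  assumes "f \<in> K" "f \<noteq> 0"
  shows "n \<le> ord f \<longleftrightarrow> f * \<tau> powi (- n) \<in> V" and "n < ord f \<longleftrightarrow> f * \<tau> powi (- n) \<in> M"
proof -
  obtain u where u: "u \<in> U" "f = u * \<tau> powi ord f" using ordE[OF assms] .
  have "f * \<tau> powi (- n) = u * \<tau> powi (ord f - n)"
    using \<tau>_nonzero by (subst u(2)) (simp add: power_int_diff power_int_minus field_simps)
  then show "n \<le> ord f \<longleftrightarrow> f * \<tau> powi (- n) \<in> V" "n < ord f \<longleftrightarrow> f * \<tau> powi (- n) \<in> M"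
    using order_nonneg_iff[OF u(1), of "ord f - n"] by simp_all
qed

text \<open>
  The valuation of a function at a point of the curve is defined through an arbitrary uniformizer; all of
  them give the order with respect to \<open>\<tau>\<close>.
\<close>

lemma ord_uniformizer:
  assumes t: "M = (*) t ` V" and u: "u \<in> U"
  shows "ord (u * t powi n) = n"
proof -
  obtain w where w: "w \<in> V" "t = \<tau> * w"
  proof -
    have "t \<in> (*) t ` V" using V_one by (intro image_eqI[of _ _ 1]) simp_all
    then have "t \<in> (*) \<tau> ` V" using M_eq t by simp
    then show ?thesis using that by blast
  qed
  obtain w' where w': "w' \<in> V" "\<tau> = t * w'"
    using \<tau>_in_M t by auto
  have "w * w' = 1" using w w' \<tau>_nonzero by (simp add: mult.commute)
  then have "w \<in> U" using w w' U_I by blast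
  have "u * t powi n = (u * w powi n) * \<tau> powi n" by (simp add: w power_int_mult_distrib)
  then show ?thesis by (simp only: ord_eqI[OF U_mult[OF u U_powi[OF \<open>w \<in> U\<close>]]])
qed

lemma le_ord_diff:
  assumes "f \<in> K" "g \<in> K" "f - g \<in> K" "f - g \<noteq> 0" "f \<noteq> 0 \<longrightarrow> n \<le> ord f" "g \<noteq> 0 \<longrightarrow> n \<le> ord g"
  shows "n \<le> ord (f - g)"
proof -
  have "f * \<tau> powi (- n) \<in> V" using assms le_ord_iff(1)[of f n] V_zero by (cases "f = 0") auto
  moreover have "g * \<tau> powi (- n) \<in> V" using assms le_ord_iff(1)[of g n] V_zero by (cases "g = 0") auto
  ultimately have "(f - g) * \<tau> powi (- n) \<in> V" using V_diff by (simp add: left_diff_distrib)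
  then show ?thesis using assms le_ord_iff(1) by blast
qed

lemma ord_diff_dominant:
  assumes "f \<in> K" "g \<in> K" "f - g \<in> K" "f \<noteq> 0" "g \<noteq> 0 \<longrightarrow> ord f < ord g"
  shows "f - g \<noteq> 0" "ord (f - g) = ord f"
proof -
  have f: "f * \<tau> powi (- ord f) \<in> V" "f * \<tau> powi (- ord f) \<notin> M"
    using le_ord_iff[OF assms(1,4), of "ord f"] by simp_all
  have g: "g * \<tau> powi (- ord f) \<in> M"
    using assms(2,5) le_ord_iff(2)[of g "ord f"] zero_in_M by (cases "g = 0") auto
  have d: "(f - g) * \<tau> powi (- ord f) = f * \<tau> powi (- ord f) - g * \<tau> powi (- ord f)"
    by (simp add: left_diff_distrib)
  have dV: "(f - g) * \<tau> powi (- ord f) \<in> V" unfolding d using f g M_subset V_diff by blast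
  have dM: "(f - g) * \<tau> powi (- ord f) \<notin> M"
  proof
    assume "(f - g) * \<tau> powi (- ord f) \<in> M"
    from M_add[OF this g] have "f * \<tau> powi (- ord f) \<in> M" unfolding d by simp
    then show False using f by blast
  qed
  show "f - g \<noteq> 0" using dM zero_in_M by force
  then show "ord (f - g) = ord f"
    using le_ord_iff[OF assms(3), of "ord f"] dV dM by auto
qed

lemma ord_mult_unit:
  assumes "f \<in> K" "f \<noteq> 0" "u \<in> U"
  shows "ord (u * f) = ord f"
proof -
  obtain w where w: "w \<in> U" "f = w * \<tau> powi ord f" using ordE[OF assms(1,2)] .
  have "ord ((u * w) * \<tau> powi ord f) = ord f" by (rule ord_eqI) (intro U_mult assms w)
  also have "(u * w) * \<tau> powi ord f = u * f" by (subst (2) w(2)) (simp add: mult.assoc)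
  finally show ?thesis .
qed

lemma ord_eq_imp_quotient_in_V:
  assumes "f \<in> K" "f \<noteq> 0" "g \<in> K" "g \<noteq> 0" "ord f = ord g"
  shows "f / g \<in> V"
proof -
  obtain u where u: "u \<in> U" "f = u * \<tau> powi ord f" using ordE[OF assms(1,2)] .
  obtain w where w: "w \<in> U" "g = w * \<tau> powi ord f" using ordE[OF assms(3,4)] assms(5) by metis
  have "f / g = (u * \<tau> powi ord f) / (w * \<tau> powi ord f)" using u(2) w(2) by (rule arg_cong2)
  also have "\<dots> = u * inverse w" using \<tau>_nonzero by (simp add: divide_inverse)
  finally show ?thesis using V_mult[OF U_V[OF u(1)] U_V[OF U_inverse[OF w(1)]]] by simp
qed

lemma ord_less_mult_M:
  assumes "g \<in> K" "g \<noteq> 0" "m \<in> M" "g * m \<in> K" "g * m \<noteq> 0"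
  shows "ord g < ord (g * m)"
proof -
  have "m * (g * \<tau> powi (- ord g)) \<in> M"
    using le_ord_iff(1)[OF assms(1,2), of "ord g"] by (intro M_mult assms) simp
  then show ?thesis using le_ord_iff(2)[OF assms(4,5), of "ord g"] by (simp add: ac_simps)
qed

end

section \<open>Local rings as specializations of the generic point\<close>

context generic_point begin

text \<open>
  The graph of \<open>g(\<xi>)/h(\<xi>) \<mapsto> g(x)/h(x)\<close>. Its domain \<open>V x\<close> and its kernel \<open>M x\<close> are the images of the
  local ring at \<open>x\<close> and of its maximal ideal.
\<close>

definition place :: "('n \<Rightarrow> 'a alg_closure) \<Rightarrow> ('a alg_closure ultra \<times> 'a alg_closure) set" where
  "place x = {(ev g / ev h, ac.mev x g / ac.mev x h) |g h d.
     homogeneous_deg d g \<and> homogeneous_deg d h \<and> ac.mev x h \<noteq> 0}"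

lemma placeI:
  assumes "homogeneous_deg d g" "homogeneous_deg d h" "ac.mev x h \<noteq> 0"
  shows "(ev g / ev h, ac.mev x g / ac.mev x h) \<in> place x"
  unfolding place_def using assms by (intro CollectI exI[of _ g] exI[of _ h] exI[of _ d]) simp

lemma placeE:
  assumes "(f, b) \<in> place x"
  obtains g h d where "homogeneous_deg d g" "homogeneous_deg d h" "ac.mev x h \<noteq> 0"
    "f = ev g / ev h" "b = ac.mev x g / ac.mev x h"
proof -
  from assms obtain g h d where "(f, b) = (ev g / ev h, ac.mev x g / ac.mev x h) \<and>
      homogeneous_deg d g \<and> homogeneous_deg d h \<and> ac.mev x h \<noteq> 0"
    unfolding place_def by (elim CollectE exE)
  then show ?thesis by (intro that[of d g h]) simp_all
qed

lemma ev_eq_0_imp: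
  assumes "ppoint_of x \<in> C" "homogeneous_deg d p" "ev p = 0"
  shows "ac.mev x p = 0"
proof -
  have hom: "homogeneous p" using assms(2) by (auto simp: homogeneous_def)
  then have "vanishes_on p C" using generic assms(3) by blast
  then show ?thesis using assms(1) vanishes_at_base_change[OF hom, of x] by (auto simp: vanishes_on_def)
qed

lemma place_specialization:
  assumes x: "ppoint_of x \<in> C"
  shows "specialization base (place x)"
proof unfold_locales
  show "(base c, to_ac c) \<in> place x" for c
    unfolding place_def
    by (intro CollectI exI[of _ "Poly_Mapping.single 0 c"] exI[of _ 1] exI[of _ 0])
       (simp add: type_ring_hom.hom_one[OF gen.mev_hom] type_ring_hom.hom_one[OF ac.mev_hom])
next
  fix a b a' b' assume "(a, b) \<in> place x" "(a', b') \<in> place x"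
  then obtain g h d g' h' d' where *: "homogeneous_deg d g" "homogeneous_deg d h" "ac.mev x h \<noteq> 0"
      "homogeneous_deg d' g'" "homogeneous_deg d' h'" "ac.mev x h' \<noteq> 0"
    and ab: "a = ev g / ev h" "b = ac.mev x g / ac.mev x h" "a' = ev g' / ev h'" "b' = ac.mev x g' / ac.mev x h'"
    by (elim placeE) blast
  have nz: "ev h \<noteq> 0" "ev h' \<noteq> 0" using ev_eq_0_imp[OF x] * by blast+
  have deg: "homogeneous_deg (d + d') (g * h' + g' * h)" "homogeneous_deg (d + d') (g * g')" "homogeneous_deg (d + d') (h * h')"
    using homogeneous_deg_mult[OF *(1,5)] homogeneous_deg_mult[OF *(4,2)]
      homogeneous_deg_mult[OF *(1,4)] homogeneous_deg_mult[OF *(2,5)]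
    by (auto intro!: homogeneous_deg_add simp: add.commute)
  have "(ev (g * h' + g' * h) / ev (h * h'), ac.mev x (g * h' + g' * h) / ac.mev x (h * h')) \<in> place x"
    "(ev (g * g') / ev (h * h'), ac.mev x (g * g') / ac.mev x (h * h')) \<in> place x"
    by (rule placeI[OF deg(1,3)] placeI[OF deg(2,3)], simp add: ac.mev_mult *(3,6))+
  then show "(a + a', b + b') \<in> place x" "(a * a', b * b') \<in> place x"
    using nz *(3,6) by (simp_all add: ab gen.mev_mult ac.mev_mult gen.mev_add ac.mev_add add_frac_eq)
next
  fix b assume "(0, b) \<in> place x"
  then obtain g h d where *: "homogeneous_deg d g" "homogeneous_deg d h" "ac.mev x h \<noteq> 0"
    "0 = ev g / ev h" "b = ac.mev x g / ac.mev x h"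
    by (elim placeE) blast
  have "ev h \<noteq> 0" using ev_eq_0_imp[OF x] * by blast
  then have "ac.mev x g = 0" using ev_eq_0_imp[OF x *(1)] *(4) by simp
  then show "b = 0" using * by simp
qed

definition V :: "('n \<Rightarrow> 'a alg_closure) \<Rightarrow> 'a alg_closure ultra set" where
  "V x = Domain (place x)"

definition M :: "('n \<Rightarrow> 'a alg_closure) \<Rightarrow> 'a alg_closure ultra set" where
  "M x = {f. (f, 0) \<in> place x}"

lemma place_inverse:
  assumes "(f, b) \<in> place x" "b \<noteq> 0"
  shows "(inverse f, inverse b) \<in> place x"
proof -
  obtain g h d where *: "homogeneous_deg d g" "homogeneous_deg d h" "ac.mev x h \<noteq> 0"
    "f = ev g / ev h" "b = ac.mev x g / ac.mev x h"
    using assms(1) by (elim placeE) blast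
  then have "ac.mev x g \<noteq> 0" using assms(2) by auto
  then show ?thesis using placeI[OF *(2,1)] * by simp
qed

lemma place_unique:
  assumes "ppoint_of x \<in> C" "(f, b) \<in> place x" "(f, b') \<in> place x"
  shows "b = b'"
proof -
  interpret specialization base "place x" by (rule place_specialization) fact
  show ?thesis using functional[of "b - b'"] diff[OF assms(2,3)] by simp
qed

lemma emb_image_ratfuns:
  "emb ` {ratfun C g h |g h. (g, h) \<in> fractions C \<and> Q g h} = {ev g / ev h |g h. (g, h) \<in> fractions C \<and> Q g h}"
proof (intro Set.set_eqI iffI)
  fix f assume "f \<in> emb ` {ratfun C g h |g h. (g, h) \<in> fractions C \<and> Q g h}"
  then obtain g h where gh: "(g, h) \<in> fractions C" "Q g h" "f = emb (ratfun C g h)" by blast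
  then show "f \<in> {ev g / ev h |g h. (g, h) \<in> fractions C \<and> Q g h}"
    unfolding emb_ratfun[OF gh(1)] by blast
next
  fix f assume "f \<in> {ev g / ev h |g h. (g, h) \<in> fractions C \<and> Q g h}"
  then obtain g h where gh: "(g, h) \<in> fractions C" "Q g h" "f = ev g / ev h" by blast
  show "f \<in> emb ` {ratfun C g h |g h. (g, h) \<in> fractions C \<and> Q g h}"
    by (rule image_eqI[of _ _ "ratfun C g h"]) (use gh in \<open>simp add: emb_ratfun, blast\<close>)
qed

lemma place_eq:
  assumes "ppoint_of x \<in> C"
  shows "emb ` local_ring_at C (ppoint_of x) = V x" "emb ` max_ideal_at C (ppoint_of x) = M x"
proof -
  have nv: "\<not> vanishes_at (base_change h) (ppoint_of x) \<longleftrightarrow> ac.mev x h \<noteq> 0" if "homogeneous_deg d h" for h d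
    using vanishes_at_base_change[of h x] that by (auto simp: homogeneous_def)
  have frac: "(g, h) \<in> fractions C \<and> \<not> vanishes_at (base_change h) (ppoint_of x) \<longleftrightarrow>
      (\<exists>d. homogeneous_deg d g \<and> homogeneous_deg d h \<and> ac.mev x h \<noteq> 0)" for g h
    using nv ev_eq_0_imp[OF assms] unfolding fractions_iff by blast
  have "emb ` local_ring_at C (ppoint_of x) =
      {ev g / ev h |g h. (g, h) \<in> fractions C \<and> \<not> vanishes_at (base_change h) (ppoint_of x)}"
    unfolding local_ring_at_def by (rule emb_image_ratfuns)
  also have "\<dots> = V x"
    unfolding frac V_def place_def by (simp add: Domain_unfold)
  finally show "emb ` local_ring_at C (ppoint_of x) = V x" .
  have "emb ` max_ideal_at C (ppoint_of x) =
      {ev g / ev h |g h. (g, h) \<in> fractions C \<and> \<not> vanishes_at (base_change h) (ppoint_of x) \<and>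
         vanishes_at (base_change g) (ppoint_of x)}"
    unfolding max_ideal_at_def by (rule emb_image_ratfuns)
  also have "\<dots> = {ev g / ev h |g h d. homogeneous_deg d g \<and> homogeneous_deg d h \<and> ac.mev x h \<noteq> 0 \<and> ac.mev x g = 0}"
  proof -
    have "(g, h) \<in> fractions C \<and> \<not> vanishes_at (base_change h) (ppoint_of x) \<and> vanishes_at (base_change g) (ppoint_of x) \<longleftrightarrow>
      (\<exists>d. homogeneous_deg d g \<and> homogeneous_deg d h \<and> ac.mev x h \<noteq> 0 \<and> ac.mev x g = 0)" for g h
      using nv frac[of g h] by blast
    then show ?thesis by (simp only:) blast
  qed
  also have "\<dots> = M x"
  proof (intro Set.set_eqI iffI)
    fix f assume "f \<in> M x"
    then obtain g h d where "homogeneous_deg d g" "homogeneous_deg d h" "ac.mev x h \<noteq> 0"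
      "f = ev g / ev h" "0 = ac.mev x g / ac.mev x h" unfolding M_def by (elim CollectE placeE) blast
    moreover from this have "ac.mev x g = 0" by simp
    ultimately show "f \<in> {ev g / ev h |g h d. homogeneous_deg d g \<and> homogeneous_deg d h \<and> ac.mev x h \<noteq> 0 \<and> ac.mev x g = 0}"
      by blast
  next
    fix f assume "f \<in> {ev g / ev h |g h d. homogeneous_deg d g \<and> homogeneous_deg d h \<and> ac.mev x h \<noteq> 0 \<and> ac.mev x g = 0}"
    then obtain g h d where *: "homogeneous_deg d g" "homogeneous_deg d h" "ac.mev x h \<noteq> 0"
      "f = ev g / ev h" "ac.mev x g = 0" by blast
    show "f \<in> M x" unfolding M_def using placeI[OF *(1-3)] * by simp
  qed
  finally show "emb ` max_ideal_at C (ppoint_of x) = M x" .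
qed

text \<open>
  To write \<open>g(\<xi>)/h(\<xi>)\<close> as a quotient of elements of the local ring, divide both forms by a power of a
  coordinate that is non-zero at \<open>x\<close>.
\<close>

lemma K_is_quotient:
  assumes x: "ppoint_of x \<in> C" "x \<noteq> (\<lambda>_. 0)" and f: "f \<in> K"
  shows "\<exists>a\<in>V x. \<exists>b\<in>V x. b \<noteq> 0 \<and> f = a / b"
proof -
  obtain g h d where gh: "homogeneous_deg d g" "homogeneous_deg d h" "ev h \<noteq> 0" "f = ev g / ev h"
    using f unfolding K_def by blast
  obtain i where "x i \<noteq> 0" using x(2) by auto
  define e :: "('n, 'a) mpol" where "e = mvar i ^ d"
  have e: "homogeneous_deg d e" "ac.mev x e \<noteq> 0"
    using \<open>x i \<noteq> 0\<close> unfolding e_def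
    by (simp_all only: homogeneous_deg_mvar_power type_ring_hom.hom_power[OF ac.mev_hom] ac.mev_mvar) simp
  then have "ev e \<noteq> 0" using ev_eq_0_imp[OF x(1)] by blast
  have "ev g / ev e \<in> V x" "ev h / ev e \<in> V x"
    unfolding V_def using placeI[OF gh(1) e] placeI[OF gh(2) e] by blast+
  moreover have "ev h / ev e \<noteq> 0" "f = (ev g / ev e) / (ev h / ev e)"
    using gh(3,4) \<open>ev e \<noteq> 0\<close> by simp_all
  ultimately show ?thesis by blast
qed

lemma V_subset_K: 
  assumes "ppoint_of x \<in> C"
  shows "V x \<subseteq> K"
proof
  fix f assume "f \<in> V x"
  then obtain g h d where *: "homogeneous_deg d g" "homogeneous_deg d h" "ac.mev x h \<noteq> 0"
    "f = ev g / ev h"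
    unfolding V_def by (elim DomainE placeE) blast
  then have "ev h \<noteq> 0" using ev_eq_0_imp[OF assms] by blast
  then show "f \<in> K" using * unfolding K_def by blast
qed

end

section \<open>Transcendence degree one\<close>

lemma poly_Poly_sum: "poly (Poly xs) z = (\<Sum>i<length xs. xs ! i * z ^ i)" for z :: "'e::comm_ring_1"
  by (induction xs) (simp_all add: sum.lessThan_Suc_shift sum_distrib_left ac_simps del: sum.lessThan_Suc)

context generic_point begin

interpretation ffh: finite_field_hom base by unfold_locales

text \<open>
  The field \<open>k(z)\<close>.
\<close>

definition adjoin :: "'a alg_closure ultra \<Rightarrow> 'a alg_closure ultra set" where
  "adjoin z = {gen.pev z p / gen.pev z q |p q. gen.pev z q \<noteq> 0}"

lemma adjoinI: "gen.pev z q \<noteq> 0 \<Longrightarrow> gen.pev z p / gen.pev z q \<in> adjoin z"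
  unfolding adjoin_def by blast

lemma adjoinE:
  assumes "f \<in> adjoin z"
  obtains p q where "gen.pev z q \<noteq> 0" "f = gen.pev z p / gen.pev z q"
  using assms unfolding adjoin_def by blast

lemma adjoin_pev: "gen.pev z p \<in> adjoin z"
  using adjoinI[of z 1 p] by (simp add: type_ring_hom.hom_one[OF gen.pev_hom])

lemma adjoin_closed:
  assumes "f \<in> adjoin z" "g \<in> adjoin z"
  shows "f + g \<in> adjoin z" "f * g \<in> adjoin z" "- f \<in> adjoin z" "inverse f \<in> adjoin z"
proof -
  obtain p q where f: "gen.pev z q \<noteq> 0" "f = gen.pev z p / gen.pev z q" using assms(1) by (elim adjoinE)
  obtain p' q' where g: "gen.pev z q' \<noteq> 0" "g = gen.pev z p' / gen.pev z q'" using assms(2) by (elim adjoinE)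
  have nz: "gen.pev z (q * q') \<noteq> 0" using f g by (simp add: gen.pev_mult)
  have "f + g = gen.pev z (p * q' + p' * q) / gen.pev z (q * q')"
    using f g by (simp add: gen.pev_mult gen.pev_add add_frac_eq)
  then show "f + g \<in> adjoin z" using adjoinI[OF nz] by simp
  have "f * g = gen.pev z (p * p') / gen.pev z (q * q')" using f g by (simp add: gen.pev_mult)
  then show "f * g \<in> adjoin z" using adjoinI[OF nz] by simp
  have "- f = gen.pev z (- p) / gen.pev z q"
    using f by (simp add: type_ring_hom.hom_uminus[OF gen.pev_hom])
  then show "- f \<in> adjoin z" using adjoinI[OF f(1)] by simp
  show "inverse f \<in> adjoin z"
  proof (cases "gen.pev z p = 0")
    case True
    then show ?thesis using f adjoin_pev[of z 0] by simp
  next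
    case False
    have "inverse f = gen.pev z q / gen.pev z p" using f by simp
    then show ?thesis using adjoinI[OF False] by simp
  qed
qed

lemma const_in_carrier: "ratfun C (Poly_Mapping.single 0 c) 1 \<in> carrier FF"
  unfolding carrier_iff using fractions_const by metis

lemma constant_functions_subset: "consts \<subseteq> carrier FF"
  unfolding constant_functions_def using const_in_carrier by auto

lemma generate_field_adjoin:
  assumes z: "z \<in> carrier FF" and h: "h \<in> generate_field FF (insert z consts)"
  shows "emb h \<in> adjoin (emb z)"
proof -
  have sub: "insert z consts \<subseteq> carrier FF" using z constant_functions_subset by blast
  note car = FF.generate_field_in_carrier[OF sub]
  show ?thesis
    using h
  proof (induction rule: generate_field.induct)
    case one
    then show ?case using adjoin_pev[of "emb z" "[:1:]"] by simp
  next
    case (incl h)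
    then show ?case
    proof (elim insertE)
      assume "h = z"
      then show ?thesis using adjoin_pev[of "emb z" "[:0, 1:]"] by simp
    next
      assume "h \<in> consts"
      then obtain c where "emb h = base c" unfolding constant_functions_def by (auto simp: emb_const)
      then show ?thesis using adjoin_pev[of "emb z" "[:c:]"] by simp
    qed
  next
    case (a_inv h)
    then show ?case using car[OF a_inv.hyps] adjoin_closed(3) by simp
  next
    case (m_inv h)
    then show ?case using car[OF m_inv.hyps(1)] adjoin_closed(4) by simp
  next
    case (eng_add h1 h2)
    then show ?case using car[OF eng_add.hyps(1)] car[OF eng_add.hyps(2)] adjoin_closed(1) by simp
  next
    case (eng_mult h1 h2)
    then show ?case using car[OF eng_mult.hyps(1)] car[OF eng_mult.hyps(2)] adjoin_closed(2) by simp
  qed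
qed

text \<open>
  Turns a relation over \<open>k(z)\<close> into one over \<open>k[z]\<close>.
\<close>

lemma adjoin_common_denominator:
  fixes n :: nat
  assumes "\<And>i. i \<le> n \<Longrightarrow> c i \<in> adjoin z"
  shows "\<exists>q. gen.pev z q \<noteq> 0 \<and> (\<forall>i\<le>n. \<exists>p. gen.pev z q * c i = gen.pev z p)"
  using assms
proof (induction n)
  case 0
  then obtain p q where "gen.pev z q \<noteq> 0" "c 0 = gen.pev z p / gen.pev z q" by (metis adjoinE le_refl)
  then show ?case by (intro exI[of _ q]) auto
next
  case (Suc n)
  then obtain q where q: "gen.pev z q \<noteq> 0" "\<And>i. i \<le> n \<Longrightarrow> \<exists>p. gen.pev z q * c i = gen.pev z p" by auto
  obtain p' q' where pq': "gen.pev z q' \<noteq> 0" "c (Suc n) = gen.pev z p' / gen.pev z q'"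
    using Suc.prems[OF le_refl] by (elim adjoinE)
  have "\<exists>p. gen.pev z (q * q') * c i = gen.pev z p" if "i \<le> Suc n" for i
  proof (cases "i = Suc n")
    case True
    then have "gen.pev z (q * q') * c i = gen.pev z (q * p')" using pq' by (simp add: gen.pev_mult)
    then show ?thesis by blast
  next
    case False
    then obtain p where "gen.pev z q * c i = gen.pev z p" using q \<open>i \<le> Suc n\<close> by fastforce
    then have "gen.pev z (q * q') * c i = gen.pev z (p * q')" by (simp add: gen.pev_mult ac_simps)
    then show ?thesis by blast
  qed
  then show ?case using q pq' by (intro exI[of _ "q * q'"]) (simp add: gen.pev_mult)
qed

lemma emb_eval:
  assumes "set L \<subseteq> carrier FF" "z \<in> carrier FF"
  shows "emb (FF.eval L z) = poly (Poly (rev (map emb L))) (emb z)"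
  using assms
proof (induction L)
  case (Cons a L)
  then have "FF.eval L z \<in> carrier FF" by (intro FF.eval_in_carrier) auto
  with Cons show ?case by (simp add: Poly_append poly_monom ac_simps)
qed simp

lemma algebraic_imp_algebraic_over_adjoin:
  assumes z: "z \<in> carrier FF" and y: "y \<in> carrier FF"
    and alg: "FF.algebraic (generate_field FF (insert z consts)) y"
  shows "ffh.algebraic_over_adjoin (emb z) (emb y)"
proof -
  let ?H = "generate_field FF (insert z consts)"
  have sub: "insert z consts \<subseteq> carrier FF" using z constant_functions_subset by blast
  have "subring ?H FF" using FF.generate_field_is_subfield[OF sub] by (rule subfieldE(1))
  then obtain L where L: "L \<in> carrier (?H [X]\<^bsub>FF\<^esub>)" "L \<noteq> []" "FF.eval L y = \<zero>\<^bsub>FF\<^esub>"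
    using FF.algebraicE[of ?H y] y alg unfolding over_def by blast
  then have LH: "set L \<subseteq> ?H" and hd: "hd L \<noteq> \<zero>\<^bsub>FF\<^esub>"
    by (auto simp: univ_poly_def polynomial_def)
  have car: "set L \<subseteq> carrier FF" using LH FF.generate_field_incl[OF sub] by blast
  define n where "n = length L - 1"
  define c where "c i = emb (rev L ! i)" for i
  have n: "length L = Suc n" using L(2) by (simp add: n_def)
  have adj: "c i \<in> adjoin (emb z)" if "i \<le> n" for i
  proof -
    have "rev L ! i \<in> set (rev L)" using that n by (intro nth_mem) simp
    then show ?thesis unfolding c_def using LH by (intro generate_field_adjoin[OF z]) auto
  qed
  have "c n = emb (hd L)" using n L(2) by (simp add: c_def rev_nth hd_conv_nth)
  moreover have "hd L \<in> carrier FF" using L(2) car by (cases L) auto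
  ultimately have lead: "c n \<noteq> 0" using hd by (simp add: emb_eq_0_iff)
  have "0 = emb (FF.eval L y)" using L(3) by simp
  also have "\<dots> = (\<Sum>i<Suc n. c i * emb y ^ i)"
    unfolding emb_eval[OF car y] poly_Poly_sum using n by (intro sum.cong) (simp_all add: c_def rev_map)
  finally have rel: "(\<Sum>i\<le>n. c i * emb y ^ i) = 0" by (simp add: lessThan_Suc_atMost)
  obtain q where q: "gen.pev (emb z) q \<noteq> 0" "\<And>i. i \<le> n \<Longrightarrow> \<exists>p. gen.pev (emb z) q * c i = gen.pev (emb z) p"
    using adjoin_common_denominator[of n c "emb z", OF adj] by blast
  then obtain p where p: "\<And>i. i \<le> n \<Longrightarrow> gen.pev (emb z) q * c i = gen.pev (emb z) (p i)" by metis
  have "gen.pev (emb z) (p n) \<noteq> 0" using p[of n] q lead by (metis le_refl mult_eq_0_iff)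
  moreover have "(\<Sum>i\<le>n. gen.pev (emb z) (p i) * emb y ^ i) = gen.pev (emb z) q * (\<Sum>i\<le>n. c i * emb y ^ i)"
    unfolding sum_distrib_left by (intro sum.cong refl) (simp add: p[symmetric] ac_simps)
  then have "(\<Sum>i\<le>n. gen.pev (emb z) (p i) * emb y ^ i) = 0" using rel by simp
  ultimately show ?thesis unfolding ffh.algebraic_over_adjoin_def by blast
qed

lemma transcendental_pev_nonzero:
  assumes z: "z \<in> carrier FF" and tr: "FF.transcendental consts z" and p: "p \<noteq> 0"
  shows "gen.pev (emb z) p \<noteq> 0"
proof
  assume zero: "gen.pev (emb z) p = 0"
  define con where "con c = ratfun C (Poly_Mapping.single 0 c) 1" for c
  define L where "L = map con (rev (coeffs p))"
  have con: "con c \<in> carrier FF" "con c \<in> consts" "emb (con c) = base c" for c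
  proof -
    show *: "con c \<in> consts" unfolding con_def constant_functions_def by blast
    then show "con c \<in> carrier FF" using constant_functions_subset by blast
    show "emb (con c) = base c" unfolding con_def by (rule emb_const)
  qed
  have "emb (FF.eval L z) = poly (Poly (map (\<lambda>c. base c) (coeffs p))) (emb z)"
    by (subst emb_eval[OF _ z]) (auto simp: L_def con rev_map o_def)
  also have "\<dots> = gen.pev (emb z) p" by (simp add: gen.pev_def map_poly_def)
  finally have ev0: "FF.eval L z = \<zero>\<^bsub>FF\<^esub>"
    using zero FF.eval_in_carrier[of L z] z con(1) by (subst emb_eq_0_iff[symmetric]) (auto simp: L_def)
  have "hd L = con (lead_coeff p)"
    using p by (simp add: L_def hd_map hd_rev last_coeffs_eq_coeff_degree)
  moreover have "con c = \<zero>\<^bsub>FF\<^esub> \<longleftrightarrow> c = 0" for c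
    using emb_eq_0_iff[OF con(1)[of c]] con(3)[of c] by simp
  ultimately have "hd L \<noteq> \<zero>\<^bsub>FF\<^esub>" using p by simp
  then have "L \<in> carrier (consts [X]\<^bsub>FF\<^esub>)"
    using con(2) by (auto simp: univ_poly_def polynomial_def L_def)
  with ev0 have "L = []" using FF.eval_transcendental tr unfolding over_def by blast
  then show False using p by (simp add: L_def)
qed

end

section \<open>Valuations at the points of the curve\<close>

locale smooth_curve = generic_point +
  assumes one_dim: "one_dimensional C"
    and regular: "P \<in> C \<Longrightarrow> \<exists>t. uniformizer_at C P t"
begin

interpretation ffh: finite_field_hom base by unfold_locales

text \<open>
  A transcendence basis with one element, seen in the ambient field.
\<close>

lemma ex_transcendence_basis:
  "\<exists>z\<in>K. (\<forall>p. p \<noteq> 0 \<longrightarrow> gen.pev z p \<noteq> 0) \<and> (\<forall>y\<in>K. ffh.algebraic_over_adjoin z y)"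
proof -
  obtain z where z: "z \<in> carrier FF" "FF.transcendental consts z"
    "\<And>y. y \<in> carrier FF \<Longrightarrow> FF.algebraic (generate_field FF (insert z consts)) y"
    using one_dim unfolding one_dimensional_def by blast
  have "emb z \<in> K" using z(1) emb_image by blast
  moreover have "gen.pev (emb z) p \<noteq> 0" if "p \<noteq> 0" for p
    by (rule transcendental_pev_nonzero[OF z(1,2) that])
  moreover have "ffh.algebraic_over_adjoin (emb z) y" if "y \<in> K" for y
  proof -
    have "y \<in> emb ` carrier FF" using that unfolding emb_image .
    then obtain Y where "Y \<in> carrier FF" "y = emb Y" by (elim imageE)
    then show ?thesis using algebraic_imp_algebraic_over_adjoin[OF z(1) _ z(3)] by blast
  qed
  ultimately show ?thesis by blast
qed

lemma algebraically_dependent: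
  assumes "t \<in> K" "y \<in> K"
  shows "\<exists>n b. (\<exists>j\<le>n. b j \<noteq> 0) \<and> (\<Sum>j\<le>n. gen.pev t (b j) * y ^ j) = 0"
  using ex_transcendence_basis ffh.algebraically_dependent assms by blast

definition uniformizer :: "('a \<Rightarrow> 'b alg_closure) \<Rightarrow> ('a, 'b) ratfun" where
  "uniformizer x = (SOME t. uniformizer_at C (ppoint_of x) t)"

lemma local_ring_carrier: "local_ring_at C P \<subseteq> carrier FF" "max_ideal_at C P \<subseteq> local_ring_at C P"
proof -
  show "local_ring_at C P \<subseteq> carrier FF"
    unfolding local_ring_at_def using carrier_iff by blast
  show "max_ideal_at C P \<subseteq> local_ring_at C P"
    unfolding local_ring_at_def max_ideal_at_def by blast
qed

lemma mem_local_ring_iff: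
  assumes "ppoint_of x \<in> C" "f \<in> carrier FF"
  shows "f \<in> local_ring_at C (ppoint_of x) \<longleftrightarrow> emb f \<in> V x"
    "f \<in> max_ideal_at C (ppoint_of x) \<longleftrightarrow> emb f \<in> M x"
proof -
  have sub: "max_ideal_at C (ppoint_of x) \<subseteq> carrier FF" using local_ring_carrier by blast
  show "f \<in> local_ring_at C (ppoint_of x) \<longleftrightarrow> emb f \<in> V x"
    unfolding place_eq[OF assms(1), symmetric]
    using inj_on_image_mem_iff[OF emb_inj assms(2) local_ring_carrier(1)] by simp
  show "f \<in> max_ideal_at C (ppoint_of x) \<longleftrightarrow> emb f \<in> M x"
    unfolding place_eq[OF assms(1), symmetric]
    using inj_on_image_mem_iff[OF emb_inj assms(2) sub] by simp
qed

lemma uniformizer_image: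
  assumes x: "ppoint_of x \<in> C" and t: "uniformizer_at C (ppoint_of x) t"
  shows "t \<in> carrier FF" "M x = (*) (emb t) ` V x"
proof -
  show tc: "t \<in> carrier FF" using t local_ring_carrier unfolding uniformizer_at_def by blast
  have "M x = emb ` (\<lambda>a. t \<otimes>\<^bsub>FF\<^esub> a) ` local_ring_at C (ppoint_of x)"
    using t unfolding uniformizer_at_def place_eq(2)[OF x, symmetric] by simp
  also have "\<dots> = (\<lambda>a. emb t * emb a) ` local_ring_at C (ppoint_of x)"
    unfolding image_image using tc local_ring_carrier by (intro image_cong refl emb_mult) blast+
  also have "\<dots> = (*) (emb t) ` V x"
    unfolding place_eq(1)[OF x, symmetric] image_image ..
  finally show "M x = (*) (emb t) ` V x" .
qed

lemma uniformizer: "ppoint_of x \<in> C \<Longrightarrow> uniformizer_at C (ppoint_of x) (uniformizer x)"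
  unfolding uniformizer_def using regular by (rule someI_ex)

text \<open>
  The uniformizer is non-zero because the local ring is not the whole function field: residue classes
  are algebraic over \<open>k\<close>, so some non-zero polynomial in a transcendental element would lie in the
  maximal ideal.
\<close>

lemma point_dvr:
  assumes x: "ppoint_of x \<in> C" "x \<noteq> (\<lambda>_. 0)"
  shows "dvr K (V x) (M x) (emb (uniformizer x))"
proof -
  interpret S: specialization base "place x"
    by (rule place_specialization) fact
  note u = uniformizer_image[OF x(1) uniformizer[OF x(1)]]
  have M_V: "M x \<subseteq> V x" unfolding M_def V_def by blast
  have unit: "inverse a \<in> V x" if a: "a \<in> V x" "a \<notin> M x" for a
  proof -
    obtain b where b: "(a, b) \<in> place x" using a unfolding V_def by blast
    have "b \<noteq> 0" using b a unfolding M_def by blast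
    then show ?thesis using place_inverse[OF b] unfolding V_def by blast
  qed
  have VK: "V x \<subseteq> K" by (rule V_subset_K) fact
  have "1 \<in> V x" unfolding V_def using S.one by blast
  then have tM: "emb (uniformizer x) \<in> M x" unfolding u(2) by (intro image_eqI[of _ _ 1]) simp_all
  then have t0: "(emb (uniformizer x), 0) \<in> place x" by (simp add: M_def)
  have nz: "emb (uniformizer x) \<noteq> 0"
  proof
    assume z: "emb (uniformizer x) = 0"
    then have M0: "M x \<subseteq> {0}" unfolding u(2) by auto
    obtain z where z: "z \<in> K" "\<And>p. p \<noteq> 0 \<Longrightarrow> gen.pev z p \<noteq> 0" using ex_transcendence_basis by blast
    obtain a b where ab: "a \<in> V x" "b \<in> V x" "b \<noteq> 0" "z = a / b" using K_is_quotient[OF x z(1)] by blast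
    have "inverse b \<in> V x" using unit[OF ab(2)] M0 ab(3) by blast
    then obtain \<alpha> \<beta> where \<alpha>\<beta>: "(a, \<alpha>) \<in> place x" "(inverse b, \<beta>) \<in> place x" using ab(1) unfolding V_def by blast
    have zp: "(z, \<alpha> * \<beta>) \<in> place x" using S.mult[OF \<alpha>\<beta>] unfolding ab(4) by (simp add: divide_inverse)
    obtain p :: "'b poly" where p: "p \<noteq> 0" "ac.pev (\<alpha> * \<beta>) p = 0"
      using alg_closure_algebraic[of "\<alpha> * \<beta>"] unfolding ac.pev_def by blast
    have "(gen.pev z p, 0) \<in> place x" using S.pev[OF zp, of p] p(2) by simp
    then have "gen.pev z p = 0" using M0 unfolding M_def by blast
    then show False using z(2) p(1) by blast
  qed
  show ?thesis
  proof
    show "1 \<in> V x" by fact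
    show "a - b \<in> V x" if "a \<in> V x" "b \<in> V x" for a b using that S.diff unfolding V_def by blast
    show "a * b \<in> V x" if "a \<in> V x" "b \<in> V x" for a b using that S.mult unfolding V_def by blast
    show "M x = (*) (emb (uniformizer x)) ` V x" by fact
    show "M x \<subseteq> V x" by fact
    show "inverse a \<in> V x" if "a \<in> V x" "a \<notin> M x" for a using unit that .
    show "1 \<notin> M x"
      using place_unique[OF x(1) S.one, of 0] unfolding M_def by auto
    show "emb (uniformizer x) \<noteq> 0" by fact
    show "\<exists>a\<in>V x. \<exists>b\<in>V x. b \<noteq> 0 \<and> f = a / b" if "f \<in> K" for f using K_is_quotient[OF x that] .
    fix y assume y: "y \<in> V x" "y \<noteq> 0"
    then obtain \<beta> where \<beta>: "(y, \<beta>) \<in> place x" unfolding V_def by blast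
    obtain n b where "\<exists>j\<le>n. b j \<noteq> 0" "(\<Sum>j\<le>n. gen.pev (emb (uniformizer x)) (b j) * y ^ j) = 0"
      using algebraically_dependent[of "emb (uniformizer x)" y] VK M_V tM y(1) by blast
    from S.no_infinitely_divisible[OF t0 nz y(2) \<beta> this] obtain k
      where "\<forall>w\<in>V x. y \<noteq> emb (uniformizer x) ^ k * w" unfolding V_def by blast
    then show "\<exists>n. y \<notin> (*) (emb (uniformizer x) ^ n) ` V x" by blast
  qed
qed

definition ord_at :: "('a \<Rightarrow> 'b alg_closure) \<Rightarrow> 'b alg_closure ultra \<Rightarrow> int" where
  "ord_at x = dvr.ord (V x) (M x) (emb (uniformizer x))"

lemma valuation_at_eq:
  assumes x: "ppoint_of x \<in> C" "x \<noteq> (\<lambda>_. 0)" and f: "f \<in> carrier FF" "f \<noteq> \<zero>\<^bsub>FF\<^esub>"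
  shows "valuation_at C (ppoint_of x) f = ord_at x (emb f)"
proof -
  interpret D: dvr K "V x" "M x" "emb (uniformizer x)" by (rule point_dvr[OF x])
  note u = uniformizer_image[OF x(1) uniformizer[OF x(1)]]
  have un: "uniformizer x \<noteq> \<zero>\<^bsub>FF\<^esub>" using D.\<tau>_nonzero by auto
  show ?thesis
    unfolding valuation_at_def ord_at_def
  proof (rule the_equality)
    have "emb f \<in> K" "emb f \<noteq> 0" using f emb_image emb_eq_0_iff by blast+
    then obtain w where w: "w \<in> D.U" "emb f = w * emb (uniformizer x) powi D.ord (emb f)" by (rule D.ordE)
    have "w \<in> K" using V_subset_K[OF x(1)] D.U_V[OF w(1)] by blast
    then obtain W where W: "W \<in> carrier FF" "w = emb W" unfolding emb_image[symmetric] by (elim imageE)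
    have "W \<in> local_ring_at C (ppoint_of x) - max_ideal_at C (ppoint_of x)"
      using w(1) W mem_local_ring_iff[OF x(1) W(1)] by (simp add: D.U_def)
    moreover have "f = W \<otimes>\<^bsub>FF\<^esub> (uniformizer x [^]\<^bsub>FF\<^esub> D.ord (emb f))"
    proof (rule inj_onD[OF emb_inj])
      show "emb f = emb (W \<otimes>\<^bsub>FF\<^esub> (uniformizer x [^]\<^bsub>FF\<^esub> D.ord (emb f)))"
        using w(2) W emb_int_pow[OF u(1) un] by simp
      show "W \<otimes>\<^bsub>FF\<^esub> (uniformizer x [^]\<^bsub>FF\<^esub> D.ord (emb f)) \<in> carrier FF"
        using W emb_int_pow[OF u(1) un] by simp
    qed (rule f)
    ultimately show "\<exists>t u. uniformizer_at C (ppoint_of x) t \<and>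
        u \<in> local_ring_at C (ppoint_of x) - max_ideal_at C (ppoint_of x) \<and>
        f = u \<otimes>\<^bsub>FF\<^esub> (t [^]\<^bsub>FF\<^esub> D.ord (emb f))"
      using uniformizer[OF x(1)] by blast
  next
    fix n :: int
    assume "\<exists>t u. uniformizer_at C (ppoint_of x) t \<and>
        u \<in> local_ring_at C (ppoint_of x) - max_ideal_at C (ppoint_of x) \<and>
        f = u \<otimes>\<^bsub>FF\<^esub> (t [^]\<^bsub>FF\<^esub> n)"
    then obtain t w where t: "uniformizer_at C (ppoint_of x) t"
      and w: "w \<in> local_ring_at C (ppoint_of x)" "w \<notin> max_ideal_at C (ppoint_of x)"
      and fw: "f = w \<otimes>\<^bsub>FF\<^esub> (t [^]\<^bsub>FF\<^esub> n)" by blast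
    note ti = uniformizer_image[OF x(1) t]
    have tn: "t \<noteq> \<zero>\<^bsub>FF\<^esub>"
    proof
      assume "t = \<zero>\<^bsub>FF\<^esub>"
      then have "M x \<subseteq> {0}" unfolding ti(2) by auto
      then show False using D.\<tau>_in_M D.\<tau>_nonzero by blast
    qed
    have wc: "w \<in> carrier FF" using w local_ring_carrier by blast
    have "emb w \<in> D.U" using w mem_local_ring_iff[OF x(1) wc] by (simp add: D.U_def)
    moreover have "emb f = emb w * emb t powi n" unfolding fw using wc emb_int_pow[OF ti(1) tn] by simp
    ultimately show "n = D.ord (emb f)" using D.ord_uniformizer[OF ti(2)] by simp
  qed
qed

end

section \<open>Functions without poles\<close>

lemma total_preorder_greatest:
  assumes "finite A" "A \<noteq> {}"
    and total: "\<And>i j. i \<in> A \<Longrightarrow> j \<in> A \<Longrightarrow> R i j \<or> R j i"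
    and trans: "\<And>i j k. i \<in> A \<Longrightarrow> j \<in> A \<Longrightarrow> k \<in> A \<Longrightarrow> R i j \<Longrightarrow> R j k \<Longrightarrow> R i k"
  shows "\<exists>j\<in>A. \<forall>i\<in>A. R i j"
  using assms
proof (induction A rule: finite_ne_induct)
  case (singleton a)
  then show ?case by blast
next
  case (insert a A)
  have "\<exists>j\<in>A. \<forall>i\<in>A. R i j"
  proof (rule insert.IH)
    show "R i j \<or> R j i" if "i \<in> A" "j \<in> A" for i j using that by (intro insert.prems(1)) auto
    show "R i k" if "i \<in> A" "j \<in> A" "k \<in> A" "R i j" "R j k" for i j k
      by (rule insert.prems(2)[of i j k]) (use that in auto)
  qed
  then obtain j where j: "j \<in> A" "\<forall>i\<in>A. R i j" by blast
  show ?case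
  proof (cases "R a j")
    case True
    then show ?thesis using j by blast
  next
    case False
    have "R j a" "R a a" using insert.prems(1)[of a j] insert.prems(1)[of a a] j(1) False by auto
    moreover have "R i a" if "i \<in> A" for i
      using insert.prems(2)[of i j a] j that \<open>R j a\<close> by auto
    ultimately show ?thesis by (intro bexI[of _ a]) auto
  qed
qed

context generic_point begin

lemma ex_nonzero_coordinate: "\<exists>i. \<xi> i \<noteq> 0"
proof -
  obtain P where "P \<in> C" using nonempty by blast
  then obtain x where x: "P = ppoint_of x" "x \<noteq> (\<lambda>_. 0)" by (rule pointE)
  then obtain i where "x i \<noteq> 0" by auto
  then have "ev (mvar i) \<noteq> 0"
    using ev_eq_0_imp[of x 1 "mvar i"] \<open>P \<in> C\<close> x homogeneous_deg_mvar[of i] by auto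
  then show ?thesis by auto
qed

text \<open>
  If all \<open>\<xi>\<^sub>i / \<xi>\<^sub>j\<close> with \<open>j\<close> fixed can be specialized, their values are homogeneous coordinates of a point. It lies on the
  curve because the equations of the curve hold at \<open>\<xi>\<close>.
\<close>

lemma center_of_specialization:
  assumes G: "specialization base G"
    and j: "\<xi> j \<noteq> 0" and \<omega>: "\<And>i. (\<xi> i / \<xi> j, \<omega> i) \<in> G"
  shows "ppoint_of \<omega> \<in> C" "\<omega> \<noteq> (\<lambda>_. 0)"
    "\<And>d p. homogeneous_deg d p \<Longrightarrow> (ev p / \<xi> j ^ d, ac.mev \<omega> p) \<in> G"
proof -
  interpret specialization base G by fact
  show ev: "(ev p / \<xi> j ^ d, ac.mev \<omega> p) \<in> G" if "homogeneous_deg d p" for d p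
  proof -
    have "gen.mev (\<lambda>i. inverse (\<xi> j) * \<xi> i) p = inverse (\<xi> j) ^ d * ev p" by (rule gen.mev_scale) fact
    then have "gen.mev (\<lambda>i. \<xi> i / \<xi> j) p = ev p / \<xi> j ^ d"
      by (simp add: divide_inverse power_inverse mult.commute)
    then show ?thesis using mev[of "\<lambda>i. \<xi> i / \<xi> j" \<omega> p, OF \<omega>] by simp
  qed
  have "(1, \<omega> j) \<in> G" using \<omega>[of j] j by simp
  then have "(0, \<omega> j - 1) \<in> G" using diff[OF _ one, of 1 "\<omega> j"] by simp
  then have "\<omega> j = 1" using functional[of "\<omega> j - 1"] by simp
  then show nz: "\<omega> \<noteq> (\<lambda>_. 0)" by (metis zero_neq_one)
  obtain S :: "('n, 'a) mpol set" where S: "\<And>p. p \<in> S \<Longrightarrow> homogeneous p" "C = zero_locus (base_change ` S)"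
    using over_base unfolding projective_over_base_def by blast
  have "vanishes_at (base_change p) (ppoint_of \<omega>)" if p: "p \<in> S" for p
  proof -
    obtain d where d: "homogeneous_deg d p" using S(1)[OF p] unfolding homogeneous_def by blast
    have "vanishes_on p C" using p unfolding vanishes_on_def S(2) zero_locus_def by blast
    then have "ev p = 0" using generic[OF S(1)[OF p]] by blast
    then have "(0, ac.mev \<omega> p) \<in> G" using ev[OF d] by simp
    then show ?thesis using functional vanishes_at_base_change[OF S(1)[OF p]] by blast
  qed
  moreover have "ppoint_of \<omega> \<in> proj_space" unfolding proj_space_def using nz by blast
  ultimately show "ppoint_of \<omega> \<in> C" unfolding S(2) zero_locus_def by blast
qed

text \<open>
  A polynomial relation \<open>p(1/f) = 0\<close> of degree \<open>n\<close>, multiplied by \<open>f\<^sup>n\<close>, takes at a zero of \<open>f\<close> the value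
  of the leading coefficient. Hence \<open>1/f\<close> is transcendental and may be specialized to \<open>0\<close>.
\<close>

lemma specialization_at_zero:
  assumes f: "f \<noteq> 0" and x: "ppoint_of x \<in> C" "f \<in> M x"
  shows "specialization base (range (\<lambda>p. (gen.pev (inverse f) p, ac.pev 0 p)))"
    (is "specialization _ ?G")
proof -
  interpret S: specialization base "place x"
    by (rule place_specialization) fact
  have f0: "(f, 0) \<in> place x" using x(2) by (simp add: M_def)
  have inj: "p = 0" if p: "gen.pev (inverse f) p = 0" for p
  proof (rule ccontr)
    assume "p \<noteq> 0"
    let ?n = "Polynomial.degree p"
    let ?c = "\<lambda>i. poly.coeff p i"
    have "0 = f ^ ?n * gen.pev (inverse f) p" using p by simp
    also have "\<dots> = (\<Sum>i\<le>?n. ultra_const (to_ac (?c i)) * f ^ (?n - i))"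
      unfolding gen.pev_altdef sum_distrib_left
    proof (intro sum.cong refl)
      fix i assume "i \<in> {..?n}"
      then have "f ^ ?n * inverse f ^ i = f ^ (?n - i)" using f by (simp add: power_diff power_inverse divide_inverse)
      then show "f ^ ?n * (ultra_const (to_ac (?c i)) * inverse f ^ i) = ultra_const (to_ac (?c i)) * f ^ (?n - i)"
        by (simp add: ac_simps)
    qed
    finally have "(0, \<Sum>i\<le>?n. to_ac (?c i) * 0 ^ (?n - i)) \<in> place x"
      using S.sum[of "{..?n}" "\<lambda>i. ultra_const (to_ac (?c i)) * f ^ (?n - i)" "\<lambda>i. to_ac (?c i) * 0 ^ (?n - i)"]
        S.mult[OF S.const S.power[OF f0]] by simp
    then have "(\<Sum>i\<le>?n. to_ac (?c i) * 0 ^ (?n - i)) = 0" by (rule S.functional)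
    also have "(\<Sum>i\<le>?n. to_ac (?c i) * 0 ^ (?n - i)) = (\<Sum>i\<in>{?n}. to_ac (?c i) * 0 ^ (?n - i))"
      by (intro sum.mono_neutral_right) auto
    finally show False using \<open>p \<noteq> 0\<close> by simp
  qed
  have mem: "(gen.pev (inverse f) p, ac.pev 0 p) \<in> ?G" for p by blast
  show ?thesis
  proof unfold_locales
    show "(base c, to_ac c) \<in> ?G" for c using mem[of "[:c:]"] by simp
    fix a b a' b' assume "(a, b) \<in> ?G" "(a', b') \<in> ?G"
    then obtain p p' where p: "a = gen.pev (inverse f) p" "b = ac.pev 0 p"
      "a' = gen.pev (inverse f) p'" "b' = ac.pev 0 p'" by blast
    show "(a + a', b + b') \<in> ?G" using mem[of "p + p'"] by (simp add: p gen.pev_add ac.pev_add)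
    show "(a * a', b * b') \<in> ?G" using mem[of "p * p'"] by (simp add: p gen.pev_mult ac.pev_mult)
  next
    fix b assume "(0, b) \<in> ?G"
    then obtain p where "gen.pev (inverse f) p = 0" "b = ac.pev 0 p" by auto
    then show "b = 0" using inj[of p] by simp
  qed
qed

text \<open>
  The specialization \<open>1/f \<mapsto> 0\<close> extends to \<open>\<xi>\<^sub>i / \<xi>\<^sub>j\<close> or to \<open>\<xi>\<^sub>j / \<xi>\<^sub>i\<close> for all \<open>i\<close> and \<open>j\<close>. This is a total
  preorder on the indices, and its greatest element \<open>j\<close> gives a chart in which all coordinates have
  values. At the resulting centre \<open>\<omega>\<close> write \<open>f = g/h\<close> with \<open>h(\<omega>) \<noteq> 0\<close>; the equation
  \<open>(1/f) g(\<xi>) = h(\<xi>)\<close> specializes to \<open>0 = h(\<omega>)\<close>.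
\<close>

theorem regular_everywhere_vanishing_somewhere:
  assumes reg: "\<And>x. ppoint_of x \<in> C \<Longrightarrow> x \<noteq> (\<lambda>_. 0) \<Longrightarrow> f \<in> V x"
    and x: "ppoint_of x \<in> C" "f \<in> M x"
  shows "f = 0"
proof (rule ccontr)
  assume f: "f \<noteq> 0"
  let ?G0 = "range (\<lambda>p. (gen.pev (inverse f) p, ac.pev 0 p))"
  define A where "A = {i. \<xi> i \<noteq> 0}"
  define Z where "Z = (\<lambda>(i, j). \<xi> i / \<xi> j) ` (A \<times> A)"
  have "finite Z" "0 \<notin> Z" unfolding Z_def A_def by auto
  then obtain G where G: "?G0 \<subseteq> G" "specialization base G"
    and GZ: "\<And>z. z \<in> Z \<Longrightarrow> (\<exists>w. (z, w) \<in> G) \<or> (\<exists>w. (inverse z, w) \<in> G)"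
    using specialization_extend_finite[OF _ _ specialization_at_zero[OF f x], of Z] by blast
  interpret S: specialization base G by fact
  have "\<exists>j\<in>A. \<forall>i\<in>A. \<exists>w. (\<xi> i / \<xi> j, w) \<in> G"
  proof (rule total_preorder_greatest)
    show "finite A" "A \<noteq> {}" using ex_nonzero_coordinate unfolding A_def by auto
    show "(\<exists>w. (\<xi> i / \<xi> j, w) \<in> G) \<or> (\<exists>w. (\<xi> j / \<xi> i, w) \<in> G)" if "i \<in> A" "j \<in> A" for i j
    proof -
      have "\<xi> i / \<xi> j \<in> Z" using that unfolding Z_def by (intro image_eqI[of _ _ "(i, j)"]) auto
      then show ?thesis using GZ[of "\<xi> i / \<xi> j"] by simp
    qed
    fix i j k assume *: "i \<in> A" "j \<in> A" "k \<in> A" "\<exists>w. (\<xi> i / \<xi> j, w) \<in> G" "\<exists>w. (\<xi> j / \<xi> k, w) \<in> G"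
    then obtain w w' where "(\<xi> i / \<xi> j, w) \<in> G" "(\<xi> j / \<xi> k, w') \<in> G" by blast
    moreover have "\<xi> i / \<xi> j * (\<xi> j / \<xi> k) = \<xi> i / \<xi> k" using *(2) by (simp add: A_def)
    ultimately show "\<exists>w. (\<xi> i / \<xi> k, w) \<in> G" using S.mult by metis
  qed
  then obtain j where j: "j \<in> A" "\<And>i. i \<in> A \<Longrightarrow> \<exists>w. (\<xi> i / \<xi> j, w) \<in> G" by blast
  have "\<exists>w. (\<xi> i / \<xi> j, w) \<in> G" for i
    using j(2)[of i] S.zero by (cases "i \<in> A") (auto simp: A_def)
  then obtain \<omega> where \<omega>: "\<And>i. (\<xi> i / \<xi> j, \<omega> i) \<in> G" by metis
  have \<xi>j: "\<xi> j \<noteq> 0" using j(1) by (simp add: A_def)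
  note center = center_of_specialization[OF G(2) \<xi>j \<omega>]
  obtain b where "(f, b) \<in> place \<omega>" using reg[OF center(1,2)] unfolding V_def by blast
  then obtain g h d where gh: "homogeneous_deg d g" "homogeneous_deg d h" "ac.mev \<omega> h \<noteq> 0"
    "f = ev g / ev h" by (elim placeE)
  have "ev g \<noteq> 0" "ev h \<noteq> 0" using f gh(4) by auto
  then have eq: "inverse f * (ev g / \<xi> j ^ d) = ev h / \<xi> j ^ d" unfolding gh(4) by simp
  have "(gen.pev (inverse f) [:0, 1:], ac.pev 0 [:0, 1:]) \<in> G" using G(1) by blast
  then have "(inverse f, 0) \<in> G" by simp
  then have "(ev h / \<xi> j ^ d, 0) \<in> G"
    using S.mult[OF _ center(3)[OF gh(1)], of "inverse f" 0] unfolding eq mult_zero_left by blast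
  then have "(0, ac.mev \<omega> h) \<in> G" using S.diff[OF center(3)[OF gh(2)]] by fastforce
  then show False using S.functional gh(3) by blast
qed

end

section \<open>Dimension as a number of values\<close>

text \<open>
  A class is determined by the common value of the coordinate.
\<close>

lemma quotient_coord_equiv:
  fixes B :: "('m \<Rightarrow> int) set"
  shows "finite (B // coord_equiv B i) \<longleftrightarrow> finite ((\<lambda>\<beta>. \<beta> i) ` B)"
    and "card (B // coord_equiv B i) = card ((\<lambda>\<beta>. \<beta> i) ` B)"
proof -
  let ?c = "\<lambda>v. {\<gamma> \<in> B. \<gamma> i = v}"
  have "B // coord_equiv B i = (\<lambda>\<beta>. coord_equiv B i `` {\<beta>}) ` B" by (auto simp: quotient_def)
  also have "\<dots> = (\<lambda>\<beta>. ?c (\<beta> i)) ` B" by (intro image_cong refl) (auto simp: coord_equiv_def)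
  finally have eq: "B // coord_equiv B i = ?c ` ((\<lambda>\<beta>. \<beta> i) ` B)" by (simp only: image_image)
  have inj: "inj_on ?c ((\<lambda>\<beta>. \<beta> i) ` B)"
  proof (rule inj_onI)
    fix v w assume "v \<in> (\<lambda>\<beta>. \<beta> i) ` B" "?c v = ?c w"
    then obtain \<beta> where "\<beta> \<in> ?c v" "?c v = ?c w" by blast
    then have "\<beta> i = v" "\<beta> i = w" by blast+
    then show "v = w" by simp
  qed
  show "finite (B // coord_equiv B i) \<longleftrightarrow> finite ((\<lambda>\<beta>. \<beta> i) ` B)"
    unfolding eq using inj by (rule finite_image_iff)
  show "card (B // coord_equiv B i) = card ((\<lambda>\<beta>. \<beta> i) ` B)"
    unfolding eq using inj by (rule card_image)
qed

text \<open>
  Each value \<open>m\<close> of \<open>v\<close> contributes one dimension: by the hypothesis on leading coefficients, the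
  elements of value at least \<open>m\<close> are spanned by one element of value \<open>m\<close> and those of larger value.
  The induction is on the number of values above the threshold \<open>n\<close>.
\<close>

lemma (in field) dimension_by_filtration:
  fixes k E :: "'a set" and v :: "'a \<Rightarrow> int" and n :: int
  assumes sub: "subfield k R" and E: "E \<subseteq> carrier R" and zero: "\<zero> \<in> E"
    and closed: "\<And>n a b. a \<in> {a \<in> E. a = \<zero> \<or> n < v a} \<Longrightarrow> b \<in> {a \<in> E. a = \<zero> \<or> n < v a} \<Longrightarrow> a \<oplus> b \<in> {a \<in> E. a = \<zero> \<or> n < v a}"
      "\<And>n a c. a \<in> {a \<in> E. a = \<zero> \<or> n < v a} \<Longrightarrow> c \<in> k \<Longrightarrow> c \<otimes> a \<in> {a \<in> E. a = \<zero> \<or> n < v a}"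
    and lead: "\<And>a b. a \<in> E \<Longrightarrow> b \<in> E \<Longrightarrow> a \<noteq> \<zero> \<Longrightarrow> b \<noteq> \<zero> \<Longrightarrow> v a = v b \<Longrightarrow>
      \<exists>c\<in>k. \<exists>e\<in>E. a = c \<otimes> b \<oplus> e \<and> (e = \<zero> \<or> v a < v e)"
    and fin: "finite (v ` {a \<in> E. a \<noteq> \<zero> \<and> n < v a})"
  shows "dimension (card (v ` {a \<in> E. a \<noteq> \<zero> \<and> n < v a})) k {a \<in> E. a = \<zero> \<or> n < v a}"
  using fin
proof (induction "card (v ` {a \<in> E. a \<noteq> \<zero> \<and> n < v a})" arbitrary: n)
  case 0
  then have "{a \<in> E. a \<noteq> \<zero> \<and> n < v a} = {}" by simp
  then have "{a \<in> E. a = \<zero> \<or> n < v a} = {\<zero>}" using zero by blast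
  moreover have "card (v ` {a \<in> E. a \<noteq> \<zero> \<and> n < v a}) = 0" using 0(1) by simp
  ultimately show ?case by (simp only: zero_dim)
next
  case (Suc N)
  let ?S = "\<lambda>n. v ` {a \<in> E. a \<noteq> \<zero> \<and> n < v a}"
  let ?E = "\<lambda>n. {a \<in> E. a = \<zero> \<or> n < v a}"
  define m where "m = Min (?S n)"
  have ne: "?S n \<noteq> {}" using Suc.hyps(2) by (metis card.empty nat.distinct(1))
  then have m: "m \<in> ?S n" unfolding m_def using Suc.prems by (intro Min_in)
  then obtain g where g: "g \<in> E" "g \<noteq> \<zero>" "n < v g" "v g = m" by blast
  have min: "m \<le> v a" if "a \<in> E" "a \<noteq> \<zero>" "n < v a" for a
    unfolding m_def using that Suc.prems by (intro Min_le) auto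
  have S: "?S n = insert m (?S m)"
  proof (intro Set.equalityI subsetI)
    fix y assume "y \<in> ?S n"
    then obtain a where a: "y = v a" "a \<in> E" "a \<noteq> \<zero>" "n < v a" by blast
    show "y \<in> insert m (?S m)"
    proof (cases "y = m")
      case False
      then have "m < v a" using min[OF a(2-4)] a(1) by simp
      then show ?thesis using a by blast
    qed simp
  next
    fix y assume "y \<in> insert m (?S m)"
    then show "y \<in> ?S n"
    proof (elim insertE)
      assume "y \<in> ?S m"
      then obtain a where a: "y = v a" "a \<in> E" "a \<noteq> \<zero>" "m < v a" by blast
      then show ?thesis using g by (intro image_eqI[of _ _ a]) auto
    qed (use m in simp)
  qed
  have "m \<notin> ?S m" by auto
  moreover have finm: "finite (?S m)" using Suc.prems unfolding S by simp
  ultimately have card: "card (?S n) = Suc (card (?S m))" unfolding S by simp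
  have dim: "dimension (card (?S m)) k (?E m)"
    using Suc.hyps(1)[of m] finm card Suc.hyps(2) by simp
  have "line_extension k g (?E m) = ?E n"
  proof (intro Set.equalityI subsetI)
    fix u assume "u \<in> line_extension k g (?E m)"
    then obtain c e where ce: "c \<in> k" "e \<in> ?E m" "u = c \<otimes> g \<oplus> e"
      unfolding line_extension_mem_iff by blast
    have "e \<in> ?E n" using ce(2) g(3,4) by auto
    moreover have "c \<otimes> g \<in> ?E n" using g ce(1) by (intro closed(2)) auto
    ultimately show "u \<in> ?E n" unfolding ce(3) by (intro closed(1))
  next
    fix u assume u: "u \<in> ?E n"
    show "u \<in> line_extension k g (?E m)"
    proof (cases "u \<in> ?E m")
      case True
      have "\<zero> \<in> k" using subfieldE(1)[OF sub] by (rule subringE(2))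
      moreover have "g \<in> carrier R" "u \<in> carrier R" using g(1) u E by blast+
      then have "u = \<zero> \<otimes> g \<oplus> u" by simp
      ultimately show ?thesis using True unfolding line_extension_mem_iff by blast
    next
      case False
      then have "u \<noteq> \<zero>" "v u \<le> m" "u \<in> E" "n < v u" using u by auto
      then have "v u = v g" using min[of u] g(4) by simp
      then obtain c e where "c \<in> k" "e \<in> E" "u = c \<otimes> g \<oplus> e" "e = \<zero> \<or> v u < v e"
        using lead[OF \<open>u \<in> E\<close> g(1) \<open>u \<noteq> \<zero>\<close> g(2)] by blast
      then show ?thesis using \<open>v u = v g\<close> g(4) unfolding line_extension_mem_iff by auto
    qed
  qed
  moreover have "g \<notin> ?E m" using g by auto
  ultimately show ?case using Suc_dim[OF _ _ dim, of g] g(1) E card by auto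
qed

section \<open>Riemann-Roch spaces supported at rational points\<close>

context generic_point begin

lemma constant_functionsE:
  assumes "a \<in> consts"
  obtains c where "a \<in> carrier FF" "emb a = base c"
  using assms const_in_carrier emb_const unfolding constant_functions_def by blast

lemma constant_functionsI:
  assumes "a \<in> carrier FF" "emb a = base c"
  shows "a \<in> consts"
proof -
  have "a = ratfun C (Poly_Mapping.single 0 c) 1"
    using assms const_in_carrier by (intro inj_onD[OF emb_inj]) (simp_all add: emb_const)
  then show ?thesis unfolding constant_functions_def by blast
qed

lemma constant_functions_subfield: "subfield consts FF"
proof (rule FF.subfieldI'[OF FF.subringI])
  show "consts \<subseteq> carrier FF" by (rule constant_functions_subset)
  show "\<one>\<^bsub>FF\<^esub> \<in> consts"
    by (rule constant_functionsI[of _ 1]) (simp_all add: FF_closed)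
  fix a assume "a \<in> consts"
  then obtain c where a: "a \<in> carrier FF" "emb a = base c" by (rule constant_functionsE)
  show "\<ominus>\<^bsub>FF\<^esub> a \<in> consts"
    using a by (intro constant_functionsI[of _ "- c"]) simp_all
  fix b assume "b \<in> consts"
  then obtain d where b: "b \<in> carrier FF" "emb b = ultra_const (to_ac d)" by (rule constant_functionsE)
  show "a \<otimes>\<^bsub>FF\<^esub> b \<in> consts"
    using a b by (intro constant_functionsI[of _ "c * d"]) simp_all
  show "a \<oplus>\<^bsub>FF\<^esub> b \<in> consts"
    using a b by (intro constant_functionsI[of _ "c + d"]) simp_all
next
  fix a assume "a \<in> consts - {\<zero>\<^bsub>FF\<^esub>}"
  then have an: "a \<noteq> \<zero>\<^bsub>FF\<^esub>" and "a \<in> consts" by auto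
  from this(2) obtain c where a: "a \<in> carrier FF" "emb a = base c" by (rule constant_functionsE)
  have "inv\<^bsub>FF\<^esub> a \<in> carrier FF"
    using a(1) an FF.field_Units FF.Units_inv_closed by blast
  then show "inv\<^bsub>FF\<^esub> a \<in> consts"
    using a an by (intro constant_functionsI[of _ "inverse c"]) (simp_all add: ultra_const_inverse)
qed

end

locale pointed_curve = smooth_curve +
  fixes Q :: "'m::finite \<Rightarrow> ('a, 'b alg_closure) ppoint"
  assumes rational: "Q i \<in> rational_points C"
    and inj_Q: "inj Q"
begin

definition coord :: "'m \<Rightarrow> 'a \<Rightarrow> 'b" where
  "coord i = (SOME y. y \<noteq> (\<lambda>_. 0) \<and> Q i = ppoint_of (\<lambda>k. to_ac (y k)))"

definition rep :: "'m \<Rightarrow> 'a \<Rightarrow> 'b alg_closure" where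
  "rep i = (\<lambda>k. to_ac (coord i k))"

lemma rep: "rep i \<noteq> (\<lambda>_. 0)" "Q i = ppoint_of (rep i)" "ppoint_of (rep i) \<in> C" "Q i \<in> C"
proof -
  have "\<exists>y. y \<noteq> (\<lambda>_. 0) \<and> Q i = ppoint_of (\<lambda>k. to_ac (y k))" "Q i \<in> C"
    using rational[of i] unfolding rational_points_def by blast+
  from someI_ex[OF this(1)] this(2) show "rep i \<noteq> (\<lambda>_. 0)" "Q i = ppoint_of (rep i)" "ppoint_of (rep i) \<in> C" "Q i \<in> C"
    unfolding rep_def coord_def[symmetric] by (auto simp: fun_eq_iff)
qed

sublocale D: dvr K "V (rep i)" "M (rep i)" "emb (uniformizer (rep i))" for i
  by (rule point_dvr[OF rep(3,1)])

abbreviation ordQ :: "'m \<Rightarrow> 'b alg_closure ultra \<Rightarrow> int" where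
  "ordQ i \<equiv> D.ord i"

lemma valuation_at_Q:
  assumes "f \<in> carrier FF" "f \<noteq> \<zero>\<^bsub>FF\<^esub>"
  shows "valuation_at C (Q i) f = ordQ i (emb f)"
  unfolding rep(2)[of i] valuation_at_eq[OF rep(3)[of i] rep(1)[of i] assms] ord_at_def ..

text \<open>
  At a point with coordinates in \<open>k\<close>, functions over \<open>k\<close> take values in \<open>k\<close>.
\<close>

lemma residue_rational:
  assumes "f \<in> V (rep i)"
  shows "\<exists>c. f - base c \<in> M (rep i)"
proof -
  interpret S: specialization base "place (rep i)"
    by (rule place_specialization[OF rep(3)])
  interpret ident: type_ring_hom "\<lambda>c :: 'b. c" by unfold_locales simp_all
  have val: "ac.mev (rep i) p = to_ac (ident.mev (coord i) p)" for p
    unfolding rep_def by (rule mev_comp[OF ident.type_ring_hom_axioms to_ac_hom, symmetric])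
  obtain b where b: "(f, b) \<in> place (rep i)" using assms unfolding V_def by blast
  then obtain g h d where "b = ac.mev (rep i) g / ac.mev (rep i) h" by (elim placeE)
  then have "b = to_ac (ident.mev (coord i) g / ident.mev (coord i) h)" unfolding val by simp
  then obtain c where "b = to_ac c" by blast
  then have "(f - base c, 0) \<in> place (rep i)" using S.diff[OF b S.const[of c]] by simp
  then show ?thesis unfolding M_def by blast
qed

lemma leading_coefficient:
  assumes "f \<in> K" "g \<in> K" "f \<noteq> 0" "g \<noteq> 0" "ordQ i f = ordQ i g"
  shows "\<exists>c. f - base c * g = 0 \<or> ordQ i f < ordQ i (f - base c * g)"
proof -
  obtain c where c: "f / g - base c \<in> M (rep i)"
    using residue_rational[OF D.ord_eq_imp_quotient_in_V[OF assms(1,3,2,4,5)]] by blast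
  have eq: "f - base c * g = g * (f / g - base c)" using assms(4) by (simp add: right_diff_distrib)
  have "f - base c * g \<in> K" using assms K_closed by simp
  then have "g * (f / g - base c) \<noteq> 0 \<Longrightarrow> ordQ i f < ordQ i (g * (f / g - base c))"
    unfolding eq assms(5) by (rule D.ord_less_mult_M[OF assms(2,4) c])
  then show ?thesis unfolding eq[symmetric] by blast
qed

definition regular_off :: "'b alg_closure ultra set" where
  "regular_off = {f \<in> K. \<forall>x. ppoint_of x \<in> C \<longrightarrow> x \<noteq> (\<lambda>_. 0) \<longrightarrow> ppoint_of x \<notin> range Q \<longrightarrow> f \<in> V x}"

text \<open>
  The image of the Riemann-Roch space in the ambient field.
\<close>

definition L :: "('m \<Rightarrow> int) \<Rightarrow> 'b alg_closure ultra set" where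
  "L \<alpha> = {f \<in> regular_off. f \<noteq> 0 \<longrightarrow> (\<forall>i. - \<alpha> i \<le> ordQ i f)}"

lemma regular_off_K: "f \<in> regular_off \<Longrightarrow> f \<in> K"
  by (simp add: regular_off_def)

lemma V_closed:
  assumes "ppoint_of x \<in> C" "x \<noteq> (\<lambda>_. 0)"
  shows "0 \<in> V x" "base c \<in> V x" "f \<in> V x \<Longrightarrow> g \<in> V x \<Longrightarrow> f - g \<in> V x"
    "f \<in> V x \<Longrightarrow> g \<in> V x \<Longrightarrow> f * g \<in> V x"
proof -
  interpret S: specialization base "place x"
    by (rule place_specialization) fact
  show "0 \<in> V x" "base c \<in> V x" using S.zero S.const unfolding V_def by blast+
  show "f \<in> V x \<Longrightarrow> g \<in> V x \<Longrightarrow> f - g \<in> V x" "f \<in> V x \<Longrightarrow> g \<in> V x \<Longrightarrow> f * g \<in> V x"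
    using S.diff S.mult unfolding V_def by blast+
qed

lemma regular_off_closed:
  shows "0 \<in> regular_off" "f \<in> regular_off \<Longrightarrow> g \<in> regular_off \<Longrightarrow> f - g \<in> regular_off"
    "f \<in> regular_off \<Longrightarrow> base c * f \<in> regular_off"
  unfolding regular_off_def using V_closed K_closed by simp_all

lemma ord_base_mult:
  assumes "f \<in> K" "f \<noteq> 0" "c \<noteq> 0"
  shows "ordQ i (base c * f) = ordQ i f"
proof -
  have "base c * base (inverse c) = base (c * inverse c)" by (simp only: gen.hom_mult)
  then have "base c * base (inverse c) = 1" using assms(3) by simp
  then have "base c \<in> D.U i"
    by (rule D.U_I[rotated 2]) (rule V_closed(2)[OF rep(3,1)])+
  then show ?thesis by (rule D.ord_mult_unit[OF assms(1,2)])
qed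

lemma L_diff: 
  assumes "f \<in> L \<alpha>" "g \<in> L \<alpha>"
  shows "f - g \<in> L \<alpha>"
proof -
  have K: "f \<in> K" "g \<in> K" "f - g \<in> K" using assms unfolding L_def by (auto dest: regular_off_K intro: K_closed)
  show ?thesis
    using assms K D.le_ord_diff[OF K] regular_off_closed(2) unfolding L_def by blast
qed

lemma L_base_mult: "f \<in> L \<alpha> \<Longrightarrow> base c * f \<in> L \<alpha>"
  using ord_base_mult[of f c] regular_off_closed(3)[of f c] regular_off_K[of f] unfolding L_def by (cases "c = 0") auto

lemma L_zero: "0 \<in> L \<alpha>"
  using regular_off_closed(1) unfolding L_def by simp

lemma L_uminus: "f \<in> L \<alpha> \<Longrightarrow> - f \<in> L \<alpha>"
  using L_diff[OF L_zero] by simp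

lemma L_add: "f \<in> L \<alpha> \<Longrightarrow> g \<in> L \<alpha> \<Longrightarrow> f + g \<in> L \<alpha>"
  using L_diff[OF _ L_uminus, of f \<alpha> g] by simp

lemma L_K: "f \<in> L \<alpha> \<Longrightarrow> f \<in> K"
  unfolding L_def using regular_off_K by blast

lemma L_negative:
  assumes "\<And>i. \<alpha> i < 0"
  shows "L \<alpha> \<subseteq> {0}"
proof
  fix f assume f: "f \<in> L \<alpha>"
  have "f = 0"
  proof (rule ccontr)
    assume "f \<noteq> 0"
    have ord: "0 < ordQ i f" for i using f \<open>f \<noteq> 0\<close> assms[of i] unfolding L_def by (smt (verit) mem_Collect_eq)
    have reg: "f \<in> V x" if x: "ppoint_of x \<in> C" "x \<noteq> (\<lambda>_. 0)" for x
    proof (cases "ppoint_of x \<in> range Q")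
      case True
      then obtain i where "ppoint_of x = ppoint_of (rep i)" using rep(2) by auto
      then have "V x = V (rep i)" using place_eq(1)[OF x(1)] place_eq(1)[OF rep(3)[of i]] by simp
      then show ?thesis using D.V_iff_ord[OF L_K[OF f] \<open>f \<noteq> 0\<close>] ord[of i] by simp
    next
      case False
      then show ?thesis using f x unfolding L_def regular_off_def by blast
    qed
    have "f \<in> M (rep undefined)" using D.M_iff_ord[OF L_K[OF f] \<open>f \<noteq> 0\<close>] ord by blast
    then show False using regular_everywhere_vanishing_somewhere[OF reg rep(3)] \<open>f \<noteq> 0\<close> by blast
  qed
  then show "f \<in> {0}" by simp
qed

lemma L_drop:
  assumes "f \<in> L \<alpha>" "g \<in> L \<alpha>" "g \<notin> L (\<alpha>(i := \<alpha> i - 1))"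
  shows "\<exists>c. f - base c * g \<in> L (\<alpha>(i := \<alpha> i - 1))"
proof -
  let ?\<alpha> = "\<alpha>(i := \<alpha> i - 1)"
  have crit: "h \<in> L ?\<alpha> \<longleftrightarrow> h = 0 \<or> - \<alpha> i < ordQ i h" if "h \<in> L \<alpha>" for h
    using that regular_off_closed(1) unfolding L_def by (auto split: if_splits)
  show ?thesis
  proof (cases "f \<in> L ?\<alpha>")
    case True
    then show ?thesis by (intro exI[of _ 0]) simp
  next
    case False
    then have f: "f \<noteq> 0" "ordQ i f \<le> - \<alpha> i" using crit[OF assms(1)] by auto
    have g: "g \<noteq> 0" "ordQ i g \<le> - \<alpha> i" using crit[OF assms(2)] assms(3) by auto
    have "ordQ i f = - \<alpha> i" "ordQ i g = - \<alpha> i"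
      using f g assms(1,2) unfolding L_def by (auto intro: antisym)
    then obtain c where "f - base c * g = 0 \<or> - \<alpha> i < ordQ i (f - base c * g)"
      using leading_coefficient[OF L_K[OF assms(1)] L_K[OF assms(2)] f(1) g(1), of i] by auto
    then show ?thesis using crit[OF L_diff[OF assms(1) L_base_mult[OF assms(2)]]] by blast
  qed
qed

text \<open>
  Raising one coordinate of \<open>\<alpha>\<close> by one multiplies the size of the space by at most that of \<open>k\<close>. When
  all coordinates are negative, the functions vanish at the points \<open>Q i\<close> and are regular elsewhere, so
  only \<open>0\<close> remains.
\<close>

theorem finite_L: "finite (L \<alpha>)"
proof (induction "\<Sum>i\<in>UNIV. nat (\<alpha> i + 1)" arbitrary: \<alpha> rule: less_induct)
  case less
  show ?case
  proof (cases "\<forall>i. \<alpha> i < 0")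
    case True
    then show ?thesis using L_negative finite_subset by blast
  next
    case False
    then obtain i where i: "\<alpha> i \<ge> 0" by (auto simp: not_less)
    let ?\<alpha> = "\<alpha>(i := \<alpha> i - 1)"
    have "(\<Sum>j\<in>UNIV. nat (?\<alpha> j + 1)) < (\<Sum>j\<in>UNIV. nat (\<alpha> j + 1))"
      by (rule sum_strict_mono_ex1) (use i in \<open>auto intro!: exI[of _ i]\<close>)
    then have fin: "finite (L ?\<alpha>)" by (rule less)
    show ?thesis
    proof (cases "L \<alpha> \<subseteq> L ?\<alpha>")
      case True
      then show ?thesis using fin finite_subset by blast
    next
      case False
      then obtain g where g: "g \<in> L \<alpha>" "g \<notin> L ?\<alpha>" by blast
      have "L \<alpha> \<subseteq> (\<lambda>(c, h). h + base c * g) ` (UNIV \<times> L ?\<alpha>)"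
      proof
        fix f assume "f \<in> L \<alpha>"
        then obtain c where "f - base c * g \<in> L ?\<alpha>" using L_drop[OF _ g] by blast
        then show "f \<in> (\<lambda>(c, h). h + base c * g) ` (UNIV \<times> L ?\<alpha>)"
          by (intro image_eqI[of _ _ "(c, f - base c * g)"]) auto
      qed
      then show ?thesis
        by (rule finite_subset) (intro finite_imageI finite_cartesian_product fin finite)
    qed
  qed
qed

end

section \<open>Absolute maximal elements\<close>

context pointed_curve begin

lemma regular_outside_iff:
  assumes f: "f \<in> carrier FF"
  shows "f \<in> regular_outside C Q \<longleftrightarrow> emb f \<in> regular_off"
proof -
  have "emb f \<in> K" using f emb_image by blast
  have "f \<in> regular_outside C Q \<longleftrightarrow> (\<forall>P\<in>C. P \<notin> range Q \<longrightarrow> f \<in> local_ring_at C P)"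
    using f unfolding regular_outside_def by blast
  also have "\<dots> \<longleftrightarrow> (\<forall>x. ppoint_of x \<in> C \<longrightarrow> x \<noteq> (\<lambda>_. 0) \<longrightarrow> ppoint_of x \<notin> range Q \<longrightarrow> f \<in> local_ring_at C (ppoint_of x))"
    by (metis pointE)
  also have "\<dots> \<longleftrightarrow> emb f \<in> regular_off"
    unfolding regular_off_def using \<open>emb f \<in> K\<close> mem_local_ring_iff(1)[OF _ f] by simp
  finally show ?thesis .
qed

lemma divisor_of_eq:
  "divisor_of Q \<alpha> (Q i) = \<alpha> i" "P \<notin> range Q \<Longrightarrow> divisor_of Q \<alpha> P = 0"
proof -
  have "divisor_of Q \<alpha> (Q i) = (\<Sum>j\<in>UNIV. if j = i then \<alpha> j else 0)"
    unfolding divisor_of_def using inj_Q by (intro sum.cong) (auto dest: injD)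
  then show "divisor_of Q \<alpha> (Q i) = \<alpha> i" by simp
  show "P \<notin> range Q \<Longrightarrow> divisor_of Q \<alpha> P = 0"
    unfolding divisor_of_def by (intro sum.neutral) auto
qed

lemma RR_iff:
  assumes f: "f \<in> carrier FF"
  shows "f \<in> RR C Q \<alpha> \<longleftrightarrow> emb f \<in> L \<alpha>"
proof (cases "f = \<zero>\<^bsub>FF\<^esub>")
  case True
  then show ?thesis using f L_zero unfolding RR_def riemann_roch_space_def by simp
next
  case False
  then have nz: "emb f \<noteq> 0" using emb_eq_0_iff[OF f] by simp
  have K: "emb f \<in> K" using f emb_image by blast
  let ?cond = "\<lambda>P. valuation_at C P f + divisor_of Q \<alpha> P \<ge> 0"
  have atQ: "?cond (Q i) \<longleftrightarrow> - \<alpha> i \<le> ordQ i (emb f)" for i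
    unfolding divisor_of_eq(1) valuation_at_Q[OF f False] by auto
  have off: "?cond (ppoint_of x) \<longleftrightarrow> emb f \<in> V x"
    if x: "ppoint_of x \<in> C" "x \<noteq> (\<lambda>_. 0)" "ppoint_of x \<notin> range Q" for x
  proof -
    interpret P: dvr K "V x" "M x" "emb (uniformizer x)" by (rule point_dvr[OF x(1,2)])
    show ?thesis
      unfolding divisor_of_eq(2)[OF x(3)] valuation_at_eq[OF x(1,2) f False] ord_at_def
      using P.V_iff_ord[OF K nz] by simp
  qed
  have "f \<in> RR C Q \<alpha> \<longleftrightarrow> (\<forall>P\<in>C. ?cond P)"
    using f False unfolding RR_def riemann_roch_space_def by simp
  also have "\<dots> \<longleftrightarrow> (\<forall>i. ?cond (Q i)) \<and> (\<forall>P\<in>C. P \<notin> range Q \<longrightarrow> ?cond P)"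
  proof (intro iffI conjI allI)
    assume all: "\<forall>P\<in>C. ?cond P"
    show "?cond (Q i)" for i by (rule bspec[OF all rep(4)])
    show "\<forall>P\<in>C. P \<notin> range Q \<longrightarrow> ?cond P" using all by simp
  next
    assume parts: "(\<forall>i. ?cond (Q i)) \<and> (\<forall>P\<in>C. P \<notin> range Q \<longrightarrow> ?cond P)"
    show "\<forall>P\<in>C. ?cond P"
    proof
      fix P assume "P \<in> C"
      with parts show "?cond P" by (cases "P \<in> range Q") auto
    qed
  qed
  also have "(\<forall>P\<in>C. P \<notin> range Q \<longrightarrow> ?cond P) \<longleftrightarrow>
      (\<forall>x. ppoint_of x \<in> C \<longrightarrow> x \<noteq> (\<lambda>_. 0) \<longrightarrow> ppoint_of x \<notin> range Q \<longrightarrow> ?cond (ppoint_of x))"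
    by (metis pointE)
  also have "\<dots> \<longleftrightarrow> emb f \<in> regular_off"
    unfolding regular_off_def using K off by simp
  also have "(\<forall>i. ?cond (Q i)) \<and> emb f \<in> regular_off \<longleftrightarrow> emb f \<in> L \<alpha>"
    unfolding L_def atQ using nz by blast
  finally show ?thesis .
qed

lemma RR_subset: "RR C Q \<alpha> \<subseteq> carrier FF"
  unfolding RR_def riemann_roch_space_def by blast

lemma emb_RR: "emb ` RR C Q \<alpha> = L \<alpha>"
proof (intro Set.equalityI subsetI)
  fix z assume "z \<in> emb ` RR C Q \<alpha>"
  then show "z \<in> L \<alpha>" using RR_iff RR_subset by blast
next
  fix z assume z: "z \<in> L \<alpha>"
  then have "z \<in> emb ` carrier FF" using L_K unfolding emb_image by blast
  then obtain f where "f \<in> carrier FF" "z = emb f" by (elim imageE)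
  then show "z \<in> emb ` RR C Q \<alpha>" using z RR_iff by blast
qed

text \<open>
  The filtration by the order at \<open>Q i\<close>: rationality of \<open>Q i\<close> provides the leading coefficients, and
  there are finitely many values because the space is finite.
\<close>

theorem dimension_RR:
  "FF.dimension (card (ordQ i ` (L \<alpha> - {0}))) consts (RR C Q \<alpha>)"
proof -
  define E where "E = RR C Q \<alpha>"
  define v where "v f = ordQ i (emb f)" for f
  let ?E = "\<lambda>n. {a \<in> E. a = \<zero>\<^bsub>FF\<^esub> \<or> n < v a}"
  have E: "a \<in> carrier FF \<and> emb a \<in> L \<alpha>" if "a \<in> E" for a
    using that RR_iff RR_subset unfolding E_def by blast
  have EI: "a \<in> E" if "a \<in> carrier FF" "emb a \<in> L \<alpha>" for a
    using that RR_iff unfolding E_def by blast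
  have En: "a \<in> ?E n \<longleftrightarrow> a \<in> carrier FF \<and> emb a \<in> L \<alpha> \<and> (emb a = 0 \<or> n < ordQ i (emb a))" for a n
    using E EI emb_eq_0_iff unfolding v_def by blast
  have closed_diff: "z - w = 0 \<or> n < ordQ i (z - w)"
    if "z \<in> L \<alpha>" "w \<in> L \<alpha>" "z = 0 \<or> n < ordQ i z" "w = 0 \<or> n < ordQ i w" for z w n
    using D.le_ord_diff[OF L_K[OF that(1)] L_K[OF that(2)] L_K[OF L_diff[OF that(1,2)]], of "n + 1" i] that(3,4)
    by (cases "z - w = 0") auto
  have ord_minus: "ordQ i (- w) = ordQ i w" if "w \<in> L \<alpha>" "w \<noteq> 0" for w
    using ord_base_mult[OF L_K[OF that(1)] that(2), of "- 1" i] by simp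
  have closed_add: "z + w = 0 \<or> n < ordQ i (z + w)"
    if "z \<in> L \<alpha>" "w \<in> L \<alpha>" "z = 0 \<or> n < ordQ i z" "w = 0 \<or> n < ordQ i w" for z w n
  proof -
    have "- w = 0 \<or> n < ordQ i (- w)" using that(4) ord_minus[OF that(2)] by (cases "w = 0") auto
    from closed_diff[OF that(1) L_uminus[OF that(2)] that(3) this] show ?thesis by simp
  qed
  have main: "FF.dimension (card (v ` {a \<in> E. a \<noteq> \<zero>\<^bsub>FF\<^esub> \<and> n < v a})) consts (?E n)" for n
  proof (rule FF.dimension_by_filtration[OF constant_functions_subfield])
    show "E \<subseteq> carrier FF" using E by blast
    show "\<zero>\<^bsub>FF\<^esub> \<in> E" by (rule EI) (simp_all add: FF_closed L_zero)
    show "a \<oplus>\<^bsub>FF\<^esub> b \<in> ?E n" if "a \<in> ?E n" "b \<in> ?E n" for n a b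
      using that L_add closed_add unfolding En by (simp add: FF_closed)
    show "c \<otimes>\<^bsub>FF\<^esub> a \<in> ?E n" if a: "a \<in> ?E n" and c: "c \<in> consts" for n a c
    proof -
      obtain d where d: "c \<in> carrier FF" "emb c = base d" using c by (rule constant_functionsE)
      have aL: "emb a \<in> L \<alpha>" "emb a = 0 \<or> n < ordQ i (emb a)" using a unfolding En by simp_all
      have "base d * emb a = 0 \<or> n < ordQ i (base d * emb a)"
        using aL(2) ord_base_mult[OF L_K[OF aL(1)], of d i] by (cases "d = 0 \<or> emb a = 0") auto
      then show ?thesis using a d L_base_mult unfolding En by (simp add: FF_closed)
    qed
    show "\<exists>c\<in>consts. \<exists>e\<in>E. a = c \<otimes>\<^bsub>FF\<^esub> b \<oplus>\<^bsub>FF\<^esub> e \<and> (e = \<zero>\<^bsub>FF\<^esub> \<or> v a < v e)"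
      if a: "a \<in> E" "a \<noteq> \<zero>\<^bsub>FF\<^esub>" and b: "b \<in> E" "b \<noteq> \<zero>\<^bsub>FF\<^esub>" and eq: "v a = v b" for a b
    proof -
      have nz: "emb a \<noteq> 0" "emb b \<noteq> 0"
        using emb_eq_0_iff[of a] emb_eq_0_iff[of b] E[OF a(1)] E[OF b(1)] a(2) b(2) by auto
      have Ks: "emb a \<in> K" "emb b \<in> K" using E[OF a(1)] E[OF b(1)] L_K by auto
      obtain c where c: "emb a - base c * emb b = 0 \<or> ordQ i (emb a) < ordQ i (emb a - base c * emb b)"
        using leading_coefficient[OF Ks nz eq[unfolded v_def]] by blast
      define k where "k = ratfun C (Poly_Mapping.single 0 c) 1"
      define e where "e = a \<ominus>\<^bsub>FF\<^esub> k \<otimes>\<^bsub>FF\<^esub> b"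
      have k: "k \<in> consts" "k \<in> carrier FF" "emb k = base c"
        unfolding k_def emb_const using const_in_carrier by (auto simp: constant_functions_def)
      have car: "a \<in> carrier FF" "b \<in> carrier FF" "e \<in> carrier FF"
        using E[OF a(1)] E[OF b(1)] k(2) unfolding e_def by simp_all
      have embe: "emb e = emb a - base c * emb b" unfolding e_def using car k by simp
      then have "e \<in> E" using E[OF a(1)] E[OF b(1)] car(3) by (intro EI) (simp_all add: L_diff L_base_mult)
      moreover have "a = k \<otimes>\<^bsub>FF\<^esub> b \<oplus>\<^bsub>FF\<^esub> e"
        by (rule inj_onD[OF emb_inj]) (use car k embe in simp_all)
      moreover have "e = \<zero>\<^bsub>FF\<^esub> \<or> v a < v e"
        using c emb_eq_0_iff[OF car(3)] unfolding v_def embe by blast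
      ultimately show ?thesis using k(1) by blast
    qed
    have "finite (ordQ i ` L \<alpha>)" using finite_L by (rule finite_imageI)
    moreover have "v ` {a \<in> E. a \<noteq> \<zero>\<^bsub>FF\<^esub> \<and> n < v a} \<subseteq> ordQ i ` L \<alpha>"
      using E unfolding v_def by blast
    ultimately show "finite (v ` {a \<in> E. a \<noteq> \<zero>\<^bsub>FF\<^esub> \<and> n < v a})" by (rule finite_subset[rotated])
  qed
  have bound: "- \<alpha> i - 1 < v a" if "a \<in> E" "a \<noteq> \<zero>\<^bsub>FF\<^esub>" for a
  proof -
    have "emb a \<noteq> 0" using emb_eq_0_iff[of a] E[OF that(1)] that(2) by simp
    then have "- \<alpha> i \<le> ordQ i (emb a)" using E[OF that(1)] unfolding L_def by simp
    then show ?thesis unfolding v_def by simp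
  qed
  have "?E (- \<alpha> i - 1) = E" using bound by blast
  moreover have "v ` {a \<in> E. a \<noteq> \<zero>\<^bsub>FF\<^esub> \<and> - \<alpha> i - 1 < v a} = ordQ i ` (L \<alpha> - {0})"
  proof -
    have "{a \<in> E. a \<noteq> \<zero>\<^bsub>FF\<^esub> \<and> - \<alpha> i - 1 < v a} = {a \<in> E. emb a \<noteq> 0}"
      using bound E emb_eq_0_iff by (intro Collect_cong conj_cong refl) auto
    then have "v ` {a \<in> E. a \<noteq> \<zero>\<^bsub>FF\<^esub> \<and> - \<alpha> i - 1 < v a} = ordQ i ` emb ` {a \<in> E. emb a \<noteq> 0}"
      unfolding v_def image_image by simp
    also have "emb ` {a \<in> E. emb a \<noteq> 0} = emb ` E - {0}" by auto
    finally show ?thesis unfolding E_def emb_RR .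
  qed
  ultimately show ?thesis using main[of "- \<alpha> i - 1"] unfolding E_def by simp
qed

text \<open>
  The vector \<open>\<rho>\<^sub>Q(f)\<close>.
\<close>

definition pole :: "'b alg_closure ultra \<Rightarrow> 'm \<Rightarrow> int" where
  "pole f = (\<lambda>i. - ordQ i f)"

lemma semigroup_eq: "weierstrass_semigroup C Q = pole ` (regular_off - {0})"
proof -
  have rho: "rho C Q f = pole (emb f)" if "f \<in> carrier FF" "f \<noteq> \<zero>\<^bsub>FF\<^esub>" for f
    unfolding rho_def pole_def using valuation_at_Q[OF that] by simp
  have sub: "regular_outside C Q \<subseteq> carrier FF" unfolding regular_outside_def by blast
  have "weierstrass_semigroup C Q = (\<lambda>f. pole (emb f)) ` (regular_outside C Q - {\<zero>\<^bsub>FF\<^esub>})"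
    unfolding weierstrass_semigroup_def using rho sub by (intro image_cong) auto
  also have "\<dots> = pole ` emb ` (regular_outside C Q - {\<zero>\<^bsub>FF\<^esub>})" by (simp only: image_image)
  also have "emb ` (regular_outside C Q - {\<zero>\<^bsub>FF\<^esub>}) = regular_off - {0}"
  proof (intro Set.equalityI subsetI)
    fix z assume "z \<in> emb ` (regular_outside C Q - {\<zero>\<^bsub>FF\<^esub>})"
    then obtain f where "f \<in> regular_outside C Q" "f \<noteq> \<zero>\<^bsub>FF\<^esub>" "z = emb f" by blast
    moreover from this have "f \<in> carrier FF" using sub by blast
    ultimately show "z \<in> regular_off - {0}" using regular_outside_iff[of f] emb_eq_0_iff[of f] by simp
  next
    fix z assume z: "z \<in> regular_off - {0}"
    then have "z \<in> emb ` carrier FF" unfolding emb_image regular_off_def by blast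
    then obtain f where f: "f \<in> carrier FF" "z = emb f" by (elim imageE)
    then have "f \<in> regular_outside C Q - {\<zero>\<^bsub>FF\<^esub>}" using z regular_outside_iff[OF f(1)] emb_eq_0_iff[OF f(1)] by auto
    then show "z \<in> emb ` (regular_outside C Q - {\<zero>\<^bsub>FF\<^esub>})" using f(2) by blast
  qed
  finally show ?thesis .
qed

lemma L_iff_pole: "f \<noteq> 0 \<Longrightarrow> f \<in> L \<alpha> \<longleftrightarrow> f \<in> regular_off \<and> pole f \<le> \<alpha>"
  unfolding L_def pole_def le_fun_def by (auto simp: minus_le_iff)

text \<open>
  For the inclusion from right to left, a function whose pole vector has minimal sum among those with
  the given \<open>i\<close>-th coordinate realizes an absolute maximal element.
\<close>

theorem values_of_maximals:
  "(\<lambda>\<beta>. \<beta> i) ` maximals_below C Q \<alpha> = uminus ` ordQ i ` (L \<alpha> - {0})"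
proof (intro Set.equalityI subsetI)
  fix c assume "c \<in> (\<lambda>\<beta>. \<beta> i) ` maximals_below C Q \<alpha>"
  then obtain \<beta> where \<beta>: "c = \<beta> i" "\<beta> \<in> weierstrass_semigroup C Q" "\<beta> \<le> \<alpha>"
    unfolding maximals_below_def absolute_maximals_def by blast
  then obtain f where f: "f \<in> regular_off" "f \<noteq> 0" "\<beta> = pole f" unfolding semigroup_eq by blast
  then have "f \<in> L \<alpha> - {0}" using \<beta>(3) L_iff_pole[OF f(2)] by simp
  moreover have "c = - ordQ i f" unfolding \<beta>(1) f(3) pole_def ..
  ultimately show "c \<in> uminus ` ordQ i ` (L \<alpha> - {0})" by blast
next
  fix c assume "c \<in> uminus ` ordQ i ` (L \<alpha> - {0})"
  then obtain f0 where f0: "f0 \<in> L \<alpha>" "f0 \<noteq> 0" "c = - ordQ i f0" by blast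
  define F where "F = {f \<in> L \<alpha>. f \<noteq> 0 \<and> ordQ i f = - c}"
  define s where "s f = (\<Sum>j\<in>UNIV. ordQ j f)" for f
  have "finite F" "F \<noteq> {}" using finite_L[of \<alpha>] f0 unfolding F_def by auto
  then have "Max (s ` F) \<in> s ` F" by (intro Max_in) auto
  then obtain f where f: "f \<in> F" "s f = Max (s ` F)" by force
  have max: "s g \<le> s f" if "g \<in> F" for g
    unfolding f(2) using that \<open>finite F\<close> by (intro Max_ge) auto
  have s_less: "s f < s g" if "\<And>j. ordQ j f \<le> ordQ j g" "ordQ k f < ordQ k g" for g k
    unfolding s_def using that by (intro sum_strict_mono_ex1) auto
  have fL: "f \<in> L \<alpha>" "f \<noteq> 0" "ordQ i f = - c" using f(1) unfolding F_def by auto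
  have freg: "f \<in> regular_off" "pole f \<le> \<alpha>" using fL(1) L_iff_pole[OF fL(2)] by simp_all
  have "nabla C Q J (pole f) = {}" if J: "J \<noteq> {}" "J \<subset> UNIV" for J
  proof (rule ccontr)
    assume "nabla C Q J (pole f) \<noteq> {}"
    then obtain \<gamma> where \<gamma>: "\<gamma> \<in> weierstrass_semigroup C Q" "\<And>j. j \<in> J \<Longrightarrow> \<gamma> j = pole f j"
      "\<And>j. j \<notin> J \<Longrightarrow> \<gamma> j < pole f j"
      unfolding nabla_def by blast
    obtain g where g: "g \<in> regular_off" "g \<noteq> 0" "\<gamma> = pole g" using \<gamma>(1) unfolding semigroup_eq by blast
    have eqJ: "ordQ j g = ordQ j f" if "j \<in> J" for j using \<gamma>(2)[OF that] unfolding g(3) pole_def by simp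
    have lessJ: "ordQ j f < ordQ j g" if "j \<notin> J" for j using \<gamma>(3)[OF that] unfolding g(3) pole_def by simp
    have le: "ordQ j f \<le> ordQ j g" for j using eqJ[of j] lessJ[of j] by (cases "j \<in> J") auto
    have gL: "g \<in> L \<alpha>"
    proof -
      have "pole g \<le> pole f" unfolding pole_def le_fun_def using le by simp
      then show ?thesis using freg(2) g(1) L_iff_pole[OF g(2)] by simp
    qed
    show False
    \<comment> \<open>Either \<open>g\<close> or a combination \<open>f - base d * g\<close> belongs to \<open>F\<close> and has a larger sum of orders.\<close>
    proof (cases "i \<in> J")
      case True
      then have "g \<in> F" using gL g(2) eqJ fL(3) unfolding F_def by auto
      moreover obtain k where "k \<notin> J" using J(2) by blast
      ultimately show False using s_less[OF le lessJ] max[of g] by fastforce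
    next
      case False
      obtain j where j: "j \<in> J" using J(1) by blast
      obtain d where d: "f - base d * g = 0 \<or> ordQ j f < ordQ j (f - base d * g)"
        using leading_coefficient[OF L_K[OF fL(1)] L_K[OF gL] fL(2) g(2), of j] eqJ[OF j] by auto
      define h where "h = f - base d * g"
      have dg: "base d * g \<in> L \<alpha>" by (rule L_base_mult[OF gL])
      have dg_ord: "ordQ l f \<le> ordQ l (base d * g)" if "base d * g \<noteq> 0" for l
        using ord_base_mult[OF L_K[OF gL] g(2), of d l] le[of l] that by (cases "d = 0") auto
      have dg_i: "base d * g \<noteq> 0 \<longrightarrow> ordQ i f < ordQ i (base d * g)"
        using ord_base_mult[OF L_K[OF gL] g(2), of d i] lessJ[OF False] by (cases "d = 0") auto
      have hL: "h \<in> L \<alpha>" unfolding h_def by (rule L_diff[OF fL(1) dg])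
      have Ks: "f \<in> K" "base d * g \<in> K" "f - base d * g \<in> K" using L_K[OF fL(1)] L_K[OF dg] L_K[OF hL] unfolding h_def by simp_all
      have h: "h \<noteq> 0" "ordQ i h = - c"
        using D.ord_diff_dominant[OF Ks fL(2) dg_i] fL(3) unfolding h_def by simp_all
      have hF: "h \<in> F" using hL h unfolding F_def by blast
      have "ordQ l f \<le> ordQ l h" for l
        using D.le_ord_diff[OF Ks, of "ordQ l f" l] h(1) dg_ord[of l] unfolding h_def by simp
      moreover have "ordQ j f < ordQ j h" using d h(1) unfolding h_def by blast
      ultimately show False using s_less[of h j] max[OF hF] by simp
    qed
  qed
  then have "pole f \<in> absolute_maximals C Q"
    unfolding absolute_maximals_def semigroup_eq using freg(1) fL(2) by blast
  then have "pole f \<in> maximals_below C Q \<alpha>" unfolding maximals_below_def using freg(2) by blast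
  moreover have "c = pole f i" unfolding pole_def fL(3) by simp
  ultimately show "c \<in> (\<lambda>\<beta>. \<beta> i) ` maximals_below C Q \<alpha>" by blast
qed

theorem dimension_counts_classes:
  "finite (maximals_below C Q \<alpha> // coord_equiv (maximals_below C Q \<alpha>) i)"
  "FF.dimension (card (maximals_below C Q \<alpha> // coord_equiv (maximals_below C Q \<alpha>) i))
     consts (RR C Q \<alpha>)"
proof -
  have "finite (uminus ` ordQ i ` (L \<alpha> - {0}))" using finite_L by simp
  then show "finite (maximals_below C Q \<alpha> // coord_equiv (maximals_below C Q \<alpha>) i)"
    unfolding quotient_coord_equiv(1) values_of_maximals .
  have "card (uminus ` ordQ i ` (L \<alpha> - {0})) = card (ordQ i ` (L \<alpha> - {0}))"
    by (rule card_image) (simp add: inj_on_def)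
  then show "FF.dimension (card (maximals_below C Q \<alpha> // coord_equiv (maximals_below C Q \<alpha>) i))
     consts (RR C Q \<alpha>)"
    unfolding quotient_coord_equiv(2) values_of_maximals using dimension_RR by simp
qed

end

theorem theorem3p5:
  fixes C :: "('n::finite, 'a::{field,finite} alg_closure) ppoint set"
    and Q :: "'m::finite \<Rightarrow> ('n, 'a alg_closure) ppoint"
    and \<alpha> :: "'m \<Rightarrow> int"
  assumes "smooth_projective_curve C"
    and "CARD('m) \<ge> 2"
    and "CARD('a) \<ge> CARD('m)"
    and "\<And>i. Q i \<in> rational_points C"
    and "inj Q"
  shows "ring.finite_dimension (function_field C) (constant_functions C) (RR C Q \<alpha>) \<and>
    (\<forall>i. finite (maximals_below C Q \<alpha> // coord_equiv (maximals_below C Q \<alpha>) i) \<and>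
         ell C Q \<alpha> = card (maximals_below C Q \<alpha> // coord_equiv (maximals_below C Q \<alpha>) i)) \<and>
    (\<forall>i j. card (maximals_below C Q \<alpha> // coord_equiv (maximals_below C Q \<alpha>) i) =
           card (maximals_below C Q \<alpha> // coord_equiv (maximals_below C Q \<alpha>) j))"
proof -
  have C: "projective_over_base C" "zariski_irreducible C" "nonsingular_curve C"
    using assms(1) by (simp_all add: smooth_projective_curve_def)
  then have "C \<subseteq> proj_space" "C \<noteq> {}"
    by (auto simp: projective_over_base_def zero_locus_def zariski_irreducible_def)
  then obtain \<xi> :: "'n \<Rightarrow> 'a alg_closure ultra"
    where \<xi>: "\<And>p. homogeneous p \<Longrightarrow> vanishes_on p C \<longleftrightarrow> gen.mev \<xi> p = 0"
    using ex_generic_point[OF C(2)] by blast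
  interpret pointed_curve C \<xi> Q
    by unfold_locales (use C \<xi> \<open>C \<noteq> {}\<close> assms(4,5) in \<open>auto simp: nonsingular_curve_def\<close>)
  have ell: "ell C Q \<alpha> = card (maximals_below C Q \<alpha> // coord_equiv (maximals_below C Q \<alpha>) i)" for i
    unfolding ell_def
    using FF.dimI[OF constant_functions_subfield dimension_counts_classes(2)] unfolding over_def .
  moreover have "FF.finite_dimension (constant_functions C) (RR C Q \<alpha>)"
    using dimension_counts_classes(2) unfolding FF.finite_dimension_def by blast
  ultimately show ?thesis using dimension_counts_classes(1) by metis
qed

end
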